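(* Suppose that $A$ is a bounded operator in $L^2(\mathbb{R}^n)$ satisfying $$\sup_{X\in\mathbb{R}^{2n}}(2\pi)^{-n}\int_{\mathbb{R}^{2n}}\left|\frac{\langle A\Psi_{X+Z},\Psi_{X-Z}\rangle}{\langle\Psi_{X+Z},\Psi_{X-Z}\rangle}\right|e^{-\frac{|Z|^2}{2}}\,dZ<\infty.$$ Then there exists a bounded continuous function $G$ on $\mathbb{R}^{2n}$ such that $A=Op^{AW}(G)$. This function is given, for all $X\in\mathbb{R}^{2n}$, by $$G(X)=(2\pi)^{-n}\int_{\mathbb{R}^{2n}}\frac{\langle A\Psi_{X+Z},\Psi_{X-Z}\rangle}{\langle\Psi_{X+Z},\Psi_{X-Z}\rangle}\,e^{-\frac12|Z|^2}\,dZ.$$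
   Context: Here $\langle f,g\rangle=\int_{\mathbb{R}^n} f(u)\overline{g(u)}\,du$ is the $L^2(\mathbb{R}^n)$ inner product, and $|\cdot|$ is the Euclidean norm. For $X=(x,\xi)\in\mathbb{R}^{2n}$ (with $x,\xi\in\mathbb{R}^n$), the coherent state $\Psi_X\in L^2(\mathbb{R}^n)$ is $$\Psi_{x,\xi}(u)=\pi^{-n/4}e^{-\frac12|u-x|^2+iu\cdot\xi-\frac i2 x\cdot\xi}.$$ These satisfy $\langle\Psi_X,\Psi_Z\rangle=e^{-\frac{|X-Z|^2}{4}+\frac i2\sigma(X,Z)}$, where $\sigma((x,\xi),(y,\eta))=y\cdot\xi-x\cdot\eta$ (so the denominators never vanish). For $G$ bounded and continuous on $\mathbb{R}^{2n}$, the anti-Wick operator $Op^{AW}(G)$ is the unique (bounded) operator in $L^2(\mathbb{R}^n)$ such that for all $f,g\in L^2(\mathbb{R}^n)$ $$\langle Op^{AW}(G)f,g\rangle=(2\pi)^{-n}\int_{\mathbb{R}^{2n}}G(Z)\,\langle f,\Psi_Z\rangle\langle\Psi_Z,g\rangle\,dZ.$$ *)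

theory Defs
  imports "HOL-Analysis.Analysis"
begin

text \<open>
  Elements of \<open>L\<^sup>2(\<real>\<^sup>n)\<close> are represented by Borel measurable square-integrable functions,
  with equality in \<open>L\<^sup>2\<close> being equality almost everywhere (every class of Lebesgue measurable
  functions has a Borel representative).
\<close>

definition L2_space :: "(real ^ 'n \<Rightarrow> complex) set" where
  "L2_space = {f \<in> borel_measurable lborel. integrable lborel (\<lambda>u. (cmod (f u))\<^sup>2)}"

definition L2_inner :: "(real ^ 'n \<Rightarrow> complex) \<Rightarrow> (real ^ 'n \<Rightarrow> complex) \<Rightarrow> complex" where
  "L2_inner f g = (LINT u|lborel. f u * cnj (g u))"

definition L2_norm :: "(real ^ 'n \<Rightarrow> complex) \<Rightarrow> real" where
  "L2_norm f = sqrt (LINT u|lborel. (cmod (f u))\<^sup>2)"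

text \<open>
  A bounded operator in \<open>L\<^sup>2(\<real>\<^sup>n)\<close> is a map on representatives that induces a bounded
  complex-linear map on the quotient by almost everywhere equality.
  Its values outside \<^const>\<open>L2_space\<close> are irrelevant.
\<close>

definition bounded_L2_operator ::
    "((real ^ 'n \<Rightarrow> complex) \<Rightarrow> (real ^ 'n \<Rightarrow> complex)) \<Rightarrow> bool" where
  "bounded_L2_operator A \<longleftrightarrow>
     (\<forall>f\<in>L2_space. A f \<in> L2_space) \<and>
     (\<forall>f\<in>L2_space. \<forall>g\<in>L2_space.
        (AE u in lborel. f u = g u) \<longrightarrow> (AE u in lborel. A f u = A g u)) \<and>
     (\<forall>f\<in>L2_space. \<forall>g\<in>L2_space. AE u in lborel. A (\<lambda>v. f v + g v) u = A f u + A g u) \<and>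
     (\<forall>c. \<forall>f\<in>L2_space. AE u in lborel. A (\<lambda>v. c * f v) u = c * A f u) \<and>
     (\<exists>C. \<forall>f\<in>L2_space. L2_norm (A f) \<le> C * L2_norm f)"

text \<open>Phase space \<open>\<real>\<^sup>2\<^sup>n\<close> is \<open>\<real>\<^sup>n \<times> \<real>\<^sup>n\<close>, whose product norm is the Euclidean norm.\<close>

definition coherent_state :: "(real ^ 'n) \<times> (real ^ 'n) \<Rightarrow> real ^ 'n \<Rightarrow> complex" where
  "coherent_state = (\<lambda>(x, \<xi>) u.
     of_real (pi powr (- real CARD('n) / 4)) *
     exp (- of_real ((norm (u - x))\<^sup>2) / 2 + \<i> * of_real (u \<bullet> \<xi>) - \<i> / 2 * of_real (x \<bullet> \<xi>)))"

text \<open>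
  \<open>is_anti_Wick G A\<close> says that \<open>A = Op\<^sup>A\<^sup>W(G)\<close>, the equality being one of operators in
  \<open>L\<^sup>2(\<real>\<^sup>n)\<close>, i.e. up to null sets; see \<open>is_anti_Wick_unique\<close> and \<open>is_anti_Wick_cong\<close> below.
\<close>

definition is_anti_Wick ::
    "((real ^ 'n) \<times> (real ^ 'n) \<Rightarrow> complex) \<Rightarrow>
     ((real ^ 'n \<Rightarrow> complex) \<Rightarrow> (real ^ 'n \<Rightarrow> complex)) \<Rightarrow> bool" where
  "is_anti_Wick G A \<longleftrightarrow>
     bounded_L2_operator A \<and>
     (\<forall>f\<in>L2_space. \<forall>g\<in>L2_space.
        L2_inner (A f) g =
          of_real (1 / (2 * pi) ^ CARD('n)) *
          (LINT Z|lborel. G Z * L2_inner f (coherent_state Z) * L2_inner (coherent_state Z) g))"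

lemma L2_mult_cnj_integrable:
  fixes f g :: "real ^ 'n \<Rightarrow> complex"
  assumes "f \<in> L2_space" "g \<in> L2_space"
  shows "integrable lborel (\<lambda>u. f u * cnj (g u))"
proof (rule Bochner_Integration.integrable_bound)
  show "integrable lborel (\<lambda>u. (cmod (f u))\<^sup>2 + (cmod (g u))\<^sup>2)"
    using assms by (auto simp: L2_space_def)
  show "(\<lambda>u. f u * cnj (g u)) \<in> borel_measurable lborel"
  proof -
    have f: "f \<in> borel_measurable lborel" and g: "g \<in> borel_measurable lborel"
      using assms by (simp_all add: L2_space_def)
    have "continuous_on UNIV cnj" by (intro continuous_intros)
    from borel_measurable_continuous_on[OF this g] show ?thesis
      by (intro borel_measurable_times f)
  qed
  have "a * b \<le> a\<^sup>2 + b\<^sup>2" if "a \<ge> 0" "b \<ge> 0" for a b :: real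
    using that sum_squares_bound[of a b] mult_nonneg_nonneg[OF that] by linarith
  then show "AE u in lborel. norm (f u * cnj (g u)) \<le> norm ((cmod (f u))\<^sup>2 + (cmod (g u))\<^sup>2)"
    by (auto simp: norm_mult)
qed

lemma L2_diff:
  fixes f g :: "real ^ 'n \<Rightarrow> complex"
  assumes "f \<in> L2_space" "g \<in> L2_space"
  shows "(\<lambda>u. f u - g u) \<in> L2_space"
proof -
  have m: "(\<lambda>u. f u - g u) \<in> borel_measurable lborel"
    using assms by (intro borel_measurable_diff) (simp_all add: L2_space_def)
  have "integrable lborel (\<lambda>u. (cmod (f u - g u))\<^sup>2)"
  proof (rule Bochner_Integration.integrable_bound)
    show "integrable lborel (\<lambda>u. 2 * (cmod (f u))\<^sup>2 + 2 * (cmod (g u))\<^sup>2)"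
      using assms by (auto simp: L2_space_def)
    show "(\<lambda>u. (cmod (f u - g u))\<^sup>2) \<in> borel_measurable lborel"
      by (intro borel_measurable_power measurable_compose[OF m borel_measurable_norm])
    have "(cmod (a - b))\<^sup>2 \<le> 2 * (cmod a)\<^sup>2 + 2 * (cmod b)\<^sup>2" for a b
    proof -
      have "(cmod (a - b))\<^sup>2 \<le> (cmod a + cmod b)\<^sup>2"
        by (rule power_mono[OF norm_triangle_ineq4]) simp
      also have "\<dots> \<le> 2 * (cmod a)\<^sup>2 + 2 * (cmod b)\<^sup>2"
        using sum_squares_bound[of "cmod a" "cmod b"] by (simp add: power2_sum)
      finally show ?thesis .
    qed
    then show "AE u in lborel. norm ((cmod (f u - g u))\<^sup>2)
        \<le> norm (2 * (cmod (f u))\<^sup>2 + 2 * (cmod (g u))\<^sup>2)"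
      by auto
  qed
  with m show ?thesis by (simp add: L2_space_def)
qed

lemma is_anti_Wick_unique:
  fixes A B :: "(real ^ 'n \<Rightarrow> complex) \<Rightarrow> (real ^ 'n \<Rightarrow> complex)"
  assumes A: "is_anti_Wick G A" and B: "is_anti_Wick G B" and f: "f \<in> L2_space"
  shows "AE u in lborel. A f u = B f u"
proof -
  define h where "h = (\<lambda>u. A f u - B f u)"
  have Af: "A f \<in> L2_space" and Bf: "B f \<in> L2_space"
    using A B f by (auto simp: is_anti_Wick_def bounded_L2_operator_def)
  have h: "h \<in> L2_space" unfolding h_def by (rule L2_diff[OF Af Bf])
  have "L2_inner (A f) h = L2_inner (B f) h"
    using A B f h by (simp add: is_anti_Wick_def)
  moreover have "L2_inner h h = L2_inner (A f) h - L2_inner (B f) h"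
    using Bochner_Integration.integral_diff[OF L2_mult_cnj_integrable[OF Af h]
        L2_mult_cnj_integrable[OF Bf h]]
    by (simp add: L2_inner_def h_def left_diff_distrib)
  ultimately have "L2_inner h h = 0" by simp
  then have "complex_of_real (LINT u|lborel. (cmod (h u))\<^sup>2) = 0"
    by (simp only: L2_inner_def complex_norm_square[symmetric] integral_complex_of_real)
  then have "(LINT u|lborel. (cmod (h u))\<^sup>2) = 0"
    by (simp only: of_real_eq_0_iff)
  then have "AE u in lborel. (cmod (h u))\<^sup>2 = 0"
    using h by (subst (asm) integral_nonneg_eq_0_iff_AE) (auto simp: L2_space_def)
  then show ?thesis by (auto simp: h_def)
qed

lemma is_anti_Wick_cong:
  fixes A B :: "(real ^ 'n \<Rightarrow> complex) \<Rightarrow> (real ^ 'n \<Rightarrow> complex)"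
  assumes A: "is_anti_Wick G A" and B: "bounded_L2_operator B"
    and eq: "\<And>f. f \<in> L2_space \<Longrightarrow> AE u in lborel. A f u = B f u"
  shows "is_anti_Wick G B"
proof -
  have "L2_inner (B f) g = L2_inner (A f) g" if f: "f \<in> L2_space" and g: "g \<in> L2_space" for f g
    unfolding L2_inner_def
  proof (rule integral_cong_AE)
    have "A f \<in> L2_space" "B f \<in> L2_space"
      using A B f by (auto simp: is_anti_Wick_def bounded_L2_operator_def)
    then show "(\<lambda>u. B f u * cnj (g u)) \<in> borel_measurable lborel"
      "(\<lambda>u. A f u * cnj (g u)) \<in> borel_measurable lborel"
      using g by (blast intro: borel_measurable_integrable[OF L2_mult_cnj_integrable])+
    show "AE u in lborel. B f u * cnj (g u) = A f u * cnj (g u)"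
      using eq[OF f] by (rule eventually_mono) simp
  qed
  with A B show ?thesis by (simp add: is_anti_Wick_def)
qed

end

theory Submission
  imports Defs "HOL-Probability.Characteristic_Functions" "HOL-Complex_Analysis.Cauchy_Integral_Formula"
begin

text \<open>
  Identify \<open>(x, \<xi>)\<close> with \<open>x + \<i> \<xi>\<close>. Up to Gaussian factors the coherent states depend
  holomorphically on their parameter, so the quotient \<open>H p q\<close> of \<open>\<langle>A \<Psi>\<^sub>p, \<Psi>\<^sub>q\<rangle>\<close> by
  \<open>\<langle>\<Psi>\<^sub>p, \<Psi>\<^sub>q\<rangle>\<close> is an entire function of \<open>p\<close> and the conjugate of \<open>q\<close>. Since
  \<open>\<bar>p\<bar>\<^sup>2 + \<bar>q\<bar>\<^sup>2 = 2 (\<bar>X\<bar>\<^sup>2 + \<bar>Z\<bar>\<^sup>2)\<close> for \<open>p = X + Z\<close> and \<open>q = X - Z\<close>, the mean value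
  property of \<open>H\<close> with respect to a Gaussian in \<open>(X, Z)\<close>, followed by integration over \<open>Z\<close> (Fubini
  applies by the hypothesis on \<open>A\<close>), recovers \<open>H\<close> from a Gaussian transform of \<open>G\<close>. This transform is
  exactly the quotient \<open>H\<close> belonging to the anti-Wick operator of \<open>G\<close>, so both operators have the same
  matrix elements between coherent states, and these are total in \<open>L\<^sup>2\<close>. A second use of the mean
  value property, with a narrower Gaussian, writes \<open>G\<close> as an integral to which dominated convergence
  applies, which gives its continuity.
\<close>

subsection \<open>Gaussian integrals\<close>

text \<open>Continuity of \<open>G\<close> is the delicate point. The hypothesis bounds the
  integrals of the integrands of \<open>G X\<close> uniformly in \<open>X\<close>, but it supplies
  no common majorant for neighbouring \<open>X\<close>, so dominated convergence cannot be applied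
  to the defining formula itself. The two Gaussians used in the mean value property differ for a
  reason. The wider one is critical: its part in the half-difference variable is exactly consumed by
  the correction factor that makes the integrand holomorphic, so that convergence in this variable
  rests on the hypothesis alone. This leaves precisely the integrand of \<open>G\<close>, but a
  further integration over the centre would no longer converge absolutely. The narrower Gaussian has
  decay to spare, and that excess pays for the additional integration. The operator with symbol
  \<open>G\<close> is never constructed. Both sides are compared as bounded sesquilinear forms, for
  which agreement on pairs of coherent states suffices.\<close>

lemma gaussian_integral_real:
  fixes s t :: real
  assumes "s > 0"
  shows "integrable lborel (\<lambda>x. exp (- of_real (s * x\<^sup>2) + \<i> * of_real (x * t)))"
    and "(LINT x|lborel. exp (- of_real (s * x\<^sup>2) + \<i> * of_real (x * t))) =
           of_real (sqrt (pi / s) * exp (- t\<^sup>2 / (4 * s)))"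
proof -
  \<comment> \<open>The integrand of the characteristic function of the standard normal distribution
    at \<open>t / sqrt (2 * s)\<close>. Rescaling its variable by \<open>sqrt (2 * s)\<close> gives
    the required integrand up to the factor \<open>sqrt (2 * pi)\<close>.\<close>
  let ?f = "\<lambda>x. of_real (std_normal_density x) * exp (\<i> * of_real (x * (t / sqrt (2 * s)))) :: complex"
  let ?c = "sqrt (2 * s)"
  have c: "?c \<noteq> 0" "?c > 0" using assms by auto
  have int: "integrable lborel ?f"
  proof (rule Bochner_Integration.integrable_bound)
    show "integrable lborel std_normal_density" by simp
    show "?f \<in> borel_measurable lborel" by measurable
    show "AE x in lborel. norm (?f x) \<le> norm (std_normal_density x)"
      by (simp add: norm_mult)
  qed
  have val: "integral\<^sup>L lborel ?f = exp (- (t / ?c)\<^sup>2 / 2)"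
  proof -
    have "char std_normal_distribution (t / ?c) = integral\<^sup>L lborel ?f"
      unfolding char_def by (subst integral_density) (auto simp: scaleR_conv_of_real mult.commute)
    then show ?thesis by (simp add: char_std_normal_distribution)
  qed
  have eq: "exp (- of_real (s * x\<^sup>2) + \<i> * of_real (x * t)) = of_real (sqrt (2 * pi)) * ?f (0 + ?c * x)" for x
  proof -
    have "std_normal_density (?c * x) = exp (- (s * x\<^sup>2)) / sqrt (2 * pi)"
      using assms by (simp add: std_normal_density_def power_mult_distrib)
    moreover have "?c * x * (t / ?c) = x * t" using c by simp
    ultimately show ?thesis
      unfolding exp_add by (simp add: exp_of_real[symmetric] flip: of_real_mult)
  qed
  have "integrable lborel (\<lambda>x. ?f (0 + ?c * x))"
    by (rule lborel_integrable_real_affine[OF int c(1)])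
  then show "integrable lborel (\<lambda>x. exp (- of_real (s * x\<^sup>2) + \<i> * of_real (x * t)))"
    unfolding eq by (rule integrable_mult_right)
  have "integral\<^sup>L lborel ?f = ?c * (LINT x|lborel. ?f (0 + ?c * x))"
    using lborel_integral_real_affine[OF c(1), of ?f 0] c by (simp add: scaleR_conv_of_real)
  then have "(LINT x|lborel. ?f (0 + ?c * x)) = exp (- (t / ?c)\<^sup>2 / 2) / ?c"
    using val c by (simp add: field_simps)
  then show "(LINT x|lborel. exp (- of_real (s * x\<^sup>2) + \<i> * of_real (x * t))) =
           of_real (sqrt (pi / s) * exp (- t\<^sup>2 / (4 * s)))"
    unfolding eq integral_mult_right_zero using assms
    by (simp add: real_sqrt_divide real_sqrt_mult power_divide power_mult_distrib exp_of_real[symmetric])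
qed

text \<open>Both terms of the exponent are sums over coordinates, and Lebesgue measure is the image
  of a product measure, so the integral factors into one-dimensional ones.\<close>

lemma gaussian_integral:
  fixes t :: "'a::euclidean_space"
  assumes s: "s > 0"
  shows "integrable lborel (\<lambda>u::'a. exp (- of_real (s * (norm u)\<^sup>2) + \<i> * of_real (u \<bullet> t)))"
    and "(LINT u|lborel. exp (- of_real (s * (norm u)\<^sup>2) + \<i> * of_real (u \<bullet> t))) =
           of_real (sqrt (pi / s) ^ DIM('a) * exp (- (norm t)\<^sup>2 / (4 * s)))"
proof -
  interpret product_sigma_finite "\<lambda>b::'a. lborel :: real measure" ..
  let ?f = "\<lambda>b x. exp (- of_real (s * x\<^sup>2) + \<i> * of_real (x * (t \<bullet> b))) :: complex"
  let ?T = "\<lambda>f. \<Sum>b\<in>Basis. f b *\<^sub>R b :: 'a"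
  have L: "(lborel :: 'a measure) = distr (\<Pi>\<^sub>M b\<in>Basis. lborel) borel ?T"
    by (simp add: lborel_def[where 'a='a] lborel_eq_real)
  have T: "?T \<in> (\<Pi>\<^sub>M b\<in>Basis. lborel) \<rightarrow>\<^sub>M borel" by measurable
  have eq: "exp (- of_real (s * (norm u)\<^sup>2) + \<i> * of_real (u \<bullet> t)) = (\<Prod>b\<in>Basis. ?f b (u \<bullet> b))" for u :: 'a
  proof -
    have "- complex_of_real (s * (norm u)\<^sup>2) + \<i> * of_real (u \<bullet> t) =
      (\<Sum>b\<in>Basis. - of_real (s * (u \<bullet> b)\<^sup>2) + \<i> * of_real ((u \<bullet> b) * (t \<bullet> b)))"
      unfolding power2_norm_eq_inner euclidean_inner[of u u] euclidean_inner[of u t]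
      by (simp add: sum.distrib sum_subtractf sum_negf sum_distrib_left power2_eq_square)
    then show ?thesis by (simp add: exp_sum)
  qed
  have eq2: "(\<Prod>b\<in>Basis. ?f b (?T x \<bullet> b)) = (\<Prod>b\<in>Basis. ?f b (x b))" for x :: "'a \<Rightarrow> real"
    by (intro prod.cong refl) simp
  have meas: "(\<lambda>u. \<Prod>b\<in>Basis. ?f b (u \<bullet> b)) \<in> borel_measurable (borel :: 'a measure)" by measurable
  have "integrable (\<Pi>\<^sub>M b\<in>Basis. lborel) (\<lambda>x. \<Prod>b\<in>Basis. ?f b (x b))"
    using gaussian_integral_real(1)[OF s] by (intro product_integrable_prod) auto
  then show "integrable lborel (\<lambda>u::'a. exp (- of_real (s * (norm u)\<^sup>2) + \<i> * of_real (u \<bullet> t)))"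
    unfolding eq L by (subst integrable_distr_eq[OF T meas]) (simp only: eq2)
  have "(LINT u|lborel. (\<Prod>b\<in>Basis. ?f b (u \<bullet> b))) = (\<Prod>b\<in>Basis. integral\<^sup>L lborel (?f b))"
    unfolding L using gaussian_integral_real(1)[OF s]
    by (subst integral_distr[OF T meas], subst eq2) (intro product_integral_prod, auto)
  also have "\<dots> = (\<Prod>b\<in>Basis. of_real (sqrt (pi / s) * exp (- (t \<bullet> b)\<^sup>2 / (4 * s))))"
    using gaussian_integral_real(2)[OF s] by simp
  also have "\<dots> = of_real (sqrt (pi / s) ^ DIM('a) * exp (- (norm t)\<^sup>2 / (4 * s)))"
    unfolding power2_norm_eq_inner euclidean_inner[of t t]
    by (simp add: prod.distrib exp_sum sum_divide_distrib power2_eq_square flip: of_real_prod of_real_mult sum_negf)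
  finally show "(LINT u|lborel. exp (- of_real (s * (norm u)\<^sup>2) + \<i> * of_real (u \<bullet> t))) =
           of_real (sqrt (pi / s) ^ DIM('a) * exp (- (norm t)\<^sup>2 / (4 * s)))"
    unfolding eq .
qed

lemma gaussian_integrable:
  assumes "s > 0"
  shows "integrable lborel (\<lambda>u::'a::euclidean_space. exp (- (s * (norm u)\<^sup>2)))"
  using integrable_norm[OF gaussian_integral(1)[OF assms, of "0::'a"]] by simp

lemma gaussian_integral_0:
  assumes "s > 0"
  shows "(LINT u|lborel. exp (- (s * (norm (u::'a::euclidean_space))\<^sup>2))) = sqrt (pi / s) ^ DIM('a)"
proof -
  have "complex_of_real (LINT u|lborel. exp (- (s * (norm (u::'a))\<^sup>2))) = of_real (sqrt (pi / s) ^ DIM('a))"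
    using gaussian_integral(2)[OF assms, of "0::'a"]
    by (simp flip: integral_complex_of_real exp_of_real)
  then show ?thesis by (simp only: of_real_eq_iff)
qed

section \<open>Inner products of coherent states\<close>

definition sympl :: "(real ^ 'n) \<times> (real ^ 'n) \<Rightarrow> (real ^ 'n) \<times> (real ^ 'n) \<Rightarrow> real" where
  "sympl X Y = fst Y \<bullet> snd X - fst X \<bullet> snd Y"

text \<open>Completing the square: in \<open>u\<close> the two Gaussians multiply to one centred at
  the midpoint \<open>m\<close> of the positions, oscillating with frequency
  \<open>\<xi> - \<eta>\<close>. Its Fourier integral contributes the momentum part of
  \<open>norm (X - Z)\<close>; the constant \<open>K\<close> left over contributes the position part
  and the phase.\<close>

lemma coherent_state_inner:
  fixes X Z :: "(real ^ 'n) \<times> (real ^ 'n)"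
  shows "L2_inner (coherent_state X) (coherent_state Z) =
    exp (of_real (- (norm (X - Z))\<^sup>2 / 4) + \<i> / 2 * of_real (sympl X Z))"
proof -
  obtain x \<xi> where X: "X = (x, \<xi>)" by force
  obtain y \<eta> where Z: "Z = (y, \<eta>)" by force
  define m where "m = (1/2) *\<^sub>R (x + y)"
  define K where "K = of_real (pi powr (- real CARD('n) / 2)) * exp (of_real (- (norm (x - y))\<^sup>2 / 4) +
    \<i> * of_real (m \<bullet> (\<xi> - \<eta>)) - \<i>/2 * of_real (x \<bullet> \<xi> - y \<bullet> \<eta>))"
  let ?g = "\<lambda>v. exp (- of_real (1 * (norm v)\<^sup>2) + \<i> * of_real (v \<bullet> (\<xi> - \<eta>)))"
  have pp: "pi powr (- real CARD('n) / 4) * pi powr (- real CARD('n) / 4) = pi powr (- real CARD('n) / 2)"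
    by (simp flip: powr_add)
  have eq: "coherent_state X u * cnj (coherent_state Z u) = K * ?g (- m + u)" for u
  proof -
    have "(norm (u - x))\<^sup>2 / 2 + (norm (u - y))\<^sup>2 / 2 = (norm (x - y))\<^sup>2 / 4 + (norm (- m + u))\<^sup>2"
      unfolding m_def power2_norm_eq_inner
      by (simp add: inner_simps inner_commute field_simps)
    then have e: "- complex_of_real ((norm (u - x))\<^sup>2) / 2 - of_real ((norm (u - y))\<^sup>2) / 2 =
      - of_real ((norm (x - y))\<^sup>2) / 4 - of_real ((norm (- m + u))\<^sup>2)"
      by (simp add: complex_eq_iff)
    let ?c = "complex_of_real (pi powr (- real CARD('n) / 4))"
    let ?w = "\<lambda>x \<xi>. - complex_of_real ((norm (u - x))\<^sup>2) / 2 + \<i> * of_real (u \<bullet> \<xi>) - \<i> / 2 * of_real (x \<bullet> \<xi>)"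
    let ?k = "of_real (- (norm (x - y))\<^sup>2 / 4) + \<i> * of_real (m \<bullet> (\<xi> - \<eta>)) - \<i>/2 * of_real (x \<bullet> \<xi> - y \<bullet> \<eta>)"
    have "coherent_state X u * cnj (coherent_state Z u) = (?c * ?c) * exp (?w x \<xi> + cnj (?w y \<eta>))"
      unfolding X Z coherent_state_def case_prod_conv complex_cnj_mult complex_cnj_complex_of_real exp_cnj exp_add
      by (simp only: ac_simps)
    also have "?w x \<xi> + cnj (?w y \<eta>) =
       (- complex_of_real ((norm (u - x))\<^sup>2) / 2 - of_real ((norm (u - y))\<^sup>2) / 2) +
       (\<i> * of_real (u \<bullet> (\<xi> - \<eta>)) - \<i>/2 * of_real (x \<bullet> \<xi> - y \<bullet> \<eta>))"
      by (simp add: complex_eq_iff inner_diff_right diff_divide_distrib)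
    also have "\<dots> = ?k + (- of_real (1 * (norm (- m + u))\<^sup>2) + \<i> * of_real ((- m + u) \<bullet> (\<xi> - \<eta>)))"
      unfolding e by (simp add: complex_eq_iff inner_diff_left)
    also have "?c * ?c = of_real (pi powr (- real CARD('n) / 2))"
      unfolding pp[symmetric] by simp
    also have "of_real (pi powr (- real CARD('n) / 2)) * exp (?k + (- of_real (1 * (norm (- m + u))\<^sup>2) + \<i> * of_real ((- m + u) \<bullet> (\<xi> - \<eta>)))) = K * ?g (- m + u)"
      unfolding K_def exp_add by (simp only: mult.assoc)
    finally show ?thesis .
  qed
  have "L2_inner (coherent_state X) (coherent_state Z) = K * (LINT u|lborel. ?g (- m + u))"
    unfolding L2_inner_def eq by simp
  also have "(LINT u|lborel. ?g (- m + u)) = (LINT v|distr lborel borel ((+) (- m)). ?g v)"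
    by (subst integral_distr) auto
  also have "\<dots> = of_real (sqrt pi ^ CARD('n) * exp (- (norm (\<xi> - \<eta>))\<^sup>2 / 4))"
    unfolding lborel_distr_plus by (subst gaussian_integral(2)) auto
  also have "K * \<dots> = of_real (pi powr (- real CARD('n) / 2) * sqrt pi ^ CARD('n)) *
     exp (of_real (- (norm (x - y))\<^sup>2 / 4) + \<i> * of_real (m \<bullet> (\<xi> - \<eta>))
      - \<i>/2 * of_real (x \<bullet> \<xi> - y \<bullet> \<eta>) + of_real (- (norm (\<xi> - \<eta>))\<^sup>2 / 4))"
    unfolding K_def exp_add[of _ "of_real (- (norm (\<xi> - \<eta>))\<^sup>2 / 4)"] exp_of_real of_real_mult
    by (simp only: ac_simps)
  also have "pi powr (- real CARD('n) / 2) * sqrt pi ^ CARD('n) = 1"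
  proof -
    have "sqrt pi ^ CARD('n) = pi powr (real CARD('n) / 2)"
      by (simp add: powr_half_sqrt[symmetric] powr_powr powr_realpow[symmetric])
    then show ?thesis by (simp add: powr_minus)
  qed
  also have "of_real (- (norm (x - y))\<^sup>2 / 4) + \<i> * of_real (m \<bullet> (\<xi> - \<eta>))
      - \<i>/2 * of_real (x \<bullet> \<xi> - y \<bullet> \<eta>) + of_real (- (norm (\<xi> - \<eta>))\<^sup>2 / 4) =
      of_real (- (norm (X - Z))\<^sup>2 / 4) + \<i> / 2 * of_real (sympl X Z)"
    unfolding m_def X Z sympl_def complex_eq_iff by (simp add: norm_Pair inner_simps field_simps)
  finally show ?thesis by simp
qed

text \<open>Stated for an arbitrary measure because it serves both on \<real>^n and on phase space.
  Working with the nonnegative integral of the product of norms gives integrability and the bound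
  from a single estimate.\<close>

lemma L2_integral_Cauchy_Schwarz:
  fixes f g :: "'a \<Rightarrow> complex"
  assumes [measurable]: "f \<in> borel_measurable M" "g \<in> borel_measurable M"
    and f: "integrable M (\<lambda>u. (cmod (f u))\<^sup>2)" and g: "integrable M (\<lambda>u. (cmod (g u))\<^sup>2)"
  shows "integrable M (\<lambda>u. f u * g u)"
    and "cmod (LINT u|M. f u * g u) \<le> sqrt (LINT u|M. (cmod (f u))\<^sup>2) * sqrt (LINT u|M. (cmod (g u))\<^sup>2)"
proof -
  let ?F = "LINT u|M. (cmod (f u))\<^sup>2" and ?G = "LINT u|M. (cmod (g u))\<^sup>2"
  have nn: "?F \<ge> 0" "?G \<ge> 0" by auto
  let ?I = "\<integral>\<^sup>+u. ennreal (cmod (f u)) * ennreal (cmod (g u)) \<partial>M"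
  have "?I\<^sup>2 \<le> (\<integral>\<^sup>+u. ennreal (cmod (f u)) ^ 2 \<partial>M) * (\<integral>\<^sup>+u. ennreal (cmod (g u)) ^ 2 \<partial>M)"
    by (rule Cauchy_Schwarz_nn_integral) auto
  also have "\<dots> = ennreal (?F * ?G)"
    using nn_integral_eq_integral[OF f] nn_integral_eq_integral[OF g]
    by (simp add: ennreal_mult ennreal_power)
  finally have I2: "?I\<^sup>2 \<le> ennreal (?F * ?G)" .
  then have "?I \<noteq> \<infinity>" by (auto simp: power2_eq_square top_unique)
  then obtain r where r: "?I = ennreal r" "r \<ge> 0" by (cases ?I) auto
  have "r\<^sup>2 \<le> ?F * ?G" using I2 r nn by (simp add: ennreal_power)
  then have r_le: "r \<le> sqrt ?F * sqrt ?G"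
    using r(2) by (simp add: real_le_rsqrt real_sqrt_mult[symmetric])
  have I: "(\<integral>\<^sup>+u. norm (f u * g u) \<partial>M) = ennreal r"
    using r by (simp add: norm_mult ennreal_mult)
  then show int: "integrable M (\<lambda>u. f u * g u)"
    by (intro integrableI_bounded) auto
  have "ennreal (cmod (LINT u|M. f u * g u)) \<le> ennreal r"
    using integral_norm_bound_ennreal[OF int] I by simp
  then show "cmod (LINT u|M. f u * g u) \<le> sqrt ?F * sqrt ?G"
    using r r_le by simp
qed

lemma lborel_shift:
  fixes f :: "'a::euclidean_space \<Rightarrow> 'b::{banach, second_countable_topology}"
  assumes [measurable]: "f \<in> borel_measurable borel"
  shows "(LINT u|lborel. f (c + u)) = (LINT u|lborel. f u)"
    and "integrable lborel (\<lambda>u. f (c + u)) \<longleftrightarrow> integrable lborel f"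
proof -
  have m: "f \<in> borel_measurable borel" by fact
  have "integral\<^sup>L (distr lborel borel ((+) c)) f = (LINT u|lborel. f (c + u))"
    by (subst integral_distr) auto
  then show "(LINT u|lborel. f (c + u)) = (LINT u|lborel. f u)"
    unfolding lborel_distr_plus by simp
  have "integrable (distr lborel borel ((+) c)) f \<longleftrightarrow> integrable lborel (\<lambda>u. f (c + u))"
    by (subst integrable_distr_eq) auto
  then show "integrable lborel (\<lambda>u. f (c + u)) \<longleftrightarrow> integrable lborel f"
    unfolding lborel_distr_plus by simp
qed

lemma lborel_shift_nn:
  fixes f :: "'a::euclidean_space \<Rightarrow> ennreal"
  assumes [measurable]: "f \<in> borel_measurable borel"
  shows "(\<integral>\<^sup>+u. f (c + u) \<partial>lborel) = (\<integral>\<^sup>+u. f u \<partial>lborel)"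
proof -
  have "(\<integral>\<^sup>+u. f u \<partial>distr lborel borel ((+) c)) = (\<integral>\<^sup>+u. f (c + u) \<partial>lborel)"
    by (subst nn_integral_distr) auto
  then show ?thesis unfolding lborel_distr_plus by simp
qed

subsection \<open>Square-integrable functions\<close>

lemma L2_measurable [measurable_dest]: "f \<in> L2_space \<Longrightarrow> f \<in> borel_measurable borel"
  and L2_integrable: "f \<in> L2_space \<Longrightarrow> integrable lborel (\<lambda>u. (cmod (f u))\<^sup>2)"
  by (simp_all add: L2_space_def)

lemma borel_measurable_cnj [measurable (raw)]:
  "f \<in> borel_measurable M \<Longrightarrow> (\<lambda>x. cnj (f x)) \<in> borel_measurable M"
  by (rule borel_measurable_continuous_on[where f=cnj]) (auto intro: continuous_intros)

lemma L2_cmult: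
  assumes "f \<in> L2_space"
  shows "(\<lambda>u. c * f u) \<in> L2_space"
  using assms by (auto simp: L2_space_def norm_mult power_mult_distrib)

lemma L2_add:
  assumes "f \<in> L2_space" "g \<in> L2_space"
  shows "(\<lambda>u. f u + g u) \<in> L2_space"
  using L2_diff[OF assms(1) L2_cmult[OF assms(2), of "-1"]] by simp

lemma L2_bound:
  assumes "g \<in> L2_space" and [measurable]: "f \<in> borel_measurable borel"
    and "\<And>u. cmod (f u) \<le> cmod (g u)"
  shows "f \<in> L2_space"
proof -
  have "integrable lborel (\<lambda>u. (cmod (f u))\<^sup>2)"
    by (rule Bochner_Integration.integrable_bound[OF L2_integrable[OF assms(1)]])
      (auto simp: power_mono assms(3))
  then show ?thesis by (simp add: L2_space_def)
qed

lemma L2_inner_add: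
  assumes "f \<in> L2_space" "g \<in> L2_space" "h \<in> L2_space"
  shows "L2_inner (\<lambda>u. f u + g u) h = L2_inner f h + L2_inner g h"
    and "L2_inner h (\<lambda>u. f u + g u) = L2_inner h f + L2_inner h g"
  using assms by (auto simp: L2_inner_def algebra_simps L2_mult_cnj_integrable)

lemma L2_inner_diff:
  assumes "f \<in> L2_space" "g \<in> L2_space" "h \<in> L2_space"
  shows "L2_inner (\<lambda>u. f u - g u) h = L2_inner f h - L2_inner g h"
    and "L2_inner h (\<lambda>u. f u - g u) = L2_inner h f - L2_inner h g"
  using assms by (auto simp: L2_inner_def algebra_simps L2_mult_cnj_integrable)

lemma L2_inner_cmult:
  "L2_inner (\<lambda>u. c * f u) h = c * L2_inner f h"
  "L2_inner h (\<lambda>u. c * f u) = cnj c * L2_inner h f"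
proof -
  show "L2_inner (\<lambda>u. c * f u) h = c * L2_inner f h"
    by (simp add: L2_inner_def mult.assoc)
  have "(\<lambda>u. h u * cnj (c * f u)) = (\<lambda>u. cnj c * (h u * cnj (f u)))" by (auto simp: ac_simps)
  then show "L2_inner h (\<lambda>u. c * f u) = cnj c * L2_inner h f"
    by (simp add: L2_inner_def)
qed

lemma L2_inner_cnj: "L2_inner g f = cnj (L2_inner f g)"
  using Bochner_Integration.integral_cnj[of lborel "\<lambda>u. f u * cnj (g u)"]
  by (simp add: L2_inner_def mult.commute del: Bochner_Integration.integral_cnj)

lemma L2_inner_cong_AE:
  assumes "f \<in> L2_space" "g \<in> L2_space" "h \<in> L2_space" "AE u in lborel. f u = g u"
  shows "L2_inner f h = L2_inner g h"
  unfolding L2_inner_def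
proof (rule integral_cong_AE)
  show "(\<lambda>u. f u * cnj (h u)) \<in> borel_measurable lborel"
    "(\<lambda>u. g u * cnj (h u)) \<in> borel_measurable lborel"
    using assms by (blast intro: borel_measurable_integrable[OF L2_mult_cnj_integrable])+
  show "AE u in lborel. f u * cnj (h u) = g u * cnj (h u)"
    using assms(4) by eventually_elim simp
qed

lemma L2_inner_self: "L2_inner f f = of_real ((L2_norm f)\<^sup>2)"
  by (simp add: L2_inner_def L2_norm_def complex_norm_square[symmetric]
      del: of_real_power)

lemma L2_norm_nonneg [simp]: "L2_norm f \<ge> 0"
  by (simp add: L2_norm_def)

lemma L2_inner_le:
  assumes "f \<in> L2_space" "g \<in> L2_space"
  shows "cmod (L2_inner f g) \<le> L2_norm f * L2_norm g"
proof -
  note [measurable] = assms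
  have "(\<lambda>u. cnj (g u)) \<in> borel_measurable lborel" by measurable
  then show ?thesis
    unfolding L2_inner_def L2_norm_def
    using L2_integral_Cauchy_Schwarz(2)[of f lborel "\<lambda>u. cnj (g u)"] L2_integrable[OF assms(1)] L2_integrable[OF assms(2)]
    by simp
qed

lemma L2_norm_cmult: "L2_norm (\<lambda>u. c * f u) = cmod c * L2_norm f"
  by (simp add: L2_norm_def norm_mult power_mult_distrib real_sqrt_mult)

lemma L2_norm_add:
  assumes "f \<in> L2_space" "g \<in> L2_space"
  shows "L2_norm (\<lambda>u. f u + g u) \<le> L2_norm f + L2_norm g"
proof -
  let ?h = "\<lambda>u. f u + g u"
  have "of_real ((L2_norm ?h)\<^sup>2) = L2_inner ?h ?h" by (simp only: L2_inner_self)
  also have "\<dots> = L2_inner f f + L2_inner f g + L2_inner g f + L2_inner g g"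
    using assms by (simp add: L2_inner_add L2_add)
  finally have "(L2_norm ?h)\<^sup>2 = (L2_norm f)\<^sup>2 + Re (L2_inner f g) + Re (L2_inner g f) + (L2_norm g)\<^sup>2"
    by (simp add: L2_inner_self complex_eq_iff)
  also have "\<dots> \<le> (L2_norm f)\<^sup>2 + L2_norm f * L2_norm g + L2_norm g * L2_norm f + (L2_norm g)\<^sup>2"
    using complex_Re_le_cmod[of "L2_inner f g"] complex_Re_le_cmod[of "L2_inner g f"]
      L2_inner_le[OF assms] L2_inner_le[OF assms(2,1)] by linarith
  also have "\<dots> = (L2_norm f + L2_norm g)\<^sup>2"
    by (simp add: power2_sum)
  finally show ?thesis by (rule power2_le_imp_le) simp
qed

lemma L2_norm_diff_triangle:
  assumes "f \<in> L2_space" "g \<in> L2_space" "h \<in> L2_space"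
  shows "L2_norm (\<lambda>u. f u - h u) \<le> L2_norm (\<lambda>u. f u - g u) + L2_norm (\<lambda>u. g u - h u)"
  using L2_norm_add[OF L2_diff[OF assms(1,2)] L2_diff[OF assms(2,3)]] by simp

lemma L2_norm_mono:
  assumes "g \<in> L2_space" and [measurable]: "f \<in> borel_measurable borel"
    and "\<And>u. cmod (f u) \<le> cmod (g u)"
  shows "L2_norm f \<le> L2_norm g"
  unfolding L2_norm_def using assms L2_bound[OF assms] L2_integrable
  by (intro real_sqrt_le_mono integral_mono) (auto intro: power_mono)

lemma L2_norm_dominated_convergence:
  fixes f :: "real ^ 'n \<Rightarrow> complex"
  assumes "\<And>k. s k \<in> L2_space" "f \<in> L2_space" "w \<in> L2_space"
    and "\<And>k u. cmod (s k u) \<le> cmod (w u)" and "\<And>u. (\<lambda>k. s k u) \<longlonglongrightarrow> f u"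
  shows "(\<lambda>k. L2_norm (\<lambda>u. f u - s k u)) \<longlonglongrightarrow> 0"
proof -
  note [measurable] = assms(1,2,3)
  have le: "cmod (f u) \<le> cmod (w u)" for u
    by (rule tendsto_upperbound[OF tendsto_norm[OF assms(5)]]) (auto simp: assms(4))
  have "(\<lambda>k. LINT u|lborel. (cmod (f u - s k u))\<^sup>2) \<longlonglongrightarrow> (LINT u::real^'n|lborel. 0 :: real)"
  proof (rule integral_dominated_convergence[where w="\<lambda>u. 4 * (cmod (w u))\<^sup>2"])
    show "integrable lborel (\<lambda>u. 4 * (cmod (w u))\<^sup>2)" using L2_integrable[OF assms(3)] by simp
    have "(\<lambda>k. (cmod (f u - s k u))\<^sup>2) \<longlonglongrightarrow> (cmod (f u - f u))\<^sup>2" for u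
      by (intro tendsto_intros assms(5))
    then show "AE u in lborel. (\<lambda>k. (cmod (f u - s k u))\<^sup>2) \<longlonglongrightarrow> 0" by simp
    have "cmod (f u - s k u) \<le> 2 * cmod (w u)" for k u
      using norm_triangle_ineq4[of "f u" "s k u"] le[of u] assms(4)[of k u] by linarith
    then have "(cmod (f u - s k u))\<^sup>2 \<le> (2 * cmod (w u))\<^sup>2" for k u
      by (intro power_mono) auto
    then show "AE u in lborel. norm ((cmod (f u - s k u))\<^sup>2) \<le> 4 * (cmod (w u))\<^sup>2" for k
      by (simp add: power_mult_distrib)
  qed auto
  then have "(\<lambda>k. sqrt (LINT u|lborel. (cmod (f u - s k u))\<^sup>2)) \<longlonglongrightarrow> sqrt 0"
    by (intro tendsto_real_sqrt) simp
  then show ?thesis by (simp add: L2_norm_def)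
qed

section \<open>Regularity and normalisation of coherent states\<close>

lemma coherent_state_continuous: "continuous_on UNIV (coherent_state Z)"
  unfolding coherent_state_def case_prod_beta by (intro continuous_intros) auto

lemma coherent_state_measurable [measurable]: "coherent_state Z \<in> borel_measurable borel"
  by (rule borel_measurable_continuous_onI[OF coherent_state_continuous])

lemma norm_coherent_state:
  fixes Z :: "(real ^ 'n) \<times> (real ^ 'n)"
  shows "cmod (coherent_state Z u) = pi powr (- real CARD('n) / 4) * exp (- (norm (u - fst Z))\<^sup>2 / 2)"
  by (simp add: coherent_state_def case_prod_beta norm_mult)

lemma coherent_state_L2 [simp]:
  fixes Z :: "(real ^ 'n) \<times> (real ^ 'n)"
  shows "coherent_state Z \<in> L2_space"
proof -
  have "(cmod (coherent_state Z u))\<^sup>2 =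
      (pi powr (- real CARD('n) / 4))\<^sup>2 * exp (- (1 * (norm (- fst Z + u))\<^sup>2))" for u
    by (simp add: norm_coherent_state power_mult_distrib exp_double[symmetric])
  moreover have "integrable lborel (\<lambda>u::real^'n. exp (- (1 * (norm (- fst Z + u))\<^sup>2)))"
    by (subst lborel_shift(2)) (auto intro: gaussian_integrable[of 1, simplified])
  ultimately show ?thesis by (simp add: L2_space_def)
qed

lemma L2_norm_coherent_state [simp]: "L2_norm (coherent_state Z) = 1"
proof -
  have "complex_of_real ((L2_norm (coherent_state Z))\<^sup>2) = of_real 1"
    unfolding L2_inner_self[symmetric] coherent_state_inner by (simp add: sympl_def inner_commute)
  then have "(L2_norm (coherent_state Z))\<^sup>2 = 1" by (simp only: of_real_eq_iff)
  then show ?thesis using L2_norm_nonneg[of "coherent_state Z"] by (simp add: power2_eq_1_iff)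
qed

subsection \<open>Totality of the coherent states\<close>

text \<open>Linear combinations are generated inductively so that statements about them reduce to
  pairs of coherent states by induction on each argument.\<close>

inductive_set coherent_span :: "(real ^ 'n \<Rightarrow> complex) set" where
  base: "coherent_state Z \<in> coherent_span"
| add: "f \<in> coherent_span \<Longrightarrow> g \<in> coherent_span \<Longrightarrow> (\<lambda>u. f u + g u) \<in> coherent_span"
| cmult: "f \<in> coherent_span \<Longrightarrow> (\<lambda>u. c * f u) \<in> coherent_span"

lemma coherent_span_L2: "f \<in> coherent_span \<Longrightarrow> f \<in> L2_space"
  by (induction rule: coherent_span.induct) (auto intro: L2_add L2_cmult)

definition coherent_closure :: "(real ^ 'n \<Rightarrow> complex) set" where
  "coherent_closure = {f \<in> L2_space. \<forall>e>0. \<exists>g\<in>coherent_span. L2_norm (\<lambda>u. f u - g u) < e}"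

lemma coherent_closure_L2: "f \<in> coherent_closure \<Longrightarrow> f \<in> L2_space"
  by (simp add: coherent_closure_def)

lemma coherent_closure_approx:
  assumes "f \<in> coherent_closure" "e > 0"
  obtains g where "g \<in> coherent_span" "L2_norm (\<lambda>u. f u - g u) < e"
  using assms by (auto simp: coherent_closure_def)

lemma coherent_span_closure: "f \<in> coherent_span \<Longrightarrow> f \<in> coherent_closure"
  by (auto simp: coherent_closure_def coherent_span_L2 L2_norm_def intro!: bexI[of _ f])

lemma coherent_closure_closed:
  assumes f: "f \<in> L2_space"
    and "\<And>e. e > 0 \<Longrightarrow> \<exists>g\<in>coherent_closure. L2_norm (\<lambda>u. f u - g u) < e"
  shows "f \<in> coherent_closure"
  unfolding coherent_closure_def
proof (safe intro!: f)
  fix e :: real assume "e > 0"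
  then obtain g where g: "g \<in> coherent_closure" "L2_norm (\<lambda>u. f u - g u) < e / 2"
    using assms(2)[of "e/2"] by auto
  from coherent_closure_approx[OF g(1), of "e/2"] \<open>e > 0\<close> obtain h
    where h: "h \<in> coherent_span" "L2_norm (\<lambda>u. g u - h u) < e / 2" by auto
  have "L2_norm (\<lambda>u. f u - h u) < e"
    using L2_norm_diff_triangle[OF f coherent_closure_L2[OF g(1)] coherent_span_L2[OF h(1)]] g h by linarith
  then show "\<exists>g\<in>coherent_span. L2_norm (\<lambda>u. f u - g u) < e" using h by blast
qed

lemma coherent_closure_dominated:
  assumes s: "\<And>k. s k \<in> coherent_closure" and w: "w \<in> L2_space"
    and f [measurable]: "f \<in> borel_measurable borel"
    and bound: "\<And>k u. cmod (s k u) \<le> cmod (w u)" and lim: "\<And>u. (\<lambda>k. s k u) \<longlonglongrightarrow> f u"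
  shows "f \<in> coherent_closure"
proof (rule coherent_closure_closed)
  have "cmod (f u) \<le> cmod (w u)" for u
    by (rule tendsto_upperbound[OF tendsto_norm[OF lim]]) (auto simp: bound)
  then show f2: "f \<in> L2_space" by (intro L2_bound[OF w f])
  fix e :: real assume "e > 0"
  have "(\<lambda>k. L2_norm (\<lambda>u. f u - s k u)) \<longlonglongrightarrow> 0"
    using L2_norm_dominated_convergence[OF coherent_closure_L2[OF s] f2 w bound lim] .
  then have "eventually (\<lambda>k. L2_norm (\<lambda>u. f u - s k u) < e) sequentially"
    using \<open>e > 0\<close> by (simp add: order_tendsto_iff)
  then show "\<exists>g\<in>coherent_closure. L2_norm (\<lambda>u. f u - g u) < e"
    using s by (auto simp: eventually_sequentially)
qed

lemma coherent_closure_add: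
  assumes "f \<in> coherent_closure" "g \<in> coherent_closure"
  shows "(\<lambda>u. f u + g u) \<in> coherent_closure"
  unfolding coherent_closure_def
proof (intro CollectI conjI allI impI)
  show "(\<lambda>u. f u + g u) \<in> L2_space" by (intro L2_add coherent_closure_L2 assms)
  fix e :: real assume "e > 0"
  then obtain f' g' where f': "f' \<in> coherent_span" "L2_norm (\<lambda>u. f u - f' u) < e / 2"
    and g': "g' \<in> coherent_span" "L2_norm (\<lambda>u. g u - g' u) < e / 2"
    using coherent_closure_approx[OF assms(1), of "e/2"] coherent_closure_approx[OF assms(2), of "e/2"]
    by (metis half_gt_zero)
  have "L2_norm (\<lambda>u. (f u - f' u) + (g u - g' u)) < e"
    using L2_norm_add[of "\<lambda>u. f u - f' u" "\<lambda>u. g u - g' u"] assms f' g'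
    by (force simp: L2_diff coherent_closure_L2 coherent_span_L2)
  then show "\<exists>h\<in>coherent_span. L2_norm (\<lambda>u. (f u + g u) - h u) < e"
    by (intro bexI[OF _ coherent_span.add[OF f'(1) g'(1)]]) (simp add: algebra_simps)
qed

lemma coherent_closure_mult_bounded:
  assumes [measurable]: "r \<in> borel_measurable borel" and "\<And>u. cmod (r u) \<le> K" and "f \<in> coherent_closure"
    and *: "\<And>g. g \<in> coherent_span \<Longrightarrow> (\<lambda>u. r u * g u) \<in> coherent_span"
  shows "(\<lambda>u. r u * f u) \<in> coherent_closure"
  unfolding coherent_closure_def
proof (safe)
  note [measurable] = coherent_closure_L2[OF assms(3)]
  have K: "K \<ge> 0" using assms(2) norm_ge_zero order_trans by blast
  have bd: "cmod (r u * z) \<le> cmod (of_real K * z)" for u z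
    using assms(2)[of u] K by (auto simp: norm_mult intro!: mult_right_mono)
  show "(\<lambda>u. r u * f u) \<in> L2_space"
    by (rule L2_bound[OF L2_cmult[OF coherent_closure_L2[OF assms(3)], of "of_real K"]])
      (measurable, simp add: bd)
  fix e :: real assume e: "e > 0"
  \<comment> \<open>\<open>K + 1\<close> in place of \<open>K\<close>, since \<open>K\<close> may be
    0.\<close>
  then have "e / (K + 1) > 0" using K by simp
  from coherent_closure_approx[OF assms(3) this]
  obtain g where g: "g \<in> coherent_span" "L2_norm (\<lambda>u. f u - g u) < e / (K + 1)" .
  note [measurable] = coherent_span_L2[OF g(1)]
  have "L2_norm (\<lambda>u. r u * (f u - g u)) \<le> L2_norm (\<lambda>u. of_real K * (f u - g u))"
    by (intro L2_norm_mono L2_cmult L2_diff)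
      (auto simp: bd coherent_closure_L2[OF assms(3)] coherent_span_L2[OF g(1)])
  also have "\<dots> \<le> (K + 1) * L2_norm (\<lambda>u. f u - g u)"
    using K by (simp add: L2_norm_cmult mult_right_mono)
  also have "\<dots> < e" using g(2) K by (simp add: field_simps)
  finally show "\<exists>h\<in>coherent_span. L2_norm (\<lambda>u. r u * f u - h u) < e"
    by (intro bexI[OF _ *[OF g(1)]]) (simp add: right_diff_distrib)
qed

lemma coherent_closure_cmult:
  assumes "f \<in> coherent_closure"
  shows "(\<lambda>u. c * f u) \<in> coherent_closure"
  using coherent_closure_mult_bounded[of "\<lambda>_. c" "cmod c" f] assms by (simp add: coherent_span.cmult)

text \<open>The multipliers form an algebra closed under pointwise limits of sequences bounded by 1.
  It contains the characters, and this closure property leads from them to the indicators of all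
  Borel sets. That measure-theoretic route takes the place of Fourier uniqueness in the proof of
  totality.\<close>

definition coherent_multiplier :: "(real ^ 'n \<Rightarrow> complex) set" where
  "coherent_multiplier =
    {r \<in> borel_measurable borel. \<forall>f\<in>coherent_closure. (\<lambda>u. r u * f u) \<in> coherent_closure}"

lemma coherent_multiplier_const: "(\<lambda>u. c) \<in> coherent_multiplier"
  by (simp add: coherent_multiplier_def coherent_closure_cmult)

lemma coherent_multiplier_mult:
  "r \<in> coherent_multiplier \<Longrightarrow> s \<in> coherent_multiplier \<Longrightarrow> (\<lambda>u. r u * s u) \<in> coherent_multiplier"
  by (auto simp: coherent_multiplier_def mult.assoc)

lemma coherent_multiplier_add:
  "r \<in> coherent_multiplier \<Longrightarrow> s \<in> coherent_multiplier \<Longrightarrow> (\<lambda>u. r u + s u) \<in> coherent_multiplier"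
  by (auto simp: coherent_multiplier_def distrib_right coherent_closure_add)

lemma coherent_multiplier_diff:
  assumes "r \<in> coherent_multiplier" "s \<in> coherent_multiplier"
  shows "(\<lambda>u. r u - s u) \<in> coherent_multiplier"
proof -
  have "(\<lambda>u. r u + (-1) * s u) \<in> coherent_multiplier"
    by (intro coherent_multiplier_add coherent_multiplier_mult coherent_multiplier_const assms)
  then show ?thesis by simp
qed

text \<open>Dominated convergence, with \<open>f\<close> itself dominating the products of
  \<open>s k\<close> and \<open>f\<close>.\<close>

lemma coherent_multiplier_lim:
  assumes s: "\<And>k. s k \<in> coherent_multiplier" and bound: "\<And>k u. cmod (s k u) \<le> 1"
    and lim: "\<And>u. (\<lambda>k. s k u) \<longlonglongrightarrow> r u"
  shows "r \<in> coherent_multiplier"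
  unfolding coherent_multiplier_def
proof safe
  show [measurable]: "r \<in> borel_measurable borel"
  proof (rule borel_measurable_LIMSEQ_metric[OF _ lim])
    show "s k \<in> borel_measurable borel" for k using s[of k] by (simp add: coherent_multiplier_def)
  qed
  fix f :: "real ^ 'a \<Rightarrow> complex" assume f: "f \<in> coherent_closure"
  note [measurable] = coherent_closure_L2[OF f]
  show "(\<lambda>u. r u * f u) \<in> coherent_closure"
  proof (rule coherent_closure_dominated[where s="\<lambda>k u. s k u * f u" and w=f])
    show "(\<lambda>u. s k u * f u) \<in> coherent_closure" for k using s[of k] f by (simp add: coherent_multiplier_def)
    show "cmod (s k u * f u) \<le> cmod (f u)" for k u
      unfolding norm_mult by (rule mult_left_le_one_le) (use bound[of k u] in auto)
    show "(\<lambda>k. s k u * f u) \<longlonglongrightarrow> r u * f u" for u by (intro tendsto_intros lim)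
    show "f \<in> L2_space" by (rule coherent_closure_L2[OF f])
    show "(\<lambda>u. r u * f u) \<in> borel_measurable borel" by measurable
  qed
qed

text \<open>Multiplication by a character shifts the momentum of a coherent state by
  \<open>t\<close>, up to a constant phase, and therefore preserves the span.\<close>

lemma coherent_multiplier_exp:
  "(\<lambda>u. exp (\<i> * of_real (u \<bullet> t))) \<in> coherent_multiplier"
proof -
  have sp: "(\<lambda>u. exp (\<i> * of_real (u \<bullet> t)) * g u) \<in> coherent_span" if "g \<in> coherent_span" for g
    using that
  proof induction
    case (base Z)
    have "(\<lambda>u. exp (\<i> * of_real (u \<bullet> t)) * coherent_state Z u) =
      (\<lambda>u. exp (\<i> / 2 * of_real (fst Z \<bullet> t)) * coherent_state (fst Z, snd Z + t) u)"
    proof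
      fix u
      let ?E = "\<lambda>t. - complex_of_real ((norm (u - fst Z))\<^sup>2) / 2 + \<i> * of_real (u \<bullet> t) - \<i> / 2 * of_real (fst Z \<bullet> t)"
      have "\<i> * of_real (u \<bullet> t) + ?E (snd Z) = \<i> / 2 * of_real (fst Z \<bullet> t) + ?E (snd Z + t)"
        by (simp add: complex_eq_iff inner_add_right add_divide_distrib)
      then have "exp (\<i> * of_real (u \<bullet> t)) * exp (?E (snd Z)) = exp (\<i> / 2 * of_real (fst Z \<bullet> t)) * exp (?E (snd Z + t))"
        by (simp only: exp_add[symmetric])
      then show "exp (\<i> * of_real (u \<bullet> t)) * coherent_state Z u =
          exp (\<i> / 2 * of_real (fst Z \<bullet> t)) * coherent_state (fst Z, snd Z + t) u"
        unfolding coherent_state_def case_prod_beta fst_conv snd_conv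
          mult.left_commute[of _ "of_real (pi powr _)"] by (rule arg_cong)
    qed
    then show ?case by (simp add: coherent_span.base coherent_span.cmult)
  next
    case (add f g)
    then show ?case by (simp add: distrib_left coherent_span.add)
  next
    case (cmult f c)
    from coherent_span.cmult[OF cmult.IH, of c] show ?case by (simp add: ac_simps)
  qed
  show ?thesis
    unfolding coherent_multiplier_def
  proof (intro CollectI conjI ballI)
    show m: "(\<lambda>u. exp (\<i> * of_real (u \<bullet> t))) \<in> borel_measurable borel" by measurable
    show "(\<lambda>u. exp (\<i> * of_real (u \<bullet> t)) * f u) \<in> coherent_closure" if "f \<in> coherent_closure" for f
      by (rule coherent_closure_mult_bounded[OF m _ that sp, of 1]) auto
  qed
qed

text \<open>The offset \<open>c\<close> is what later gives half-spaces whose boundary misses the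
  origin.\<close>

lemma coherent_multiplier_sin:
  "(\<lambda>u. of_real (sin (u \<bullet> t - c))) \<in> coherent_multiplier"
proof -
  have eq: "of_real (sin (u \<bullet> t - c)) =
     (exp (- \<i> * of_real c) / (2 * \<i>)) * exp (\<i> * of_real (u \<bullet> t)) -
     (exp (\<i> * of_real c) / (2 * \<i>)) * exp (\<i> * of_real (u \<bullet> (- t)))" for u
  proof -
    have e1: "exp (- \<i> * of_real c) * exp (\<i> * of_real (u \<bullet> t)) = exp (\<i> * of_real (u \<bullet> t - c))"
      by (simp add: exp_add[symmetric] algebra_simps)
    have e2: "exp (\<i> * of_real c) * exp (\<i> * of_real (u \<bullet> (- t))) = exp (- (\<i> * of_real (u \<bullet> t - c)))"
      by (simp add: exp_add[symmetric] algebra_simps)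
    have "of_real (sin (u \<bullet> t - c)) = (exp (\<i> * of_real (u \<bullet> t - c)) - exp (- (\<i> * of_real (u \<bullet> t - c)))) / (2 * \<i>)"
      by (simp only: sin_of_real[symmetric] sin_exp_eq)
    then show ?thesis unfolding e1[symmetric] e2[symmetric] by (simp only: times_divide_eq_left diff_divide_distrib)
  qed
  show ?thesis unfolding eq
    by (intro coherent_multiplier_diff coherent_multiplier_mult[OF coherent_multiplier_const] coherent_multiplier_exp)
qed

text \<open>Iterating the polynomial \<open>smoothstep\<close> on the multiplier \<open>sin\<close> produces \<open>sgn \<circ> sin\<close>, and
  letting the period tend to infinity then produces the indicators of half-spaces.\<close>

definition smoothstep :: "real \<Rightarrow> real" where "smoothstep s = (3 * s - s ^ 3) / 2"

lemma smoothstep_range: "\<bar>s\<bar> \<le> 1 \<Longrightarrow> \<bar>smoothstep s\<bar> \<le> 1"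
proof -
  assume s: "\<bar>s\<bar> \<le> 1"
  have "1 - smoothstep s = (1 - s)\<^sup>2 * (2 + s) / 2" "1 + smoothstep s = (1 + s)\<^sup>2 * (2 - s) / 2"
    by (simp_all add: smoothstep_def power2_eq_square power3_eq_cube field_simps)
  moreover have "(1 - s)\<^sup>2 * (2 + s) / 2 \<ge> 0" "(1 + s)\<^sup>2 * (2 - s) / 2 \<ge> 0"
    using s by (intro divide_nonneg_pos mult_nonneg_nonneg; simp)+
  ultimately show ?thesis by linarith
qed

text \<open>For a starting point in the interval from 0 to 1 the iterates increase, because
  \<open>t \<le> smoothstep t\<close> there, and their limit is a positive fixed point, hence 1. The
  point 0 is fixed, and oddness of \<open>smoothstep\<close> settles negative starting
  points.\<close>

lemma smoothstep_iter_tendsto_sgn: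
  assumes "\<bar>s\<bar> \<le> 1"
  shows "(\<lambda>k. (smoothstep ^^ k) s) \<longlonglongrightarrow> sgn s"
proof -
  have range: "\<bar>(smoothstep ^^ k) s\<bar> \<le> 1" if "\<bar>s\<bar> \<le> 1" for k s
    using that by (induction k) (auto intro: smoothstep_range)
  have "smoothstep (- t) = - smoothstep t" for t by (simp add: smoothstep_def field_simps)
  then have odd: "(smoothstep ^^ k) (- s) = - (smoothstep ^^ k) s" for k s
    by (induction k) auto
  have pos: "(\<lambda>k. (smoothstep ^^ k) s) \<longlonglongrightarrow> 1" if s: "0 < s" "s \<le> 1" for s
  proof -
    define x where "x = (\<lambda>k. (smoothstep ^^ k) s)"
    have step: "t \<le> smoothstep t" if "0 \<le> t" "t \<le> 1" for t
    proof -
      have "smoothstep t - t = t * (1 - t) * (1 + t) / 2"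
        by (simp add: smoothstep_def power3_eq_cube field_simps)
      moreover have "\<dots> \<ge> 0" using that by simp
      ultimately show ?thesis by simp
    qed
    have x1: "x k \<le> 1" for k using range[of s k] s by (simp add: x_def)
    have xs: "s \<le> x k" for k
    proof (induction k)
      case (Suc k)
      then show ?case using step[of "x k"] x1[of k] s by (simp add: x_def)
    qed (simp add: x_def)
    have "incseq x"
      using step xs x1 s by (intro incseq_SucI) (smt (verit) x_def funpow.simps(2) o_apply)
    with x1 obtain L where L: "x \<longlonglongrightarrow> L" "\<And>i. x i \<le> L"
      using incseq_convergent[of x 1] by auto
    have "(\<lambda>k. smoothstep (x k)) \<longlonglongrightarrow> smoothstep L"
      unfolding smoothstep_def by (intro tendsto_intros L) simp
    moreover have "(\<lambda>k. smoothstep (x k)) \<longlonglongrightarrow> L"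
      using LIMSEQ_Suc[OF L(1)] by (simp add: x_def)
    ultimately have "smoothstep L = L" by (rule LIMSEQ_unique)
    moreover have "2 * (smoothstep L - L) = L * (1 - L) * (1 + L)"
      by (simp add: smoothstep_def power3_eq_cube field_simps)
    ultimately have "L * (1 - L) * (1 + L) = 0" by simp
    moreover have "L > 0" using L(2)[of 0] s by (simp add: x_def)
    ultimately have "L = 1" by auto
    then show ?thesis using L(1) by (simp add: x_def)
  qed
  consider "s = 0" | "s > 0" | "s < 0" by linarith
  then show ?thesis
  proof cases
    case 1
    have "(smoothstep ^^ k) 0 = 0" for k by (induction k) (auto simp: smoothstep_def)
    then show ?thesis using 1 by simp
  next
    case 2 then show ?thesis using pos assms by simp
  next
    case 3
    have "(\<lambda>k. - (smoothstep ^^ k) (- s)) \<longlonglongrightarrow> - 1"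
      using 3 assms by (intro tendsto_minus pos) auto
    then show ?thesis using 3 by (simp add: odd)
  qed
qed

lemma coherent_multiplier_sgn_sin:
  "(\<lambda>u. of_real (sgn (sin (u \<bullet> t - c)))) \<in> coherent_multiplier"
proof (rule coherent_multiplier_lim[where s="\<lambda>k u. of_real ((smoothstep ^^ k) (sin (u \<bullet> t - c)))"])
  show "(\<lambda>u. of_real ((smoothstep ^^ k) (sin (u \<bullet> t - c)))) \<in> coherent_multiplier" for k
  proof (induction k)
    case 0
    then show ?case by (simp add: coherent_multiplier_sin)
  next
    case (Suc k)
    let ?r = "\<lambda>u. complex_of_real ((smoothstep ^^ k) (sin (u \<bullet> t - c)))"
    have "(\<lambda>u. of_real ((smoothstep ^^ Suc k) (sin (u \<bullet> t - c)))) =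
       (\<lambda>u. (3/2) * ?r u - (1/2) * (?r u * (?r u * ?r u)))"
      by (simp add: smoothstep_def power3_eq_cube diff_divide_distrib mult.assoc)
    then show ?case
      by (simp only:) (intro coherent_multiplier_diff coherent_multiplier_mult coherent_multiplier_const Suc)
  qed
  have "\<bar>(smoothstep ^^ k) (sin x)\<bar> \<le> 1" for k x
    by (induction k) (auto intro: smoothstep_range)
  then show "cmod (of_real ((smoothstep ^^ k) (sin (u \<bullet> t - c)))) \<le> 1" for k u by simp
  show "(\<lambda>k. of_real ((smoothstep ^^ k) (sin (u \<bullet> t - c)))) \<longlonglongrightarrow> complex_of_real (sgn (sin (u \<bullet> t - c)))" for u
    by (intro tendsto_of_real smoothstep_iter_tendsto_sgn) simp
qed

text \<open>For fixed \<open>u\<close> the argument of the stretched sine eventually lies strictly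
  between \<open>- pi\<close> and \<open>pi\<close>, where sine has the sign of its argument. The
  approximating sequence is thus eventually constant at every point.\<close>

lemma coherent_multiplier_sgn:
  "(\<lambda>u. of_real (sgn (u \<bullet> t - c))) \<in> coherent_multiplier"
proof (rule coherent_multiplier_lim[where
      s="\<lambda>k u. of_real (sgn (sin (u \<bullet> ((1 / real (Suc k)) *\<^sub>R t) - c / real (Suc k))))"])
  show "(\<lambda>k. of_real (sgn (sin (u \<bullet> ((1 / real (Suc k)) *\<^sub>R t) - c / real (Suc k))))) \<longlonglongrightarrow>
      complex_of_real (sgn (u \<bullet> t - c))" for u
  proof (rule tendsto_eventually)
    define y where "y = u \<bullet> t - c"
    obtain N :: nat where N: "\<bar>y\<bar> < real N" using reals_Archimedean2 by blast
    have "sgn (sin (y / real (Suc k))) = sgn y" if "k \<ge> N" for k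
    proof -
      have lt: "\<bar>y / real (Suc k)\<bar> < pi"
      proof -
        have "\<bar>y / real (Suc k)\<bar> < 1" using N that by (simp add: field_simps)
        then show ?thesis using pi_gt3 by linarith
      qed
      consider "y = 0" | "y > 0" | "y < 0" by linarith
      then show ?thesis
      proof cases
        case 2
        then have "sin (y / real (Suc k)) > 0" using lt by (intro sin_gt_zero) auto
        then show ?thesis using 2 by simp
      next
        case 3
        then have "sin (- (y / real (Suc k))) > 0" using lt by (intro sin_gt_zero) (auto simp: divide_neg_pos)
        then show ?thesis using 3 by simp
      qed auto
    qed
    moreover have "u \<bullet> ((1 / real (Suc k)) *\<^sub>R t) - c / real (Suc k) = y / real (Suc k)" for k
      by (simp add: y_def diff_divide_distrib)
    ultimately show "\<forall>\<^sub>F k in sequentially. complex_of_real (sgn (sin (u \<bullet> ((1 / real (Suc k)) *\<^sub>R t) - c / real (Suc k)))) = of_real (sgn (u \<bullet> t - c))"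
      unfolding eventually_sequentially y_def[symmetric] by metis
  qed
  show "cmod (of_real (sgn (sin (u \<bullet> ((1 / real (Suc k)) *\<^sub>R t) - c / real (Suc k))))) \<le> 1" for k u
    by (auto simp: sgn_if)
qed (rule coherent_multiplier_sgn_sin)

lemma coherent_multiplier_indicator:
  assumes "B \<in> sets borel"
  shows "(\<lambda>u. indicator B u) \<in> coherent_multiplier"
proof -
  let ?G = "(\<lambda>(a, i). {x::real^'n. a < x \<bullet> i}) ` (UNIV \<times> Basis)"
  have "B \<in> sigma_sets UNIV ?G"
    using assms unfolding borel_eq_halfspace_greater by simp
  then show ?thesis
  proof induction
    case (Basic S)
    then obtain a i where S: "S = {x. a < x \<bullet> i}" by auto
    \<comment> \<open>For \<open>s = sgn (u \<bullet> i - a)\<close> the polynomial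
      \<open>(s * s + s) / 2\<close> is 1 at \<open>s = 1\<close> and 0 at both \<open>s = 0\<close>
      and \<open>s = -1\<close>, so the boundary hyperplane is correctly left out of the open
      half-space.\<close>
    have "(indicator S u :: complex) = (1/2) * (of_real (sgn (u \<bullet> i - a)) * of_real (sgn (u \<bullet> i - a)) + of_real (sgn (u \<bullet> i - a)))" for u
      by (auto simp: S sgn_if)
    then show ?case
      by (simp only:) (intro coherent_multiplier_mult coherent_multiplier_add coherent_multiplier_const coherent_multiplier_sgn)
  next
    case Empty
    then show ?case using coherent_multiplier_const[of 0] by simp
  next
    case (Compl S)
    have "(indicator (UNIV - S) u :: complex) = 1 - indicator S u" for u by (auto simp: indicator_def)
    then show ?case by (simp only:) (intro coherent_multiplier_diff coherent_multiplier_const Compl.IH)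
  next
    case (Union S)
    \<comment> \<open>Finite unions by inclusion-exclusion; their indicators are bounded by 1 and
      converge to that of the countable union.\<close>
    have *: "(\<lambda>u. indicator (\<Union>i<k. S i) u :: complex) \<in> coherent_multiplier" for k
    proof (induction k)
      case 0
      then show ?case using coherent_multiplier_const[of 0] by simp
    next
      case (Suc k)
      have "(indicator (\<Union>i<Suc k. S i) u :: complex) =
         (indicator (\<Union>i<k. S i) u + indicator (S k) u) - indicator (\<Union>i<k. S i) u * indicator (S k) u" for u
        by (auto simp: indicator_def less_Suc_eq)
      then show ?case
        by (simp only:) (intro coherent_multiplier_mult coherent_multiplier_add coherent_multiplier_diff Union.IH Suc)
    qed
    have lim: "(\<lambda>k. indicator (\<Union>i<k. S i) u :: complex) \<longlonglongrightarrow> indicator (\<Union>i. S i) u" for u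
      by (rule LIMSEQ_indicator_UN)
    show ?case
      by (rule coherent_multiplier_lim[OF * _ lim]) (auto simp: indicator_def)
  qed
qed

text \<open>The Gaussian \<open>coherent_state 0\<close> vanishes nowhere, so \<open>f\<close> is
  its product with the quotient \<open>f / ?\<psi>\<close>. Simple functions approximating the
  quotient are multipliers, and their products with the Gaussian are dominated by
  \<open>2 * f\<close>.\<close>

theorem coherent_closure_eq_L2:
  assumes f: "f \<in> L2_space"
  shows "f \<in> coherent_closure"
proof -
  let ?\<psi> = "coherent_state 0"
  note [measurable] = f
  have nz: "?\<psi> u \<noteq> 0" for u :: "real^'n" by (simp add: zero_prod_def coherent_state_def)
  have [measurable]: "(\<lambda>u. f u / ?\<psi> u) \<in> borel_measurable borel" by measurable
  from borel_measurable_implies_sequence_metric[OF this, of 0] obtain F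
    where F: "\<And>i. simple_function borel (F i)" "\<And>u. (\<lambda>i. F i u) \<longlonglongrightarrow> f u / ?\<psi> u"
      "\<And>i u. dist (F i u) 0 \<le> 2 * dist (f u / ?\<psi> u) 0" by auto
  show ?thesis
  proof (rule coherent_closure_dominated[where s="\<lambda>i u. F i u * ?\<psi> u" and w="\<lambda>u. 2 * f u"])
    fix i
    have simple: "(\<lambda>u. \<Sum>y\<in>S. y * indicator (F i -` {y}) u) \<in> coherent_multiplier" if "finite S" for S
      using that
    proof induction
      case empty
      then show ?case using coherent_multiplier_const[of 0] by simp
    next
      case (insert y S)
      have "F i -` {y} \<in> sets borel" using F(1)[of i]
        by (metis simple_functionD(2) space_borel inf_top.right_neutral)
      then show ?case unfolding sum.insert[OF insert(1,2)] using insert(3)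
        by (intro coherent_multiplier_add coherent_multiplier_mult coherent_multiplier_const coherent_multiplier_indicator)
    qed
    have fin: "finite (range (F i))" using F(1)[of i] by (auto simp: simple_function_def)
    have "F i = (\<lambda>u. \<Sum>y\<in>range (F i). y * indicator (F i -` {y}) u)"
    proof
      show "F i u = (\<Sum>y\<in>range (F i). y * indicator (F i -` {y}) u)" for u
        by (subst sum.remove[OF fin, of "F i u"]) (auto intro!: sum.neutral simp: indicator_def)
    qed
    then have "F i \<in> coherent_multiplier" by (rule ssubst) (rule simple[OF fin])
    then show "(\<lambda>u. F i u * ?\<psi> u) \<in> coherent_closure"
      by (simp add: coherent_multiplier_def coherent_span_closure coherent_span.base)
    show "cmod (F i u * ?\<psi> u) \<le> cmod (2 * f u)" for u
      using mult_right_mono[OF F(3)[of i u], of "cmod (?\<psi> u)"] nz[of u] by (simp add: norm_mult norm_divide)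
  next
    show "(\<lambda>i. F i u * ?\<psi> u) \<longlonglongrightarrow> f u" for u
    proof -
      have "(\<lambda>i. F i u * ?\<psi> u) \<longlonglongrightarrow> (f u / ?\<psi> u) * ?\<psi> u" by (intro tendsto_intros F)
      then show ?thesis by (simp add: nz)
    qed
    show "f \<in> borel_measurable borel" by measurable
    show "(\<lambda>u. 2 * f u) \<in> L2_space" by (rule L2_cmult[OF f])
  qed
qed

subsection \<open>A mean value property over complex lines\<close>

text \<open>Tonelli's theorem and translation invariance: for a fixed second component the shear is
  a translation of the first. Shears are the factors from which the rotations below are
  assembled.\<close>

lemma distr_shear_fst:
  fixes \<phi> :: "'b::euclidean_space \<Rightarrow> 'a::euclidean_space"
  assumes [measurable]: "\<phi> \<in> borel_measurable borel"
  shows "distr lborel borel (\<lambda>p. (fst p + \<phi> (snd p), snd p)) = (lborel :: ('a \<times> 'b) measure)"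
proof (rule measure_eqI)
  let ?T = "\<lambda>p. (fst p + \<phi> (snd p), snd p)"
  have T [measurable]: "?T \<in> borel \<rightarrow>\<^sub>M (borel :: ('a \<times> 'b) measure)"
    unfolding borel_prod[symmetric] by measurable
  fix A assume "A \<in> sets (distr lborel borel ?T)"
  then have A [measurable]: "A \<in> sets borel" by simp
  have m: "(indicator A :: _ \<Rightarrow> ennreal) \<in> borel_measurable (lborel \<Otimes>\<^sub>M lborel)"
    unfolding lborel_prod by measurable
  have mT: "(\<lambda>p. indicator A (?T p) :: ennreal) \<in> borel_measurable (lborel \<Otimes>\<^sub>M lborel)"
    unfolding lborel_prod by measurable
  have m2 [measurable]: "(\<lambda>x. indicator A (x, z) :: ennreal) \<in> borel_measurable borel" for z
    by measurable
  have "emeasure (distr lborel borel ?T) A = (\<integral>\<^sup>+p. indicator A p \<partial>distr lborel borel ?T)"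
    by simp
  also have "\<dots> = (\<integral>\<^sup>+p. indicator A (?T p) \<partial>(lborel \<Otimes>\<^sub>M lborel))"
    unfolding lborel_prod by (subst nn_integral_distr) auto
  also have "\<dots> = (\<integral>\<^sup>+z. \<integral>\<^sup>+x. indicator A (x + \<phi> z, z) \<partial>lborel \<partial>lborel)"
    by (subst lborel_pair.nn_integral_snd[OF mT, symmetric]) simp
  also have "\<dots> = (\<integral>\<^sup>+z. \<integral>\<^sup>+x. indicator A (x, z) \<partial>lborel \<partial>lborel)"
  proof (rule nn_integral_cong)
    show "(\<integral>\<^sup>+x. indicator A (x + \<phi> z, z) \<partial>lborel) = (\<integral>\<^sup>+x. indicator A (x, z) \<partial>lborel :: ennreal)" for z
      using lborel_shift_nn[OF m2, of "\<phi> z" z] by (simp only: add.commute)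
  qed
  also have "\<dots> = (\<integral>\<^sup>+p. indicator A p \<partial>(lborel \<Otimes>\<^sub>M lborel))"
    by (subst lborel_pair.nn_integral_snd[OF m, symmetric]) simp
  also have "\<dots> = emeasure lborel A" unfolding lborel_prod by simp
  finally show "emeasure (distr lborel borel ?T) A = emeasure lborel A" .
qed simp

lemma distr_shear_snd:
  fixes \<phi> :: "'a::euclidean_space \<Rightarrow> 'b::euclidean_space"
  assumes [measurable]: "\<phi> \<in> borel_measurable borel"
  shows "distr lborel borel (\<lambda>p. (fst p, snd p + \<phi> (fst p))) = (lborel :: ('a \<times> 'b) measure)"
proof (rule measure_eqI)
  let ?T = "\<lambda>p. (fst p, snd p + \<phi> (fst p))"
  have T [measurable]: "?T \<in> borel \<rightarrow>\<^sub>M (borel :: ('a \<times> 'b) measure)"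
    unfolding borel_prod[symmetric] by measurable
  fix A assume "A \<in> sets (distr lborel borel ?T)"
  then have A [measurable]: "A \<in> sets borel" by simp
  have m: "(indicator A :: _ \<Rightarrow> ennreal) \<in> borel_measurable (lborel \<Otimes>\<^sub>M lborel)"
    unfolding lborel_prod by measurable
  have mT: "(\<lambda>p. indicator A (?T p) :: ennreal) \<in> borel_measurable (lborel \<Otimes>\<^sub>M lborel)"
    unfolding lborel_prod by measurable
  have m2 [measurable]: "(\<lambda>z. indicator A (x, z) :: ennreal) \<in> borel_measurable borel" for x
    by measurable
  have "emeasure (distr lborel borel ?T) A = (\<integral>\<^sup>+p. indicator A p \<partial>distr lborel borel ?T)"
    by simp
  also have "\<dots> = (\<integral>\<^sup>+p. indicator A (?T p) \<partial>(lborel \<Otimes>\<^sub>M lborel))"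
    unfolding lborel_prod by (subst nn_integral_distr) auto
  also have "\<dots> = (\<integral>\<^sup>+x. \<integral>\<^sup>+z. indicator A (x, z + \<phi> x) \<partial>lborel \<partial>lborel)"
    by (subst lborel.nn_integral_fst[OF mT, symmetric]) simp
  also have "\<dots> = (\<integral>\<^sup>+x. \<integral>\<^sup>+z. indicator A (x, z) \<partial>lborel \<partial>lborel)"
  proof (rule nn_integral_cong)
    show "(\<integral>\<^sup>+z. indicator A (x, z + \<phi> x) \<partial>lborel) = (\<integral>\<^sup>+z. indicator A (x, z) \<partial>lborel :: ennreal)" for x
      using lborel_shift_nn[OF m2, of x "\<phi> x"] by (simp only: add.commute)
  qed
  also have "\<dots> = (\<integral>\<^sup>+p. indicator A p \<partial>(lborel \<Otimes>\<^sub>M lborel))"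
    by (subst lborel.nn_integral_fst[OF m, symmetric]) simp
  also have "\<dots> = emeasure lborel A" unfolding lborel_prod by simp
  finally show "emeasure (distr lborel borel ?T) A = emeasure lborel A" .
qed simp

text \<open>With \<open>J\<close> as multiplication by \<open>\<i>\<close>, this multiplies
  \<open>fst p + snd p\<close> by \<open>w\<close> and \<open>fst p - snd p\<close> by the conjugate
  of \<open>w\<close>. A function that is holomorphic in the sum and antiholomorphic in the
  difference therefore becomes holomorphic in \<open>w\<close>.\<close>

definition cx_rotation :: "('a::euclidean_space \<Rightarrow> 'a) \<Rightarrow> complex \<Rightarrow> 'a \<times> 'a \<Rightarrow> 'a \<times> 'a" where
  "cx_rotation J w p = (Re w *\<^sub>R fst p + Im w *\<^sub>R J (snd p), Re w *\<^sub>R snd p + Im w *\<^sub>R J (fst p))"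

lemma cx_rotation_continuous:
  assumes "linear J"
  shows "continuous_on UNIV (\<lambda>q. cx_rotation J (fst q) (snd q))"
proof -
  note cJ = linear_continuous_on_compose[OF _ assms]
  show ?thesis unfolding cx_rotation_def by (intro continuous_intros cJ)
qed

lemma cx_rotation_measurable [measurable]:
  assumes "linear J"
  shows "cx_rotation J w \<in> borel \<rightarrow>\<^sub>M borel"
proof -
  note cJ = linear_continuous_on_compose[OF _ assms]
  show ?thesis unfolding cx_rotation_def[abs_def]
    by (intro borel_measurable_continuous_onI continuous_intros cJ)
qed

text \<open>The classical factorisation of a rotation into three shears, each of which preserves the
  measure. The shear parameter has a pole at \<open>w = -1\<close>; that rotation is the square of
  the one for \<open>\<i>\<close>.\<close>

lemma distr_cx_rotation:
  fixes J :: "'a::euclidean_space \<Rightarrow> 'a"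
  assumes lin: "linear J" and JJ: "\<And>x. J (J x) = - x" and w: "cmod w = 1"
  shows "distr lborel borel (cx_rotation J w) = lborel"
proof -
  interpret J: linear J by fact
  have "continuous_on UNIV J" using linear_continuous_on_compose[OF continuous_on_id lin] by simp
  note [measurable] = borel_measurable_continuous_onI[OF this] cx_rotation_measurable[OF lin]
  define c s where "c = Re w" and "s = Im w"
  have cs: "c\<^sup>2 + s\<^sup>2 = 1" using w by (simp add: c_def s_def cmod_def)
  have main: "distr lborel borel (cx_rotation J w) = lborel"
    if w: "cmod w = 1" and ne: "Re w \<noteq> -1" for w
  proof -
    define c s where "c = Re w" and "s = Im w"
    have cs: "c\<^sup>2 + s\<^sup>2 = 1" using w by (simp add: c_def s_def cmod_def)
    have c: "1 + c \<noteq> 0" using ne by (auto simp: c_def)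
    \<comment> \<open>The tangent of half the argument of \<open>w\<close>.\<close>
    define t where "t = s / (1 + c)"
    have st: "s * t = 1 - c" "t * (1 + c) = s"
      using c cs by (auto simp: t_def field_simps power2_eq_square)
    let ?S = "\<lambda>p::'a\<times>'a. (fst p + t *\<^sub>R J (snd p), snd p)"
    let ?R = "\<lambda>p::'a\<times>'a. (fst p, snd p + s *\<^sub>R J (fst p))"
    have [measurable]: "?S \<in> borel \<rightarrow>\<^sub>M borel" "?R \<in> borel \<rightarrow>\<^sub>M borel"
      unfolding borel_prod[symmetric] by measurable
    have "cx_rotation J w p = (?S \<circ> (?R \<circ> ?S)) p" for p
    proof -
      let ?x = "fst p" and ?z = "snd p"
      have 1: "s *\<^sub>R J (?x + t *\<^sub>R J ?z) + ?z = c *\<^sub>R ?z + s *\<^sub>R J ?x"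
        by (simp add: J.add J.scaleR JJ scaleR_add_right st algebra_simps)
      have 2: "?x + t *\<^sub>R J ?z + t *\<^sub>R J (c *\<^sub>R ?z + s *\<^sub>R J ?x) = c *\<^sub>R ?x + s *\<^sub>R J ?z"
      proof -
        have "?x + t *\<^sub>R J ?z + t *\<^sub>R J (c *\<^sub>R ?z + s *\<^sub>R J ?x) = (1 - s * t) *\<^sub>R ?x + (t * (1 + c)) *\<^sub>R J ?z"
          by (simp add: J.add J.scaleR JJ algebra_simps)
        then show ?thesis by (simp add: st)
      qed
      show ?thesis using 1 2 by (simp add: cx_rotation_def c_def s_def add.commute)
    qed
    then have eq: "cx_rotation J w = ?S \<circ> (?R \<circ> ?S)" by blast
    have S: "distr lborel borel ?S = lborel" by (rule distr_shear_fst) measurable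
    have R: "distr lborel borel ?R = lborel" by (rule distr_shear_snd) measurable
    have "distr lborel borel (?R \<circ> ?S) = distr (distr lborel borel ?S) borel ?R"
      by (subst distr_distr) auto
    then have RS: "distr lborel borel (?R \<circ> ?S) = lborel" using S R by simp
    have "distr lborel borel (?S \<circ> (?R \<circ> ?S)) = distr (distr lborel borel (?R \<circ> ?S)) borel ?S"
      by (subst distr_distr[where N=borel]) (auto intro: measurable_comp[where N=borel])
    then show ?thesis using RS S eq by simp
  qed
  show ?thesis
  proof (cases "Re w = -1")
    case False
    then show ?thesis using main w by blast
  next
    case True
    then have "Im w = 0" using cs by (simp add: c_def s_def)
    then have "cx_rotation J w p = (cx_rotation J \<i> \<circ> cx_rotation J \<i>) p" for p
      using True by (simp add: cx_rotation_def JJ)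
    then have eq: "cx_rotation J w = cx_rotation J \<i> \<circ> cx_rotation J \<i>" by blast
    have i: "distr lborel borel (cx_rotation J \<i>) = lborel" by (rule main) auto
    have "distr lborel borel (cx_rotation J \<i> \<circ> cx_rotation J \<i>) =
       distr (distr lborel borel (cx_rotation J \<i>)) borel (cx_rotation J \<i>)"
      by (subst distr_distr) auto
    then show ?thesis using i eq by simp
  qed
qed

text \<open>Cauchy's integral formula at the centre of the unit circle: the derivative of the path
  cancels the Cauchy kernel up to the constant \<open>2 * pi * \<i>\<close>.\<close>

lemma entire_circle_mean:
  assumes "\<phi> holomorphic_on UNIV"
  shows "(LINT t:{0..1}|lborel. \<phi> (exp (2 * of_real pi * \<i> * of_real t))) = \<phi> 0"
proof -
  let ?e = "\<lambda>t::real. exp (2 * of_real pi * \<i> * of_real t)"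
  have "((\<lambda>u. \<phi> u / (u - 0)) has_contour_integral (2 * of_real pi * \<i> * \<phi> 0)) (circlepath 0 1)"
    using assms by (intro Cauchy_integral_circlepath)
      (auto intro: holomorphic_on_subset holomorphic_on_imp_continuous_on)
  then have "((\<lambda>t. \<phi> (circlepath 0 1 t) / circlepath 0 1 t * vector_derivative (circlepath 0 1) (at t within {0..1}))
      has_integral (2 * of_real pi * \<i> * \<phi> 0)) {0..1}"
    by (simp add: has_contour_integral_def)
  then have "((\<lambda>t. 2 * of_real pi * \<i> * \<phi> (?e t)) has_integral (2 * of_real pi * \<i> * \<phi> 0)) {0..1}"
  proof (rule has_integral_eq[rotated])
    fix t :: real assume "t \<in> {0..1}"
    then show "\<phi> (circlepath 0 1 t) / circlepath 0 1 t * vector_derivative (circlepath 0 1) (at t within {0..1})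
       = 2 * of_real pi * \<i> * \<phi> (?e t)"
      by (subst vector_derivative_circlepath01) (auto simp: circlepath)
  qed
  then have "((\<lambda>t. (1 / (2 * of_real pi * \<i>)) * (2 * of_real pi * \<i> * \<phi> (?e t))) has_integral
      (1 / (2 * of_real pi * \<i>)) * (2 * of_real pi * \<i> * \<phi> 0)) {0..1}"
    by (rule has_integral_mult_right)
  then have hi: "((\<lambda>t. \<phi> (?e t)) has_integral \<phi> 0) {0..1}" by simp
  have "continuous_on {0..1} (\<lambda>t. \<phi> (?e t))"
    by (rule continuous_on_compose2[OF holomorphic_on_imp_continuous_on[OF assms]])
      (auto intro!: continuous_intros)
  then have "set_integrable lborel {0..1} (\<lambda>t. \<phi> (?e t))" by (rule borel_integrable_atLeastAtMost')
  then have "(LINT t:{0..1}|lborel. \<phi> (?e t)) = integral {0..1} (\<lambda>t. \<phi> (?e t))"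
    by (rule set_borel_integral_eq_integral)
  then show ?thesis using hi by (simp add: integral_unique)
qed

text \<open>A single complex variable suffices for a mean value property in several variables: a weight
  invariant under multiplication by unimodular scalars can be averaged over each complex line.\<close>

lemma cx_rotation_mean_value:
  fixes J :: "'a::euclidean_space \<Rightarrow> 'a" and K :: "'a \<times> 'a \<Rightarrow> complex"
  assumes lin: "linear J" and JJ: "\<And>x. J (J x) = - x"
    and K: "continuous_on UNIV K"
    and w [measurable]: "w \<in> borel_measurable borel"
    and winv: "\<And>p \<zeta>. cmod \<zeta> = 1 \<Longrightarrow> w (cx_rotation J \<zeta> p) = w p"
    and int: "integrable lborel (\<lambda>p. K p * of_real (w p))"
    and entire: "\<And>p. \<exists>\<phi>. \<phi> holomorphic_on UNIV \<and> \<phi> 0 = K 0 \<and> (\<forall>\<zeta>. cmod \<zeta> = 1 \<longrightarrow> K (cx_rotation J \<zeta> p) = \<phi> \<zeta>)"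
  shows "(LINT p|lborel. K p * of_real (w p)) = K 0 * of_real (LINT p|lborel. w p)"
proof -
  let ?e = "\<lambda>t::real. exp (2 * of_real pi * \<i> * of_real t)"
  have ne: "cmod (?e t) = 1" for t by (simp add: norm_exp_eq_Re)
  let ?T = "\<lambda>t. cx_rotation J (?e t)"
  let ?F = "\<lambda>p. K p * of_real (w p)"
  \<comment> \<open>Fubini is applied to this family of rotated integrands. Integrated over
    \<open>p\<close> it gives the left-hand integral for every \<open>t\<close> in the unit
    interval, by invariance of the measure; integrated over \<open>t\<close> it gives the circle
    mean of an entire function, that is, its value at the centre.\<close>
  define f where "f = (\<lambda>(t::real, p). indicator {0..1} t *\<^sub>R (K (?T t p) * of_real (w p)))"
  note [measurable] = borel_measurable_continuous_onI[OF K] cx_rotation_measurable[OF lin]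
  have TF: "K (?T t p) * of_real (w p) = ?F (?T t p)" for t p by (simp add: winv[OF ne])
  have d: "distr lborel borel (?T t) = lborel" for t by (rule distr_cx_rotation[OF lin JJ ne])
  have cont: "continuous_on UNIV (\<lambda>q. K (?T (fst q) (snd q)))"
    by (rule continuous_on_compose2[OF K], rule continuous_on_compose2[OF cx_rotation_continuous[OF lin], of _ "\<lambda>q. (?e (fst q), snd q)", simplified])
      (auto intro!: continuous_intros)
  have [measurable]: "(\<lambda>q. K (?T (fst q) (snd q))) \<in> borel_measurable (lborel \<Otimes>\<^sub>M lborel)"
    unfolding lborel_prod using borel_measurable_continuous_onI[OF cont] by simp
  have fm [measurable]: "f \<in> borel_measurable (lborel \<Otimes>\<^sub>M lborel)"
    unfolding f_def case_prod_beta by measurable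
  have intT: "integrable lborel (\<lambda>p. ?F (?T t p))" for t
  proof -
    have "integrable (distr lborel borel (?T t)) ?F" using int d by simp
    then show ?thesis by (subst (asm) integrable_distr_eq) auto
  qed
  have valT: "(LINT p|lborel. ?F (?T t p)) = (LINT p|lborel. ?F p)" for t
  proof -
    have "(LINT p|distr lborel borel (?T t). ?F p) = (LINT p|lborel. ?F (?T t p))"
      by (subst integral_distr) auto
    then show ?thesis using d by simp
  qed
  have nvalT: "(LINT p|lborel. norm (?F (?T t p))) = (LINT p|lborel. norm (?F p))" for t
  proof -
    have "(LINT p|distr lborel borel (?T t). norm (?F p)) = (LINT p|lborel. norm (?F (?T t p)))"
      by (subst integral_distr) auto
    then show ?thesis using d by simp
  qed
  have fint: "integrable (lborel \<Otimes>\<^sub>M lborel) f"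
  proof (rule lborel_pair.Fubini_integrable[OF fm])
    have "(\<lambda>t. LINT p|lborel. norm (f (t, p))) = (\<lambda>t. indicator {0..1} t *\<^sub>R (LINT p|lborel. norm (?F p)))"
      by (rule ext) (simp add: f_def TF nvalT del: norm_mult)
    then show "integrable lborel (\<lambda>t. LINT p|lborel. norm (f (t, p)))"
      by simp
    show "AE t in lborel. integrable lborel (\<lambda>p. f (t, p))"
      unfolding f_def case_prod_conv TF by (intro AE_I2 integrable_scaleR_right intT)
  qed
  have inner: "(LINT t|lborel. f (t, p)) = K 0 * of_real (w p)" for p
  proof -
    obtain \<phi> where \<phi>: "\<phi> holomorphic_on UNIV" "\<phi> 0 = K 0" "\<And>\<zeta>. cmod \<zeta> = 1 \<Longrightarrow> K (cx_rotation J \<zeta> p) = \<phi> \<zeta>"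
      using entire[of p] by blast
    have "(LINT t|lborel. f (t, p)) = (LINT t:{0..1}|lborel. \<phi> (?e t)) * of_real (w p)"
      by (simp add: f_def set_lebesgue_integral_def \<phi>(3)[OF ne] flip: integral_mult_left_zero mult_scaleR_left)
    then show ?thesis by (simp add: entire_circle_mean[OF \<phi>(1)] \<phi>(2))
  qed
  have "(LINT p|lborel. ?F p) = (LINT t::real|lborel. indicator {0..1} t *\<^sub>R (LINT p|lborel. ?F p))"
    by simp
  also have "\<dots> = (LINT t|lborel. LINT p|lborel. f (t, p))"
    by (simp add: f_def TF valT)
  also have "\<dots> = (LINT p|lborel. LINT t|lborel. f (t, p))"
    using lborel_pair.Fubini_integral[of "\<lambda>t p. f (t, p)"] fint by simp
  also have "\<dots> = K 0 * of_real (LINT p|lborel. w p)"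
    unfolding inner by (simp flip: integral_complex_of_real)
  finally show ?thesis .
qed

section \<open>Complex structure and Hermitian form on phase space\<close>

type_synonym 'n phase = "(real ^ 'n) \<times> (real ^ 'n)"

text \<open>Multiplication by \<open>\<i>\<close> when \<open>(x, \<xi>)\<close> is read as
  \<open>x + \<i> * \<xi>\<close>.\<close>

definition cxJ :: "'n::finite phase \<Rightarrow> 'n::finite phase" where
  "cxJ X = (- snd X, fst X)"

definition cx_scale :: "complex \<Rightarrow> 'n::finite phase \<Rightarrow> 'n::finite phase" where
  "cx_scale w X = Re w *\<^sub>R X + Im w *\<^sub>R cxJ X"

text \<open>The standard Hermitian product on complex n-space, linear on the left and
  conjugate-linear on the right. The exponent of the inner product of two coherent states is
  \<open>herm X Y / 2\<close> minus \<open>(norm X)\<^sup>2 / 4\<close> and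
  \<open>(norm Y)\<^sup>2 / 4\<close>.\<close>

definition herm :: "'n::finite phase \<Rightarrow> 'n::finite phase \<Rightarrow> complex" where
  "herm X Y = of_real (X \<bullet> Y) + \<i> * of_real (sympl X Y)"

lemma linear_cxJ: "linear cxJ"
  by (auto simp: linear_iff cxJ_def)

lemma cxJ_cxJ: "cxJ (cxJ X) = - X"
  by (simp add: cxJ_def prod_eq_iff)

lemma sympl_cxJ: "sympl X Y = X \<bullet> cxJ Y"
  by (simp add: sympl_def cxJ_def inner_prod_def inner_commute)

lemma inner_cxJ: "cxJ X \<bullet> cxJ Y = X \<bullet> Y" "cxJ X \<bullet> Y = - (X \<bullet> cxJ Y)"
  by (simp_all add: cxJ_def inner_prod_def)

lemma cxJ_add: "cxJ (X + Y) = cxJ X + cxJ Y" and cxJ_diff: "cxJ (X - Y) = cxJ X - cxJ Y"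
  and cxJ_scaleR: "cxJ (r *\<^sub>R X) = r *\<^sub>R cxJ X"
  by (simp_all add: cxJ_def prod_eq_iff)

lemma herm_add: "herm (X + Y) Z = herm X Z + herm Y Z" "herm Z (X + Y) = herm Z X + herm Z Y"
  and herm_diff: "herm (X - Y) Z = herm X Z - herm Y Z" "herm Z (X - Y) = herm Z X - herm Z Y"
  by (simp_all add: herm_def sympl_cxJ cxJ_add cxJ_diff inner_simps algebra_simps)

lemma herm_scale: "herm (cx_scale w X) Y = w * herm X Y" "herm X (cx_scale w Y) = cnj w * herm X Y"
  by (simp_all add: herm_def cx_scale_def sympl_cxJ cxJ_add cxJ_scaleR cxJ_cxJ inner_cxJ inner_simps complex_eq_iff algebra_simps)

lemma sympl_bilinear:
  "sympl (X + Y) Z = sympl X Z + sympl Y Z" "sympl Z (X + Y) = sympl Z X + sympl Z Y"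
  "sympl (X - Y) Z = sympl X Z - sympl Y Z" "sympl Z (X - Y) = sympl Z X - sympl Z Y"
  "sympl (r *\<^sub>R X) Y = r * sympl X Y" "sympl X (r *\<^sub>R Y) = r * sympl X Y"
  by (simp_all add: sympl_def inner_simps algebra_simps)

lemma sympl_anti: "sympl Y X = - sympl X Y" and sympl_self [simp]: "sympl X X = 0"
  by (simp_all add: sympl_def inner_commute)

lemma sympl_continuous [continuous_intros]:
  "continuous_on S f \<Longrightarrow> continuous_on S g \<Longrightarrow> continuous_on S (\<lambda>x. sympl (f x) (g x))"
  unfolding sympl_def by (intro continuous_intros)

lemma cx_scale_add_left:
  "cx_scale (w + h) X = cx_scale w X + cx_scale h X"
  by (simp add: cx_scale_def scaleR_add_left)

subsection \<open>Holomorphic dependence of coherent states\<close>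

text \<open>The factor removes exactly the non-holomorphic part of the dependence on
  \<open>Z\<close>: what remains is the exponential of a complex polynomial of degree two in
  \<open>Z\<close>, as in the kernel of the Bargmann transform.\<close>

definition hol_state :: "'n::finite phase \<Rightarrow> real ^ 'n \<Rightarrow> complex" where
  "hol_state Z u = of_real (exp ((norm Z)\<^sup>2 / 4)) * coherent_state Z u"

lemma hol_state_L2 [simp]: "hol_state Z \<in> L2_space"
  unfolding hol_state_def[abs_def] by (intro L2_cmult coherent_state_L2)

definition cx_dot :: "real ^ 'n \<Rightarrow> 'n::finite phase \<Rightarrow> complex" where
  "cx_dot u Z = of_real (u \<bullet> fst Z) + \<i> * of_real (u \<bullet> snd Z)"

text \<open>The complex-bilinear product, without conjugation, hence holomorphic in each
  argument.\<close>

definition cx_bil :: "'n::finite phase \<Rightarrow> 'n::finite phase \<Rightarrow> complex" where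
  "cx_bil X Y = of_real (fst X \<bullet> fst Y - snd X \<bullet> snd Y) + \<i> * of_real (fst X \<bullet> snd Y + snd X \<bullet> fst Y)"

lemma cx_bil_commute: "cx_bil X Y = cx_bil Y X"
  by (simp add: cx_bil_def inner_commute add.commute)

lemma hol_state_eq:
  fixes Z :: "'n::finite phase"
  shows "hol_state Z u = of_real (pi powr (- real CARD('n) / 4)) *
    exp (- of_real ((norm u)\<^sup>2 / 2) + cx_dot u Z - cx_bil Z Z / 4)"
proof -
  have e: "of_real ((norm Z)\<^sup>2 / 4) + (- of_real ((norm (u - fst Z))\<^sup>2) / 2 + \<i> * of_real (u \<bullet> snd Z) - \<i> / 2 * of_real (fst Z \<bullet> snd Z))
    = - of_real ((norm u)\<^sup>2 / 2) + cx_dot u Z - cx_bil Z Z / 4"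
    unfolding power2_norm_eq_inner cx_dot_def cx_bil_def
    by (simp add: complex_eq_iff inner_prod_def inner_simps inner_commute field_simps)
  show ?thesis
    unfolding e[symmetric] hol_state_def coherent_state_def case_prod_beta exp_add exp_of_real
    by (simp only: ac_simps)
qed

lemma hol_state_shift:
  "hol_state (Z + cx_scale h P) u =
    hol_state Z u * exp (h * (cx_dot u P - cx_bil Z P / 2) + h\<^sup>2 * (- cx_bil P P / 4))"
proof -
  have "- of_real ((norm u)\<^sup>2 / 2) + cx_dot u (Z + cx_scale h P) - cx_bil (Z + cx_scale h P) (Z + cx_scale h P) / 4
     = (- of_real ((norm u)\<^sup>2 / 2) + cx_dot u Z - cx_bil Z Z / 4) + (h * (cx_dot u P - cx_bil Z P / 2) + h\<^sup>2 * (- cx_bil P P / 4))"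
  proof -
    have d: "cx_dot u (Z + cx_scale h P) = cx_dot u Z + h * cx_dot u P"
      by (simp add: cx_dot_def cx_scale_def cxJ_def complex_eq_iff inner_simps algebra_simps)
    have b: "cx_bil (X + Y) V = cx_bil X V + cx_bil Y V" "cx_bil V (X + Y) = cx_bil V X + cx_bil V Y"
      "cx_bil X (cx_scale h V) = h * cx_bil X V" "cx_bil (cx_scale h V) X = h * cx_bil V X" for X Y V :: "'n::finite phase"
      by (simp_all add: cx_bil_def cx_scale_def cxJ_def complex_eq_iff inner_simps inner_commute algebra_simps)
    have "cx_bil (Z + cx_scale h P) (Z + cx_scale h P) = cx_bil Z Z + 2 * h * cx_bil Z P + h\<^sup>2 * cx_bil P P"
      by (simp add: b cx_bil_commute[of P Z] power2_eq_square algebra_simps)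
    then show ?thesis unfolding d by (simp add: field_simps)
  qed
  then show ?thesis
    unfolding hol_state_eq by (simp only: exp_add mult.assoc)
qed

lemma le_exp_double:
  fixes a b :: real
  assumes "a \<ge> 0" "b \<ge> 0"
  shows "a \<le> exp (2 * (a + b))" "b \<le> exp (2 * (a + b))"
proof -
  have "a \<le> 1 + 2 * (a + b)" "b \<le> 1 + 2 * (a + b)" using assms by auto
  then show "a \<le> exp (2 * (a + b))" "b \<le> exp (2 * (a + b))"
    using exp_ge_add_one_self[of "2 * (a + b)"] order_trans by blast+
qed

text \<open>In the application \<open>L\<close> is a function growing linearly in \<open>u\<close>,
  so the bound has to be a single exponential that a Gaussian can absorb. Of the factor 3, two parts
  come from the second-order Taylor remainder, with its square absorbed into the doubled exponent,
  and one from the term \<open>h\<^sup>2 * g\<close>.\<close>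

lemma exp_remainder:
  fixes h L g :: complex
  assumes "cmod h \<le> 1"
  shows "cmod (exp (h * L + h\<^sup>2 * g) - 1 - h * L) \<le> 3 * (cmod h)\<^sup>2 * exp (2 * (cmod L + cmod g))"
proof -
  let ?w = "h * L + h\<^sup>2 * g" and ?B = "cmod L + cmod g"
  have "cmod ?w \<le> cmod h * cmod L + (cmod h * cmod h) * cmod g"
    by (metis norm_mult norm_triangle_ineq power2_eq_square)
  also have "\<dots> \<le> cmod h * cmod L + (cmod h * 1) * cmod g"
    by (intro add_mono mult_mono) (use assms in auto)
  finally have w: "cmod ?w \<le> cmod h * ?B" by (simp add: algebra_simps)
  also have "\<dots> \<le> ?B" using assms by (simp add: mult_left_le_one_le)
  finally have wB: "cmod ?w \<le> ?B" .
  have "cmod (exp ?w - 1 - ?w) \<le> (cmod ?w)\<^sup>2 * exp (cmod ?w)"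
  proof -
    have "cmod (exp ?w - (\<Sum>i\<le>1. ?w ^ i / fact i)) \<le> exp (cmod ?w) * (cmod ?w) ^ Suc 1 / fact 1"
      by (rule Taylor_exp_field)
    then show ?thesis by (simp add: power2_eq_square algebra_simps)
  qed
  also have "\<dots> \<le> (cmod h * ?B)\<^sup>2 * exp ?B"
    using w wB by (intro mult_mono power_mono) auto
  also have "\<dots> = (cmod h)\<^sup>2 * (?B\<^sup>2 * exp ?B)" by (simp add: power_mult_distrib)
  also have "?B\<^sup>2 \<le> 2 * exp ?B"
  proof -
    have B: "?B \<ge> 0" by simp
    show ?thesis using exp_lower_Taylor_quadratic[OF B] B by linarith
  qed
  then have "?B\<^sup>2 * exp ?B \<le> 2 * exp (2 * ?B)"
    using mult_right_mono[of "?B\<^sup>2" "2 * exp ?B" "exp ?B"] by (simp add: exp_add[symmetric] algebra_simps)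
  finally have 1: "cmod (exp ?w - 1 - ?w) \<le> (cmod h)\<^sup>2 * (2 * exp (2 * ?B))" by (simp add: mult_left_mono)
  have "cmod g \<le> exp (2 * ?B)"
    by (rule le_exp_double) auto
  then have 2: "cmod (h\<^sup>2 * g) \<le> (cmod h)\<^sup>2 * exp (2 * ?B)"
    by (simp add: norm_mult norm_power mult_left_mono)
  have "exp ?w - 1 - h * L = (exp ?w - 1 - ?w) + h\<^sup>2 * g" by simp
  then have "cmod (exp ?w - 1 - h * L) \<le> cmod (exp ?w - 1 - ?w) + cmod (h\<^sup>2 * g)"
    by (metis norm_triangle_ineq)
  then show ?thesis using 1 2 by (simp add: algebra_simps)
qed

text \<open>The inequality \<open>2 * k * v \<le> v\<^sup>2 / 2 + 2 * k\<^sup>2\<close> spends half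
  of the squared Gaussian on the exponential growth; the other half is integrable.\<close>

lemma gaussian_exp_L2:
  fixes x :: "real ^ 'n"
  assumes "k \<ge> 0"
  shows "(\<lambda>u. complex_of_real (c * exp (- (norm (u - x))\<^sup>2 / 2 + k * norm u))) \<in> L2_space"
proof -
  let ?g = "\<lambda>u. exp (2 * k * norm x + 2 * k\<^sup>2) * exp (- ((1/2) * (norm (- x + u))\<^sup>2))"
  have le: "(exp (- (norm (u - x))\<^sup>2 / 2 + k * norm u))\<^sup>2 \<le> ?g u" for u
  proof -
    let ?v = "norm (u - x)"
    have "norm u \<le> norm x + ?v" using norm_triangle_ineq[of x "u - x"] by simp
    then have "2 * k * norm u \<le> 2 * k * norm x + 2 * k * ?v"
      using assms mult_left_mono[of "norm u" "norm x + ?v" "2 * k"] by (simp add: algebra_simps)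
    moreover have "0 \<le> (?v - 2 * k)\<^sup>2" by simp
    then have "2 * k * ?v \<le> ?v\<^sup>2 / 2 + 2 * k\<^sup>2"
      by (simp add: power2_diff power_mult_distrib field_simps)
    ultimately have "- ?v\<^sup>2 + 2 * k * norm u \<le> (2 * k * norm x + 2 * k\<^sup>2) - (1/2) * ?v\<^sup>2" by simp
    then have "exp (- ?v\<^sup>2 + 2 * k * norm u) \<le> exp ((2 * k * norm x + 2 * k\<^sup>2) + - ((1/2) * ?v\<^sup>2))" by simp
    moreover have "(exp (- ?v\<^sup>2 / 2 + k * norm u))\<^sup>2 = exp (- ?v\<^sup>2 + 2 * k * norm u)"
      unfolding exp_double[symmetric] by (simp add: algebra_simps)
    moreover have "- x + u = u - x" by simp
    ultimately show ?thesis unfolding exp_add[of "2 * k * norm x + 2 * k\<^sup>2"] by (simp only:)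
  qed
  have "integrable lborel (\<lambda>u::real^'n. exp (- ((1/2) * (norm (- x + u))\<^sup>2)))"
    using lborel_shift(2)[of "\<lambda>u::real^'n. exp (- ((1/2) * (norm u)\<^sup>2))" "- x"] gaussian_integrable[of "1/2", where 'a="real^'n"]
    by auto
  then have g: "integrable lborel (\<lambda>u. c\<^sup>2 * ?g u)" by (intro integrable_mult_right)
  have "integrable lborel (\<lambda>u. (c * exp (- (norm (u - x))\<^sup>2 / 2 + k * norm u))\<^sup>2)"
  proof (rule Bochner_Integration.integrable_bound[OF g])
    show "AE u in lborel. norm ((c * exp (- (norm (u - x))\<^sup>2 / 2 + k * norm u))\<^sup>2) \<le> norm (c\<^sup>2 * ?g u)"
    proof (rule AE_I2)
      fix u
      have "norm ((c * exp (- (norm (u - x))\<^sup>2 / 2 + k * norm u))\<^sup>2) = c\<^sup>2 * (exp (- (norm (u - x))\<^sup>2 / 2 + k * norm u))\<^sup>2"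
        by (simp add: power_mult_distrib)
      also have "\<dots> \<le> c\<^sup>2 * ?g u" by (intro mult_left_mono le) simp
      also have "\<dots> \<le> norm (c\<^sup>2 * ?g u)" by simp
      finally show "norm ((c * exp (- (norm (u - x))\<^sup>2 / 2 + k * norm u))\<^sup>2) \<le> norm (c\<^sup>2 * ?g u)" .
    qed
    show "(\<lambda>u. (c * exp (- (norm (u - x))\<^sup>2 / 2 + k * norm u))\<^sup>2) \<in> borel_measurable lborel" by measurable
  qed
  moreover have "(\<lambda>u. complex_of_real (c * exp (- (norm (u - x))\<^sup>2 / 2 + k * norm u))) \<in> borel_measurable lborel"
    by measurable
  ultimately show ?thesis unfolding L2_space_def by (simp only: mem_Collect_eq norm_of_real power2_abs)
qed

text \<open>Complex differentiability along a complex line, in the L2 norm and with a quadratic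
  remainder. The pointwise remainder is at most \<open>(cmod h)\<^sup>2\<close> times one
  square-integrable function that does not depend on \<open>h\<close>, and \<open>M\<close> is the
  norm of that function.\<close>

lemma hol_state_expansion:
  fixes Z P :: "'n::finite phase"
  obtains D M where "D \<in> L2_space" "M \<ge> 0"
    "\<And>h. cmod h \<le> 1 \<Longrightarrow> L2_norm (\<lambda>u. hol_state (Z + cx_scale h P) u - hol_state Z u - h * D u) \<le> M * (cmod h)\<^sup>2"
proof -
  define L :: "real ^ 'n \<Rightarrow> complex" where "L = (\<lambda>u. cx_dot u P - cx_bil Z P / 2)"
  define g :: complex where "g = - cx_bil P P / 4"
  \<comment> \<open>\<open>cx_dot u P\<close> grows at most linearly in \<open>norm u\<close>;
    \<open>k\<close> is twice this rate, the doubling being that of the exponent in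
    \<open>exp_remainder\<close>. The terms independent of \<open>u\<close> are collected in
    \<open>m\<close>.\<close>
  define k :: real where "k = 2 * (norm (fst P) + norm (snd P))"
  define m :: real where "m = 2 * (cmod (cx_bil Z P / 2) + cmod g)"
  define c :: real where "c = 3 * exp m * exp ((norm Z)\<^sup>2 / 4) * pi powr (- real CARD('n) / 4)"
  define G :: "real ^ 'n \<Rightarrow> complex" where
    "G = (\<lambda>u. of_real (c * exp (- (norm (u - fst Z))\<^sup>2 / 2 + k * norm u)))"
  have G: "G \<in> L2_space" unfolding G_def by (rule gaussian_exp_L2) (simp add: k_def)
  have L: "2 * (cmod (L u) + cmod g) \<le> m + k * norm u" for u
  proof -
    have "cmod (cx_dot u P) \<le> \<bar>u \<bullet> fst P\<bar> + \<bar>u \<bullet> snd P\<bar>"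
      unfolding cx_dot_def by (rule order_trans[OF norm_triangle_ineq]) (simp add: norm_mult)
    also have "\<dots> \<le> norm u * norm (fst P) + norm u * norm (snd P)"
      by (intro add_mono Cauchy_Schwarz_ineq2)
    finally have 1: "cmod (cx_dot u P) \<le> norm u * norm (fst P) + norm u * norm (snd P)" .
    have 2: "cmod (cx_dot u P - cx_bil Z P / 2) \<le> cmod (cx_dot u P) + cmod (cx_bil Z P / 2)" by (rule norm_triangle_ineq4)
    have "2 * (A + g) \<le> 2 * (B + g) + (2 * (p + q)) * n" if "D \<le> n * p + n * q" "A \<le> D + B"
      for A B D g n p q :: real
      using that by (simp add: algebra_simps)
    from this[OF 1 2] show ?thesis unfolding m_def k_def L_def .
  qed
  have norm_hol: "cmod (hol_state Z u) = exp ((norm Z)\<^sup>2 / 4) * (pi powr (- real CARD('n) / 4) * exp (- (norm (u - fst Z))\<^sup>2 / 2))" for u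
    by (simp add: hol_state_def norm_mult norm_coherent_state)
  have meas [measurable]: "hol_state Y \<in> borel_measurable borel" for Y :: "'n::finite phase"
    by (rule L2_measurable[OF hol_state_L2])
  have [measurable]: "L \<in> borel_measurable borel"
    unfolding L_def cx_dot_def by measurable
  let ?D = "\<lambda>u. hol_state Z u * L u"
  have bound: "cmod (hol_state Z u) * (3 * exp (2 * (cmod (L u) + cmod g))) \<le> cmod (G u)" for u
  proof -
    have "3 * exp (2 * (cmod (L u) + cmod g)) \<le> 3 * exp (m + k * norm u)" using L[of u] by simp
    then have "cmod (hol_state Z u) * (3 * exp (2 * (cmod (L u) + cmod g))) \<le> cmod (hol_state Z u) * (3 * exp (m + k * norm u))"
      by (rule mult_left_mono) simp
    also have "\<dots> = c * (exp (- (norm (u - fst Z))\<^sup>2 / 2) * exp (k * norm u))"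
      unfolding norm_hol exp_add[of m] c_def by (simp only: ac_simps)
    also have "\<dots> = cmod (G u)"
      unfolding G_def norm_of_real exp_add[symmetric] c_def by (simp only: abs_mult abs_exp_cancel abs_numeral powr_ge_zero abs_of_nonneg)
    finally show ?thesis .
  qed
  show ?thesis
  proof (rule that[of ?D "L2_norm G"])
    show "?D \<in> L2_space"
    proof (rule L2_bound[OF G])
      fix u
      have "cmod (L u) \<le> exp (2 * (cmod (L u) + cmod g))"
        by (rule le_exp_double) auto
      also have "\<dots> \<le> 3 * exp (2 * (cmod (L u) + cmod g))" by simp
      finally have "cmod (L u) \<le> 3 * exp (2 * (cmod (L u) + cmod g))" .
      from mult_left_mono[OF this norm_ge_zero[of "hol_state Z u"]] bound[of u]
      show "cmod (?D u) \<le> cmod (G u)" unfolding norm_mult by linarith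
    qed measurable
    show "L2_norm G \<ge> 0" by simp
    fix h assume h: "cmod h \<le> 1"
    have "L2_norm (\<lambda>u. hol_state (Z + cx_scale h P) u - hol_state Z u - h * ?D u)
       \<le> L2_norm (\<lambda>u. of_real ((cmod h)\<^sup>2) * G u)"
    proof (rule L2_norm_mono)
      show "(\<lambda>u. of_real ((cmod h)\<^sup>2) * G u) \<in> L2_space" by (rule L2_cmult[OF G])
      fix u
      have "hol_state (Z + cx_scale h P) u = hol_state Z u * exp (h * L u + h\<^sup>2 * g)"
        unfolding hol_state_shift L_def g_def ..
      then have "hol_state (Z + cx_scale h P) u - hol_state Z u - h * ?D u =
         hol_state Z u * (exp (h * L u + h\<^sup>2 * g) - 1 - h * L u)"
        by (simp only: right_diff_distrib mult_1_right mult.left_commute)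
      then have "cmod (hol_state (Z + cx_scale h P) u - hol_state Z u - h * ?D u) =
         cmod (hol_state Z u) * cmod (exp (h * L u + h\<^sup>2 * g) - 1 - h * L u)"
        by (simp only: norm_mult)
      also have "\<dots> \<le> cmod (hol_state Z u) * (3 * (cmod h)\<^sup>2 * exp (2 * (cmod (L u) + cmod g)))"
        by (intro mult_left_mono exp_remainder h norm_ge_zero)
      also have "\<dots> = (cmod h)\<^sup>2 * (cmod (hol_state Z u) * (3 * exp (2 * (cmod (L u) + cmod g))))"
        by (simp only: ac_simps)
      also have "\<dots> \<le> (cmod h)\<^sup>2 * cmod (G u)" by (intro mult_left_mono bound) simp
      finally show "cmod (hol_state (Z + cx_scale h P) u - hol_state Z u - h * ?D u) \<le> cmod (of_real ((cmod h)\<^sup>2) * G u)"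
        by (simp only: norm_mult norm_of_real abs_power2)
    qed measurable
    also have "\<dots> = L2_norm G * (cmod h)\<^sup>2"
      unfolding L2_norm_cmult norm_of_real abs_power2 by (rule mult.commute)
    finally show "L2_norm (\<lambda>u. hol_state (Z + cx_scale h P) u - hol_state Z u - h * ?D u) \<le> L2_norm G * (cmod h)\<^sup>2" .
  qed
qed

section \<open>Norm continuity of coherent states and bounded sesquilinear forms\<close>

lemma L2_norm_coherent_diff:
  "L2_norm (\<lambda>u. coherent_state X u - coherent_state Z u) =
     sqrt (2 - 2 * Re (exp (of_real (- (norm (X - Z))\<^sup>2 / 4) + \<i> / 2 * of_real (sympl X Z))))"
proof -
  let ?d = "\<lambda>u. coherent_state X u - coherent_state Z u"
  have "complex_of_real ((L2_norm ?d)\<^sup>2) = L2_inner ?d ?d" by (simp only: L2_inner_self)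
  also have "\<dots> = 2 - L2_inner (coherent_state X) (coherent_state Z) - cnj (L2_inner (coherent_state X) (coherent_state Z))"
    using L2_inner_cnj[of "coherent_state Z" "coherent_state X"]
    by (simp add: L2_inner_diff L2_diff L2_inner_self[of "coherent_state _"])
  finally have "(L2_norm ?d)\<^sup>2 = 2 - 2 * Re (L2_inner (coherent_state X) (coherent_state Z))"
    by (simp add: complex_eq_iff)
  then have "L2_norm ?d = sqrt (2 - 2 * Re (L2_inner (coherent_state X) (coherent_state Z)))"
    by (intro real_sqrt_unique[symmetric]) auto
  then show ?thesis by (simp only: coherent_state_inner)
qed

lemma coherent_state_tendsto:
  assumes "(f \<longlongrightarrow> Z) F"
  shows "((\<lambda>x. L2_norm (\<lambda>u. coherent_state (f x) u - coherent_state Z u)) \<longlongrightarrow> 0) F"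
proof -
  have "((\<lambda>x. sqrt (2 - 2 * Re (exp (of_real (- (norm (f x - Z))\<^sup>2 / 4) + \<i> / 2 * of_real (sympl (f x) Z)))))
     \<longlongrightarrow> sqrt (2 - 2 * Re (exp (of_real (- (norm (Z - Z))\<^sup>2 / 4) + \<i> / 2 * of_real (sympl Z Z))))) F"
    unfolding sympl_def by (intro tendsto_intros assms) auto
  then show ?thesis by (simp add: L2_norm_coherent_diff)
qed

text \<open>Abstracted from operators because it has three instances: the matrix elements of the
  given operator, the anti-Wick form of a bounded symbol, and the difference of two such
  forms.\<close>

locale bounded_sesquilinear =
  fixes B :: "(real ^ 'n::finite \<Rightarrow> complex) \<Rightarrow> (real ^ 'n \<Rightarrow> complex) \<Rightarrow> complex" and K :: real
  assumes add_left: "f \<in> L2_space \<Longrightarrow> g \<in> L2_space \<Longrightarrow> h \<in> L2_space \<Longrightarrow> B (\<lambda>u. f u + g u) h = B f h + B g h"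
    and add_right: "f \<in> L2_space \<Longrightarrow> g \<in> L2_space \<Longrightarrow> h \<in> L2_space \<Longrightarrow> B h (\<lambda>u. f u + g u) = B h f + B h g"
    and cmult_left: "f \<in> L2_space \<Longrightarrow> h \<in> L2_space \<Longrightarrow> B (\<lambda>u. c * f u) h = c * B f h"
    and cmult_right: "f \<in> L2_space \<Longrightarrow> h \<in> L2_space \<Longrightarrow> B h (\<lambda>u. c * f u) = cnj c * B h f"
    and bounded: "f \<in> L2_space \<Longrightarrow> g \<in> L2_space \<Longrightarrow> cmod (B f g) \<le> K * (L2_norm f * L2_norm g)"
    and K_nonneg: "K \<ge> 0"
begin

lemma diff_left:
  assumes "f \<in> L2_space" "g \<in> L2_space" "h \<in> L2_space"
  shows "B (\<lambda>u. f u - g u) h = B f h - B g h"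
  using add_left[OF assms(1) L2_cmult[OF assms(2), of "-1"] assms(3)] cmult_left[OF assms(2,3), of "-1"]
  by simp

lemma diff_right:
  assumes "f \<in> L2_space" "g \<in> L2_space" "h \<in> L2_space"
  shows "B h (\<lambda>u. f u - g u) = B h f - B h g"
  using add_right[OF assms(1) L2_cmult[OF assms(2), of "-1"] assms(3)] cmult_right[OF assms(2,3), of "-1"]
  by simp

lemma bounded_le:
  assumes "f \<in> L2_space" "g \<in> L2_space" "L2_norm f \<le> a" "L2_norm g \<le> b"
  shows "cmod (B f g) \<le> K * (a * b)"
proof -
  have "a \<ge> 0" using assms(3) L2_norm_nonneg[of f] by linarith
  then have "K * (L2_norm f * L2_norm g) \<le> K * (a * b)"
    using assms K_nonneg by (intro mult_left_mono mult_mono) auto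
  then show ?thesis using bounded[OF assms(1,2)] by linarith
qed

lemma coherent_continuous:
  assumes f: "continuous_on S f" and g: "continuous_on S g"
  shows "continuous_on S (\<lambda>x. B (coherent_state (f x)) (coherent_state (g x)))"
  unfolding continuous_on_def
proof
  fix x0 assume x0: "x0 \<in> S"
  let ?b = "\<lambda>x. B (coherent_state (f x)) (coherent_state (g x))"
  let ?F = "\<lambda>x. L2_norm (\<lambda>u. coherent_state (f x) u - coherent_state (f x0) u)"
  let ?G = "\<lambda>x. L2_norm (\<lambda>u. coherent_state (g x) u - coherent_state (g x0) u)"
  have "(?F \<longlongrightarrow> 0) (at x0 within S)" "(?G \<longlongrightarrow> 0) (at x0 within S)"
    using f g x0 by (auto simp: continuous_on_def intro: coherent_state_tendsto)
  then have "((\<lambda>x. K * (?F x + ?G x)) \<longlongrightarrow> K * (0 + 0)) (at x0 within S)"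
    by (intro tendsto_intros)
  then have lim: "((\<lambda>x. K * (?F x + ?G x)) \<longlongrightarrow> 0) (at x0 within S)" by simp
  have "cmod (?b x - ?b x0) \<le> K * (?F x + ?G x)" for x
  proof -
    have "?b x - ?b x0 = B (\<lambda>u. coherent_state (f x) u - coherent_state (f x0) u) (coherent_state (g x))
       + B (coherent_state (f x0)) (\<lambda>u. coherent_state (g x) u - coherent_state (g x0) u)"
      by (simp add: diff_left diff_right)
    also have "cmod \<dots> \<le> K * (?F x * 1) + K * (1 * ?G x)"
      by (intro norm_triangle_le add_mono bounded_le L2_diff) auto
    finally show ?thesis by (simp add: algebra_simps)
  qed
  then show "(?b \<longlongrightarrow> ?b x0) (at x0 within S)"
    using Lim_null_comparison[OF _ lim, of "\<lambda>x. ?b x - ?b x0"] by (simp add: LIM_zero_iff)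
qed

text \<open>Both slots respond complex-linearly to an increment \<open>h\<close> of
  \<open>w\<close>. The first is linear in a holomorphic state; the second is conjugate-linear, but
  its label moves by \<open>cnj h\<close>, and the two conjugations cancel.\<close>

lemma hol_state_holomorphic:
  "(\<lambda>w. B (hol_state (a + cx_scale w P)) (hol_state (b + cx_scale (cnj w) Q))) holomorphic_on UNIV"
proof -
  define \<phi> where "\<phi> = (\<lambda>w. B (hol_state (a + cx_scale w P)) (hol_state (b + cx_scale (cnj w) Q)))"
  have "\<exists>d. (\<phi> has_field_derivative d) (at w)" for w
  proof -
    define Z Y where "Z = a + cx_scale w P" and "Y = b + cx_scale (cnj w) Q"
    obtain D M where D: "D \<in> L2_space" "M \<ge> 0"
      "\<And>h. cmod h \<le> 1 \<Longrightarrow> L2_norm (\<lambda>u. hol_state (Z + cx_scale h P) u - hol_state Z u - h * D u) \<le> M * (cmod h)\<^sup>2"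
      using hol_state_expansion[of Z P] by blast
    obtain D' M' where D': "D' \<in> L2_space" "M' \<ge> 0"
      "\<And>h. cmod h \<le> 1 \<Longrightarrow> L2_norm (\<lambda>u. hol_state (Y + cx_scale h Q) u - hol_state Y u - h * D' u) \<le> M' * (cmod h)\<^sup>2"
      using hol_state_expansion[of Y Q] by blast
    let ?e = "hol_state Z" and ?f = "hol_state Y"
    define d where "d = B D ?f + B ?e D'"
    define N where "N = K * (M * (L2_norm ?f + (L2_norm D' + M'))) + K * (L2_norm D * (L2_norm D' + M')) + K * (L2_norm ?e * M')"
    have main: "cmod (\<phi> (w + h) - \<phi> w - h * d) \<le> N * (cmod h)\<^sup>2" if h: "cmod h \<le> 1" for h
    proof -
      let ?eh = "hol_state (Z + cx_scale h P)" and ?fh = "hol_state (Y + cx_scale (cnj h) Q)"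
      let ?r = "\<lambda>u. ?eh u - ?e u - h * D u" and ?s = "\<lambda>u. ?fh u - ?f u - cnj h * D' u"
      have r: "?r \<in> L2_space" "?s \<in> L2_space" by (intro L2_diff L2_cmult D D' hol_state_L2)+
      have rn: "L2_norm ?r \<le> M * (cmod h)\<^sup>2" "L2_norm ?s \<le> M' * (cmod h)\<^sup>2"
        using D(3)[OF h] D'(3)[of "cnj h"] h by auto
      have h2: "(cmod h)\<^sup>2 \<le> cmod h" using h by (simp add: power2_eq_square mult_left_le_one_le)
      have fh_f: "L2_norm (\<lambda>u. ?fh u - ?f u) \<le> cmod h * (L2_norm D' + M')"
      proof -
        have "L2_norm (\<lambda>u. cnj h * D' u + ?s u) \<le> L2_norm (\<lambda>u. cnj h * D' u) + L2_norm ?s"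
          by (rule L2_norm_add[OF L2_cmult[OF D'(1)] r(2)])
        also have "\<dots> \<le> cmod h * L2_norm D' + M' * cmod h"
          using rn(2) h2 D'(2) mult_left_mono[OF h2 D'(2)] by (simp add: L2_norm_cmult)
        finally show ?thesis by (simp add: algebra_simps)
      qed
      have fh: "L2_norm ?fh \<le> L2_norm ?f + (L2_norm D' + M')"
      proof -
        have "L2_norm (\<lambda>u. ?f u + (?fh u - ?f u)) \<le> L2_norm ?f + L2_norm (\<lambda>u. ?fh u - ?f u)"
          by (intro L2_norm_add L2_diff hol_state_L2)
        moreover have "cmod h * (L2_norm D' + M') \<le> 1 * (L2_norm D' + M')"
          using h D'(2) by (intro mult_right_mono) auto
        ultimately show ?thesis using fh_f by simp
      qed
      have shift: "\<phi> (w + h) = B ?eh ?fh" "\<phi> w = B ?e ?f"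
        by (simp_all add: \<phi>_def Z_def Y_def cx_scale_add_left add.assoc)
      have hD: "(\<lambda>u. h * D u) \<in> L2_space" "(\<lambda>u. cnj h * D' u) \<in> L2_space"
        by (intro L2_cmult D D')+
      have t1: "B ?r ?fh = B ?eh ?fh - B ?e ?fh - h * B D ?fh"
        using diff_left[OF L2_diff[OF hol_state_L2 hol_state_L2] hD(1) hol_state_L2]
          diff_left[OF hol_state_L2 hol_state_L2 hol_state_L2] cmult_left[OF D(1) hol_state_L2] by simp
      have t2: "B D (\<lambda>u. ?fh u - ?f u) = B D ?fh - B D ?f"
        by (rule diff_right[OF hol_state_L2 hol_state_L2 D(1)])
      have t3: "B ?e ?s = B ?e ?fh - B ?e ?f - h * B ?e D'"
        using diff_right[OF L2_diff[OF hol_state_L2 hol_state_L2] hD(2) hol_state_L2]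
          diff_right[OF hol_state_L2 hol_state_L2 hol_state_L2] cmult_right[OF D'(1) hol_state_L2] by simp
      \<comment> \<open>The error in the product rule. The outer terms contain a remainder of second
        order; the middle one is a product of two quantities of first order.\<close>
      have "\<phi> (w + h) - \<phi> w - h * d = B ?r ?fh + (h * B D (\<lambda>u. ?fh u - ?f u) + B ?e ?s)"
        unfolding shift d_def t1 t2 t3 by (simp only: algebra_simps)
      then have "cmod (\<phi> (w + h) - \<phi> w - h * d) \<le> cmod (B ?r ?fh) + (cmod h * cmod (B D (\<lambda>u. ?fh u - ?f u)) + cmod (B ?e ?s))"
        by (simp only: norm_mult[symmetric]) (intro norm_triangle_mono norm_triangle_ineq order_refl)
      also have "\<dots> \<le> K * (M * (cmod h)\<^sup>2 * (L2_norm ?f + (L2_norm D' + M'))) +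
          (cmod h * (K * (L2_norm D * (cmod h * (L2_norm D' + M')))) + K * (L2_norm ?e * (M' * (cmod h)\<^sup>2)))"
      proof (intro add_mono mult_left_mono norm_ge_zero)
        show "cmod (B ?r ?fh) \<le> K * (M * (cmod h)\<^sup>2 * (L2_norm ?f + (L2_norm D' + M')))"
          by (rule bounded_le[OF r(1) hol_state_L2 rn(1) fh])
        show "cmod (B D (\<lambda>u. ?fh u - ?f u)) \<le> K * (L2_norm D * (cmod h * (L2_norm D' + M')))"
          by (rule bounded_le[OF D(1) L2_diff[OF hol_state_L2 hol_state_L2] order_refl fh_f])
        show "cmod (B ?e ?s) \<le> K * (L2_norm ?e * (M' * (cmod h)\<^sup>2))"
          by (rule bounded_le[OF hol_state_L2 r(2) order_refl rn(2)])
      qed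
      also have "\<dots> = N * (cmod h)\<^sup>2"
        unfolding N_def power2_eq_square by (simp only: algebra_simps)
      finally show ?thesis .
    qed
    have "((\<lambda>h. (\<phi> (w + h) - \<phi> w) / h - d) \<longlongrightarrow> 0) (at 0)"
    proof (rule Lim_null_comparison)
      have "cmod ((\<phi> (w + h) - \<phi> w) / h - d) \<le> N * cmod h" if h: "h \<noteq> 0" "cmod h \<le> 1" for h
      proof -
        have "(\<phi> (w + h) - \<phi> w) / h - d = (\<phi> (w + h) - \<phi> w - h * d) / h" using h by (simp add: field_simps)
        then have "cmod ((\<phi> (w + h) - \<phi> w) / h - d) \<le> N * (cmod h)\<^sup>2 / cmod h"
          using main[OF h(2)] by (simp add: norm_divide divide_right_mono)
        then show ?thesis using h by (simp add: power2_eq_square)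
      qed
      then show "\<forall>\<^sub>F h in at 0. cmod ((\<phi> (w + h) - \<phi> w) / h - d) \<le> N * cmod h"
        unfolding eventually_at by (intro exI[of _ 1]) auto
      have "((\<lambda>h. N * cmod h) \<longlongrightarrow> N * cmod 0) (at 0)" by (intro tendsto_intros)
      then show "((\<lambda>h. N * cmod h) \<longlongrightarrow> 0) (at 0)" by simp
    qed
    then show ?thesis by (auto simp: DERIV_def LIM_zero_iff)
  qed
  then have "\<phi> holomorphic_on UNIV"
    by (auto simp: holomorphic_on_def field_differentiable_def)
  then show ?thesis by (simp add: \<phi>_def)
qed

definition H :: "'n phase \<Rightarrow> 'n phase \<Rightarrow> complex" where
  "H p q = B (coherent_state p) (coherent_state q) / L2_inner (coherent_state p) (coherent_state q)"

text \<open>The integrand of the symbol: \<open>x\<close> is the midpoint and \<open>z\<close> half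
  the difference of the two labels.\<close>

definition Hw :: "'n phase \<Rightarrow> 'n phase \<Rightarrow> complex" where
  "Hw x z = H (x + z) (x - z) * of_real (exp (- (norm z)\<^sup>2 / 2))"

text \<open>The norms introduced by \<open>hol_state\<close> cancel against those in the
  denominator, leaving only \<open>herm p q\<close>. Every remaining factor is holomorphic in
  \<open>p\<close> and antiholomorphic in \<open>q\<close>.\<close>

lemma H_hol_state: "H p q = B (hol_state p) (hol_state q) * exp (- herm p q / 2)"
proof -
  have "B (hol_state p) (hol_state q) = exp (of_real ((norm p)\<^sup>2 / 4 + (norm q)\<^sup>2 / 4)) * B (coherent_state p) (coherent_state q)"
    unfolding hol_state_def[abs_def] exp_of_real exp_add of_real_mult
    by (simp add: cmult_left cmult_right L2_cmult)
  then have "B (hol_state p) (hol_state q) * exp (- herm p q / 2) = B (coherent_state p) (coherent_state q) *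
      exp (of_real ((norm p)\<^sup>2 / 4 + (norm q)\<^sup>2 / 4) + - herm p q / 2)"
    unfolding exp_add[of "of_real ((norm p)\<^sup>2 / 4 + (norm q)\<^sup>2 / 4)"] by (simp only: ac_simps)
  also have "of_real ((norm p)\<^sup>2 / 4 + (norm q)\<^sup>2 / 4) + - herm p q / 2 = - (of_real (- (norm (p - q))\<^sup>2 / 4) + \<i> / 2 * of_real (sympl p q))"
    unfolding power2_norm_eq_inner by (simp add: herm_def complex_eq_iff inner_simps inner_commute field_simps)
  also have "B (coherent_state p) (coherent_state q) * exp (- (of_real (- (norm (p - q))\<^sup>2 / 4) + \<i> / 2 * of_real (sympl p q))) = H p q"
    unfolding H_def coherent_state_inner exp_minus by (rule divide_inverse[symmetric])
  finally show ?thesis by simp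
qed

lemma H_continuous:
  assumes "continuous_on S f" "continuous_on S g"
  shows "continuous_on S (\<lambda>x. H (f x) (g x))"
  unfolding H_def coherent_state_inner
  by (intro continuous_intros coherent_continuous assms) auto

lemma Hw_continuous:
  assumes "continuous_on S f" "continuous_on S g"
  shows "continuous_on S (\<lambda>x. Hw (f x) (g x))"
  unfolding Hw_def by (intro continuous_intros H_continuous assms) auto

text \<open>The factor \<open>exp (\<i> * sympl z (fst p) + (norm (snd p))\<^sup>2 / 2)\<close> turns
  \<open>Hw (x + fst p) (z + snd p)\<close>, as a function of \<open>p\<close>, into an entire function of
  \<open>fst p + snd p\<close> and the conjugate of \<open>fst p - snd p\<close>.\<close>

lemma Hw_mean_value:
  fixes x z :: "'n phase"
  assumes s: "s > 0"
    and int: "integrable lborel (\<lambda>p. Hw (x + fst p) (z + snd p) *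
      exp (\<i> * of_real (sympl z (fst p)) + of_real ((norm (snd p))\<^sup>2 / 2)) * of_real (exp (- (s * (norm p)\<^sup>2))))"
  shows "(LINT p|lborel. Hw (x + fst p) (z + snd p) *
      exp (\<i> * of_real (sympl z (fst p)) + of_real ((norm (snd p))\<^sup>2 / 2)) * of_real (exp (- (s * (norm p)\<^sup>2)))) =
      Hw x z * of_real ((pi / s) ^ (2 * CARD('n)))"
proof -
  define F where "F = (\<lambda>p. Hw (x + fst p) (z + snd p) * exp (\<i> * of_real (sympl z (fst p)) + of_real ((norm (snd p))\<^sup>2 / 2)))"
  define w :: "'n phase \<times> 'n phase \<Rightarrow> real" where "w = (\<lambda>p. exp (- (s * (norm p)\<^sup>2)))"
  \<comment> \<open>The restriction of \<open>F\<close> to a complex line, written out so that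
    holomorphy is visible: the form of two holomorphic states times the exponential of a quadratic
    polynomial in \<open>\<zeta>\<close>.\<close>
  define \<phi> where "\<phi> = (\<lambda>p \<zeta>. B (hol_state ((x + z) + cx_scale \<zeta> (fst p + snd p))) (hol_state ((x - z) + cx_scale (cnj \<zeta>) (fst p - snd p))) *
      exp (- herm (x + z) (x - z) / 2 - of_real ((norm z)\<^sup>2 / 2) - \<zeta> * (herm (fst p + snd p) x + herm x (fst p - snd p)) / 2
        - \<zeta>\<^sup>2 * herm (fst p + snd p) (fst p - snd p) / 2))"
  have hol: "\<phi> p holomorphic_on UNIV" for p
    unfolding \<phi>_def by (intro holomorphic_intros hol_state_holomorphic) auto
  have F_eq: "F (cx_rotation cxJ \<zeta> p) = \<phi> p \<zeta>" for p \<zeta>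
  proof -
    obtain x' z' where p: "p = (x', z')" by (metis surj_pair)
    define P Q where "P = cx_scale \<zeta> (x' + z')" and "Q = cx_scale (cnj \<zeta>) (x' - z')"
    define x2 z2 where "x2 = fst (cx_rotation cxJ \<zeta> p)" and "z2 = snd (cx_rotation cxJ \<zeta> p)"
    have PQ: "x2 + z2 = P" "x2 - z2 = Q"
      by (simp_all add: x2_def z2_def P_def Q_def p cx_rotation_def cx_scale_def cxJ_add cxJ_diff algebra_simps)
    have a: "(x + x2) + (z + z2) = (x + z) + P" "(x + x2) - (z + z2) = (x - z) + Q"
      using PQ by (auto simp: algebra_simps)
    \<comment> \<open>This is where the correction factor comes from: it cancels the square of
      \<open>norm z2\<close> and turns the remaining real inner product into a combination of
      \<open>herm z Q\<close> and \<open>herm P z\<close>, both of which are linear in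
      \<open>\<zeta>\<close>.\<close>
    have h1: "- of_real ((norm (z + z2))\<^sup>2 / 2) + (\<i> * of_real (sympl z x2) + of_real ((norm z2)\<^sup>2 / 2)) =
       - of_real ((norm z)\<^sup>2 / 2) + (herm z Q - herm P z) / 2"
      unfolding PQ[symmetric] herm_add herm_diff power2_norm_eq_inner using sympl_anti[of z z2] sympl_anti[of z x2]
      by (simp add: herm_def complex_eq_iff inner_simps inner_commute field_simps)
    have h2: "herm (x + z + P) (x - z + Q) = herm (x + z) (x - z) + \<zeta> * (herm (x' + z') (x - z) + herm (x + z) (x' - z'))
        + \<zeta>\<^sup>2 * herm (x' + z') (x' - z')"
      unfolding P_def Q_def by (simp only: herm_add(1)[of "x + z"] herm_add(2)[of _ "x - z"] herm_scale complex_cnj_cnj)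
        (simp add: power2_eq_square algebra_simps)
    have h3: "herm z Q - herm P z = \<zeta> * (herm z (x' - z') - herm (x' + z') z)"
      unfolding P_def Q_def herm_scale by (simp add: algebra_simps)
    have "F (cx_rotation cxJ \<zeta> p) = B (hol_state (x + z + P)) (hol_state (x - z + Q)) *
        exp (- herm (x + z + P) (x - z + Q) / 2 + (- of_real ((norm (z + z2))\<^sup>2 / 2) + (\<i> * of_real (sympl z x2) + of_real ((norm z2)\<^sup>2 / 2))))"
    proof -
      have e: "complex_of_real (exp (- (norm (z + z2))\<^sup>2 / 2)) = exp (- of_real ((norm (z + z2))\<^sup>2 / 2))"
        by (simp add: exp_of_real[symmetric])
      show ?thesis
        unfolding F_def x2_def[symmetric] z2_def[symmetric] Hw_def a H_hol_state e
          exp_add[of "- herm (x + z + P) (x - z + Q) / 2"] exp_add[of "- of_real ((norm (z + z2))\<^sup>2 / 2)"]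
        by (simp only: mult.assoc)
    qed
    also have "- herm (x + z + P) (x - z + Q) / 2 + (- of_real ((norm (z + z2))\<^sup>2 / 2) + (\<i> * of_real (sympl z x2) + of_real ((norm z2)\<^sup>2 / 2)))
       = - herm (x + z) (x - z) / 2 - of_real ((norm z)\<^sup>2 / 2) - \<zeta> * (herm (x' + z') x + herm x (x' - z')) / 2
        - \<zeta>\<^sup>2 * herm (x' + z') (x' - z') / 2"
      unfolding h1 h2 h3 herm_diff(2)[of "x' + z'" x z] herm_add(1)[of x z "x' - z'"] by (simp add: field_simps)
    finally show ?thesis unfolding \<phi>_def p fst_conv snd_conv P_def[symmetric] Q_def[symmetric] .
  qed
  have F0: "F 0 = Hw x z" by (simp add: F_def sympl_def)
  \<comment> \<open>\<open>F_eq\<close> holds for every complex \<open>\<zeta>\<close>, not just on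
    the unit circle, so it also gives the value at the centre.\<close>
  have "cx_rotation cxJ 0 p = 0" for p :: "'n phase \<times> 'n phase" by (simp add: cx_rotation_def zero_prod_def)
  then have \<phi>0: "\<phi> p 0 = F 0" for p using F_eq[of 0 p] by simp
  have "(LINT p|lborel. F p * of_real (w p)) = F 0 * of_real (LINT p|lborel. w p)"
  proof (rule cx_rotation_mean_value[OF linear_cxJ cxJ_cxJ])
    show "continuous_on UNIV F"
      unfolding F_def by (intro continuous_intros Hw_continuous) auto
    show "w \<in> borel_measurable borel" unfolding w_def by measurable
    show "w (cx_rotation cxJ \<zeta> p) = w p" if "cmod \<zeta> = 1" for p \<zeta>
    proof -
      obtain x' z' where p: "p = (x', z')" by (metis surj_pair)
      define c d where "c = Re \<zeta>" and "d = Im \<zeta>"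
      have cd: "c * c + d * d = 1" using that by (simp add: c_def d_def cmod_def power2_eq_square)
      \<comment> \<open>The cross terms cancel because \<open>cxJ\<close> is skew-symmetric.\<close>
      have "cx_rotation cxJ \<zeta> p \<bullet> cx_rotation cxJ \<zeta> p = (c * c + d * d) * (x' \<bullet> x' + z' \<bullet> z')"
        using inner_cxJ(2)[of x' z'] inner_cxJ(2)[of z' x']
        by (simp add: p cx_rotation_def c_def[symmetric] d_def[symmetric] inner_simps inner_cxJ(1) inner_commute algebra_simps)
      then have "(norm (cx_rotation cxJ \<zeta> p))\<^sup>2 = (norm p)\<^sup>2"
        unfolding power2_norm_eq_inner cd p by simp
      then show ?thesis by (simp only: w_def)
    qed
    show "integrable lborel (\<lambda>p. F p * of_real (w p))" using int by (simp only: F_def w_def)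
    show "\<exists>\<psi>. \<psi> holomorphic_on UNIV \<and> \<psi> 0 = F 0 \<and> (\<forall>\<zeta>. cmod \<zeta> = 1 \<longrightarrow> F (cx_rotation cxJ \<zeta> p) = \<psi> \<zeta>)" for p
      using hol F_eq \<phi>0 by blast
  qed
  moreover have "(LINT p|lborel. w p) = (pi / s) ^ (2 * CARD('n))"
  proof -
    \<comment> \<open>Pairs of phase space points have real dimension four times
      \<open>CARD('n)\<close>.\<close>
    have "(LINT p|lborel. w p) = sqrt (pi / s) ^ (2 * (2 * CARD('n)))"
      unfolding w_def gaussian_integral_0[OF s] by (rule arg_cong[where f="\<lambda>k. sqrt (pi / s) ^ k"]) simp
    also have "\<dots> = (pi / s) ^ (2 * CARD('n))"
      unfolding power_mult[of _ 2 "2 * CARD('n)"] using s by (subst real_sqrt_pow2) auto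
    finally show ?thesis .
  qed
  ultimately show ?thesis unfolding F0 by (simp only: F_def w_def)
qed

end

subsection \<open>The anti-Wick symbol\<close>

text \<open>The bound is on nonnegative integrals, so that it contains the integrability of
  \<open>Hw x\<close>; the constant \<open>C\<close> leaves out the normalising factor.\<close>

locale bounded_symbol = bounded_sesquilinear B K
  for B :: "(real ^ 'n::finite \<Rightarrow> complex) \<Rightarrow> (real ^ 'n \<Rightarrow> complex) \<Rightarrow> complex" and K :: real +
  fixes C :: real
  assumes Hw_bound: "(\<integral>\<^sup>+z. ennreal (cmod (Hw x z)) \<partial>lborel) \<le> ennreal C"
    and C_nonneg: "C \<ge> 0"
begin

definition G :: "'n phase \<Rightarrow> complex" where
  "G x = of_real (1 / (2 * pi) ^ CARD('n)) * (LINT z|lborel. Hw x z)"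

lemma Hw_section_measurable [measurable]: "Hw x \<in> borel_measurable borel"
  using borel_measurable_continuous_onI[OF Hw_continuous[OF continuous_on_const continuous_on_id]] .

lemma Hw_integrable: "integrable lborel (Hw x)"
proof (rule integrableI_bounded)
  show "(\<integral>\<^sup>+z. ennreal (norm (Hw x z)) \<partial>lborel) < \<infinity>"
    using Hw_bound[of x] by (rule order_le_less_trans) simp
qed simp

lemma Hw_norm_integral: "(LINT z|lborel. cmod (Hw x z)) \<le> C"
  using Hw_bound[of x] nn_integral_eq_integral[OF integrable_norm[OF Hw_integrable[of x]]] C_nonneg
  by (simp add: ennreal_le_iff)

lemma lint_G: "(LINT z|lborel. Hw x z) = of_real ((2 * pi) ^ CARD('n)) * G x"
  by (simp add: G_def)

lemma cmod_G: "cmod (G x) \<le> C / (2 * pi) ^ CARD('n)"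
proof -
  have "cmod (LINT z|lborel. Hw x z) \<le> C"
    using integral_norm_bound[of lborel "Hw x"] Hw_norm_integral[of x] by linarith
  then show ?thesis
    by (simp add: G_def norm_mult norm_divide norm_power divide_right_mono)
qed

lemma Hw_shift_measurable:
  "(\<lambda>p. Hw (x + fst p) (z + snd p)) \<in> borel_measurable borel"
  by (intro borel_measurable_continuous_onI Hw_continuous continuous_intros)

text \<open>The weight decays in the first component only. Integrability in the second comes from
  \<open>Hw_bound\<close>, whose uniformity in the midpoint makes the estimate survive the
  integration over the first component.\<close>

lemma Hw_weight_integrable:
  assumes e [measurable]: "e \<in> borel_measurable borel" and v: "integrable lborel v"
    and le: "\<And>p. cmod (e p) \<le> v (fst p)"
  shows "integrable (lborel \<Otimes>\<^sub>M lborel) (\<lambda>p. Hw (x + fst p) (z + snd p) * e p)"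
proof (rule integrableI_bounded)
  have [measurable]: "v \<in> borel_measurable borel" using v by auto
  note [measurable] = Hw_shift_measurable
  have v0: "v y \<ge> 0" for y using order_trans[OF norm_ge_zero le[of "(y, 0)"]] by simp
  have m: "(\<lambda>p. Hw (x + fst p) (z + snd p) * e p) \<in> borel_measurable borel" by measurable
  then show "(\<lambda>p. Hw (x + fst p) (z + snd p) * e p) \<in> borel_measurable (lborel \<Otimes>\<^sub>M lborel)"
    unfolding lborel_prod by simp
  have "v \<circ> fst \<in> borel_measurable (borel \<Otimes>\<^sub>M (borel :: 'n phase measure))" by (intro measurable_comp[of _ _ borel]) measurable
  then have [measurable]: "(\<lambda>p. v (fst p)) \<in> borel_measurable (borel :: ('n phase \<times> 'n phase) measure)"
    unfolding borel_prod comp_def .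
  have "(\<integral>\<^sup>+p. ennreal (norm (Hw (x + fst p) (z + snd p) * e p)) \<partial>(lborel \<Otimes>\<^sub>M lborel)) \<le>
      (\<integral>\<^sup>+p. ennreal (v (fst p)) * ennreal (cmod (Hw (x + fst p) (z + snd p))) \<partial>(lborel \<Otimes>\<^sub>M lborel))"
    using le v0 by (intro nn_integral_mono) (auto simp: norm_mult mult.commute[of "cmod (Hw _ _)"] ennreal_mult[symmetric] intro!: ennreal_leI mult_right_mono)
  also have "\<dots> = (\<integral>\<^sup>+y. \<integral>\<^sup>+w. ennreal (v y) * ennreal (cmod (Hw (x + y) (z + w))) \<partial>lborel \<partial>lborel)"
    by (subst lborel.nn_integral_fst[symmetric]) (simp_all add: lborel_prod)
  also have "\<dots> = (\<integral>\<^sup>+y. ennreal (v y) * (\<integral>\<^sup>+w. ennreal (cmod (Hw (x + y) w)) \<partial>lborel) \<partial>lborel)"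
  proof (rule nn_integral_cong)
    fix y
    have "(\<integral>\<^sup>+w. ennreal (cmod (Hw (x + y) (z + w))) \<partial>lborel) = (\<integral>\<^sup>+w. ennreal (cmod (Hw (x + y) w)) \<partial>lborel)"
      by (rule lborel_shift_nn) simp
    moreover have "(\<lambda>w. ennreal (cmod (Hw (x + y) (z + w)))) \<in> borel_measurable lborel" by measurable
    ultimately show "(\<integral>\<^sup>+w. ennreal (v y) * ennreal (cmod (Hw (x + y) (z + w))) \<partial>lborel) =
        ennreal (v y) * (\<integral>\<^sup>+w. ennreal (cmod (Hw (x + y) w)) \<partial>lborel)"
      by (simp add: nn_integral_cmult)
  qed
  also have "\<dots> \<le> (\<integral>\<^sup>+y. ennreal (v y) * ennreal C \<partial>lborel)"
    by (intro nn_integral_mono mult_left_mono Hw_bound) simp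
  also have "\<dots> = (\<integral>\<^sup>+y. ennreal (v y) \<partial>lborel) * ennreal C" by (rule nn_integral_multc) simp
  also have "(\<integral>\<^sup>+y. ennreal (v y) \<partial>lborel) = ennreal (LINT y|lborel. v y)"
    using v v0 by (intro nn_integral_eq_integral) auto
  also have "\<dots> * ennreal C < \<infinity>" by (simp add: ennreal_mult_less_top)
  finally show "(\<integral>\<^sup>+p. ennreal (norm (Hw (x + fst p) (z + snd p) * e p)) \<partial>(lborel \<Otimes>\<^sub>M lborel)) < \<infinity>" .
qed

lemma norm_prod_sq: "(norm p)\<^sup>2 = (norm (fst p))\<^sup>2 + (norm (snd p))\<^sup>2"
  by (simp add: norm_prod_def)

lemma sympl_measurable [measurable (raw)]:
  "f \<in> borel_measurable M \<Longrightarrow> g \<in> borel_measurable M \<Longrightarrow> (\<lambda>p. sympl (f p) (g p)) \<in> borel_measurable M"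
  unfolding sympl_cxJ using borel_measurable_continuous_on[OF linear_continuous_on[OF linear_conv_bounded_linear[THEN iffD1, OF linear_cxJ]]]
  by (intro borel_measurable_inner) auto

text \<open>The mean value property with parameter 1/2: in \<open>snd p\<close> the Gaussian cancels
  the correction factor exactly, and the remaining weight depends on \<open>fst p\<close> alone. The
  inner integral is then a translate of the one defining \<open>G (x + y)\<close>.\<close>

lemma Hw_reproducing:
  "(LINT y|lborel. G (x + y) * exp (\<i> * of_real (sympl z y)) * of_real (exp (- (1/2 * (norm y)\<^sup>2)))) =
     of_real ((2 * pi) ^ CARD('n)) * Hw x z"
proof -
  let ?e = "\<lambda>p::'n phase \<times> 'n phase. exp (\<i> * of_real (sympl z (fst p))) * of_real (exp (- (1/2 * (norm (fst p))\<^sup>2)))"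
  let ?f = "\<lambda>p. Hw (x + fst p) (z + snd p) * ?e p"
  have eq: "Hw (x + fst p) (z + snd p) * exp (\<i> * of_real (sympl z (fst p)) + of_real ((norm (snd p))\<^sup>2 / 2)) *
      of_real (exp (- (1/2 * (norm p)\<^sup>2))) = ?f p" for p :: "'n phase \<times> 'n phase"
  proof -
    have "complex_of_real (exp (- (1/2 * (norm p)\<^sup>2))) = exp (- of_real ((norm (snd p))\<^sup>2 / 2)) * of_real (exp (- (1/2 * (norm (fst p))\<^sup>2)))"
      unfolding norm_prod_sq[of p] add.commute[of "(norm (fst p))\<^sup>2"] exp_of_real[symmetric] by (simp add: exp_add[symmetric] add_divide_distrib)
    then show ?thesis
      unfolding exp_add by (simp add: exp_minus)
  qed
  have int: "integrable (lborel \<Otimes>\<^sub>M lborel) ?f"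
  proof (rule Hw_weight_integrable)
    show "?e \<in> borel_measurable borel"
      by (intro borel_measurable_continuous_onI continuous_intros)
    show "integrable lborel (\<lambda>y::'n phase. exp (- (1/2 * (norm y)\<^sup>2)))" by (rule gaussian_integrable) simp
  qed (simp add: norm_mult)
  have "(LINT p|(lborel \<Otimes>\<^sub>M lborel). ?f p) = Hw x z * of_real ((pi / (1/2)) ^ (2 * CARD('n)))"
    using Hw_mean_value[of "1/2" x z] int unfolding eq lborel_prod by simp
  also have "(LINT p|(lborel \<Otimes>\<^sub>M lborel). ?f p) = (LINT y|lborel. LINT w|lborel. ?f (y, w))"
    by (rule lborel_pair.integral_fst'[OF int, symmetric])
  also have "\<dots> = (LINT y|lborel. of_real ((2 * pi) ^ CARD('n)) * (G (x + y) * exp (\<i> * of_real (sympl z y)) * of_real (exp (- (1/2 * (norm y)\<^sup>2)))))"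
  proof (rule Bochner_Integration.integral_cong[OF refl])
    fix y
    have "(LINT w|lborel. ?f (y, w)) = (LINT w|lborel. Hw (x + y) (z + w)) * ?e (y, 0)" by simp
    also have "(LINT w|lborel. Hw (x + y) (z + w)) = (LINT w|lborel. Hw (x + y) w)"
      by (rule lborel_shift(1)) simp
    finally show "(LINT w|lborel. ?f (y, w)) =
        of_real ((2 * pi) ^ CARD('n)) * (G (x + y) * exp (\<i> * of_real (sympl z y)) * of_real (exp (- (1/2 * (norm y)\<^sup>2))))"
      unfolding lint_G by (simp add: mult.assoc)
  qed
  also have "\<dots> = of_real ((2 * pi) ^ CARD('n)) *
      (LINT y|lborel. G (x + y) * exp (\<i> * of_real (sympl z y)) * of_real (exp (- (1/2 * (norm y)\<^sup>2))))"
    by (rule integral_mult_right_zero)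
  finally have "Hw x z * of_real ((pi / (1/2)) ^ (2 * CARD('n))) = of_real ((2 * pi) ^ CARD('n)) *
      (LINT y|lborel. G (x + y) * exp (\<i> * of_real (sympl z y)) * of_real (exp (- (1/2 * (norm y)\<^sup>2))))"
    by (rule sym)
  \<comment> \<open>One of these two factors cancels against the normalisation of
    \<open>G\<close>.\<close>
  moreover have "(pi / (1/2)) ^ (2 * CARD('n)) = (2 * pi) ^ CARD('n) * (2 * pi) ^ CARD('n)"
    unfolding mult_2[of "CARD('n)"] power_add by (simp add: mult.commute)
  ultimately have "of_real ((2 * pi) ^ CARD('n)) *
      (LINT y|lborel. G (x + y) * exp (\<i> * of_real (sympl z y)) * of_real (exp (- (1/2 * (norm y)\<^sup>2)))) =
      of_real ((2 * pi) ^ CARD('n)) * (of_real ((2 * pi) ^ CARD('n)) * Hw x z)"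
    by (simp only: of_real_mult ac_simps)
  then show ?thesis by simp
qed

text \<open>A symplectic Fourier transform of \<open>Hw y\<close>. It is bounded by \<open>C\<close>
  and continuous in \<open>h\<close>, whereas in \<open>y\<close> only measurability is established;
  the formula for \<open>G\<close> is arranged so that its argument enters through
  \<open>h\<close>.\<close>

definition Q :: "'n phase \<Rightarrow> 'n phase \<Rightarrow> complex" where
  "Q y h = (LINT w|lborel. Hw y w * exp (\<i> * of_real (sympl w h)))"

lemma cmod_Q: "cmod (Q y h) \<le> C"
proof -
  have "cmod (Q y h) \<le> (LINT w|lborel. cmod (Hw y w * exp (\<i> * of_real (sympl w h))))"
    unfolding Q_def by (rule integral_norm_bound)
  also have "\<dots> \<le> C" using Hw_norm_integral[of y] by (simp add: norm_mult)
  finally show ?thesis .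
qed

lemma Q_measurable:
  assumes f: "continuous_on UNIV f"
  shows "(\<lambda>y. Q y (f y)) \<in> borel_measurable borel"
proof -
  have "continuous_on UNIV (\<lambda>p. Hw (fst p) (snd p) * exp (\<i> * of_real (sympl (snd p) (f (fst p)))))"
    by (intro continuous_intros Hw_continuous continuous_on_compose2[OF f]) auto
  then have "(\<lambda>p. Hw (fst p) (snd p) * exp (\<i> * of_real (sympl (snd p) (f (fst p))))) \<in> borel_measurable (borel \<Otimes>\<^sub>M lborel)"
    unfolding measurable_cong_sets[OF sets_pair_measure_cong[OF refl sets_lborel] refl] borel_prod
    by (rule borel_measurable_continuous_onI)
  from lborel.borel_measurable_lebesgue_integral[of "\<lambda>y w. Hw y w * exp (\<i> * of_real (sympl w (f y)))" borel] this
  show ?thesis unfolding Q_def by (simp add: case_prod_beta)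
qed

text \<open>Integrating the mean value property over \<open>z\<close> expresses \<open>G\<close> through integrals whose
  dependence on \<open>x\<close> is dominated; the Gaussian \<open>exp (- (norm (snd p))\<^sup>2 / 2)\<close> remaining from the
  weight with parameter \<open>1\<close> makes the triple integral converge.\<close>

lemma G_eq_integral_Q:
  "of_real (pi ^ (2 * CARD('n))) * G x = (LINT y|lborel. Q y (y - x) * of_real (exp (- (3/2 * (norm (y - x))\<^sup>2))))"
proof -
  let ?v = "\<lambda>p::'n phase \<times> 'n phase. exp (- (1 * (norm (fst p))\<^sup>2)) * exp (- (1/2 * (norm (snd p))\<^sup>2))"
  let ?f = "\<lambda>z p. Hw (x + fst p) (z + snd p) * (exp (\<i> * of_real (sympl z (fst p))) * of_real (?v p))"
  have eq: "Hw (x + fst p) (z + snd p) * exp (\<i> * of_real (sympl z (fst p)) + of_real ((norm (snd p))\<^sup>2 / 2)) *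
      of_real (exp (- (1 * (norm p)\<^sup>2))) = ?f z p" for p :: "'n phase \<times> 'n phase" and z
  proof -
    have "complex_of_real (exp (- (1 * (norm p)\<^sup>2))) = exp (- of_real ((norm (snd p))\<^sup>2 / 2)) * of_real (?v p)"
      unfolding norm_prod_sq[of p] add.commute[of "(norm (fst p))\<^sup>2"] of_real_mult exp_of_real[symmetric] by (simp add: exp_add[symmetric])
    then show ?thesis
      unfolding exp_add by (simp add: exp_minus)
  qed
  have mv: "(LINT p|lborel. ?f z p) = Hw x z * of_real (pi ^ (2 * CARD('n)))" for z
  proof -
    have "integrable (lborel \<Otimes>\<^sub>M lborel) (?f z)"
    proof (rule Hw_weight_integrable)
      show "(\<lambda>p. exp (\<i> * of_real (sympl z (fst p))) * of_real (?v p)) \<in> borel_measurable borel"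
        by (intro borel_measurable_continuous_onI continuous_intros)
      show "integrable lborel (\<lambda>y::'n phase. exp (- (1 * (norm y)\<^sup>2)))" by (rule gaussian_integrable) simp
    qed (simp add: norm_mult)
    then show ?thesis
      using Hw_mean_value[of 1 x z] unfolding eq lborel_prod by simp
  qed
  have v: "integrable (lborel \<Otimes>\<^sub>M lborel) (\<lambda>p. ?v p)"
  proof -
    have "integrable lborel (\<lambda>p::'n phase \<times> 'n phase. exp (- (1/2 * (norm p)\<^sup>2)))"
      by (rule gaussian_integrable) simp
    then show ?thesis
      unfolding lborel_prod
    proof (rule Bochner_Integration.integrable_bound)
      show "?v \<in> borel_measurable lborel"
        unfolding measurable_lborel2 by (intro borel_measurable_continuous_onI continuous_intros)
      have "?v p \<le> exp (- (1/2 * (norm p)\<^sup>2))" for p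
        unfolding norm_prod_sq[of p] exp_add[symmetric] exp_le_cancel_iff by (simp add: field_simps)
      then show "AE p in lborel. norm (?v p) \<le> norm (exp (- (1/2 * (norm p)\<^sup>2)))"
        by (auto simp: abs_mult)
    qed
  qed
  have cont: "continuous_on UNIV (\<lambda>q. ?f (fst q) (snd q))"
    by (intro continuous_intros Hw_continuous)
  have fm: "(\<lambda>q. ?f (fst q) (snd q)) \<in> borel_measurable (lborel \<Otimes>\<^sub>M lborel)"
    unfolding lborel_prod using borel_measurable_continuous_onI[OF cont] by simp
  \<comment> \<open>Tonelli with the integral over \<open>z\<close> innermost: for each
    \<open>p\<close> it is a translate bounded by \<open>C\<close>, uniformly in the midpoint, and
    the Gaussian \<open>?v\<close> controls the integral over \<open>p\<close>.\<close>
  have fint: "integrable (lborel \<Otimes>\<^sub>M lborel) (\<lambda>q. ?f (fst q) (snd q))"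
  proof (rule integrableI_bounded[OF fm])
    have "(\<integral>\<^sup>+q. ennreal (norm (?f (fst q) (snd q))) \<partial>(lborel \<Otimes>\<^sub>M lborel)) =
       (\<integral>\<^sup>+p. \<integral>\<^sup>+z. ennreal (norm (?f z p)) \<partial>lborel \<partial>lborel)"
      using fm by (subst lborel_pair.nn_integral_snd[symmetric]) auto
    also have "\<dots> \<le> (\<integral>\<^sup>+p. ennreal (?v p) * ennreal C \<partial>lborel)"
    proof (rule nn_integral_mono)
      fix p :: "'n phase \<times> 'n phase"
      have m: "(\<lambda>z. ennreal (cmod (Hw (x + fst p) z))) \<in> borel_measurable borel" by measurable
      have m': "(\<lambda>z. ennreal (cmod (Hw (x + fst p) (snd p + z)))) \<in> borel_measurable lborel" by measurable
      have "(\<integral>\<^sup>+z. ennreal (norm (?f z p)) \<partial>lborel) = (\<integral>\<^sup>+z. ennreal (?v p) * ennreal (cmod (Hw (x + fst p) (snd p + z))) \<partial>lborel)"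
        by (rule nn_integral_cong) (simp add: norm_mult ennreal_mult[symmetric] ac_simps)
      also have "\<dots> = ennreal (?v p) * (\<integral>\<^sup>+z. ennreal (cmod (Hw (x + fst p) z)) \<partial>lborel)"
        unfolding nn_integral_cmult[OF m'] lborel_shift_nn[OF m] ..
      also have "\<dots> \<le> ennreal (?v p) * ennreal C" by (intro mult_left_mono Hw_bound) simp
      finally show "(\<integral>\<^sup>+z. ennreal (norm (?f z p)) \<partial>lborel) \<le> ennreal (?v p) * ennreal C" .
    qed
    also have "\<dots> = (\<integral>\<^sup>+p. ennreal (?v p) \<partial>lborel) * ennreal C"
      using v unfolding lborel_prod by (intro nn_integral_multc) auto
    also have "(\<integral>\<^sup>+p. ennreal (?v p) \<partial>lborel) = ennreal (LINT p|lborel. ?v p)"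
      using v unfolding lborel_prod by (intro nn_integral_eq_integral) auto
    also have "\<dots> * ennreal C < \<infinity>" by (simp add: ennreal_mult_less_top)
    finally show "(\<integral>\<^sup>+q. ennreal (norm (?f (fst q) (snd q))) \<partial>(lborel \<Otimes>\<^sub>M lborel)) < \<infinity>" .
  qed
  have fint': "integrable (lborel \<Otimes>\<^sub>M lborel) (\<lambda>(z, p). ?f z p)"
    using fint by (simp only: case_prod_unfold)
  \<comment> \<open>In the variable \<open>w = z + snd p\<close>, additivity of \<open>sympl\<close>
    splits off a phase that depends on \<open>p\<close> alone.\<close>
  have inner: "(LINT z|lborel. ?f z p) = Q (x + fst p) (fst p) * exp (\<i> * of_real (- sympl (snd p) (fst p))) * of_real (?v p)" for p
  proof -
    let ?g = "\<lambda>w. Hw (x + fst p) w * exp (\<i> * of_real (sympl (w - snd p) (fst p)))"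
    have "(LINT z|lborel. ?f z p) = (LINT z|lborel. ?g (snd p + z)) * of_real (?v p)"
      by (simp add: add.commute mult.assoc flip: integral_mult_left_zero)
    also have "(LINT z|lborel. ?g (snd p + z)) = (LINT w|lborel. ?g w)"
      by (rule lborel_shift(1)) measurable
    also have "(\<lambda>w. ?g w) = (\<lambda>w. Hw (x + fst p) w * exp (\<i> * of_real (sympl w (fst p))) * exp (\<i> * of_real (- sympl (snd p) (fst p))))"
      by (rule ext) (simp add: sympl_bilinear mult.assoc exp_add[symmetric] algebra_simps)
    also have "(LINT w|lborel. Hw (x + fst p) w * exp (\<i> * of_real (sympl w (fst p))) * exp (\<i> * of_real (- sympl (snd p) (fst p)))) =
        Q (x + fst p) (fst p) * exp (\<i> * of_real (- sympl (snd p) (fst p)))"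
      unfolding Q_def by (rule integral_mult_left_zero)
    finally show ?thesis .
  qed
  let ?h = "\<lambda>p. Q (x + fst p) (fst p) * exp (\<i> * of_real (- sympl (snd p) (fst p))) * of_real (?v p)"
  have hint: "integrable (lborel \<Otimes>\<^sub>M lborel) ?h"
  proof -
    from lborel_pair.integrable_snd[OF fint'] show ?thesis
      unfolding inner lborel_prod .
  qed
  have "of_real (pi ^ (2 * CARD('n))) * (LINT z|lborel. Hw x z) = (LINT z|lborel. LINT p|lborel. ?f z p)"
    unfolding mv by (simp add: mult.commute)
  also have "\<dots> = (LINT p|lborel. LINT z|lborel. ?f z p)"
    by (rule lborel_pair.Fubini_integral[OF fint', symmetric])
  also have "\<dots> = (LINT p|(lborel \<Otimes>\<^sub>M lborel). ?h p)"
    unfolding inner lborel_prod ..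
  also have "\<dots> = (LINT y|lborel. LINT w|lborel. ?h (y, w))"
    by (rule lborel_pair.integral_fst'[OF hint, symmetric])
  also have "\<dots> = (LINT y|lborel. of_real ((2 * pi) ^ CARD('n)) * (Q (x + y) y * of_real (exp (- (3/2 * (norm y)\<^sup>2)))))"
  proof (rule Bochner_Integration.integral_cong[OF refl])
    fix y :: "'n phase"
    \<comment> \<open>The split-off phase is a character in \<open>w\<close> with frequency
      \<open>- cxJ y\<close>. Its integral against the Gaussian in \<open>w\<close> yields
      \<open>exp (- (norm y)\<^sup>2 / 2)\<close>, and together with
      \<open>exp (- (norm y)\<^sup>2)\<close> this gives the constant 3/2.\<close>
    have "(LINT w|lborel. ?h (y, w)) = (LINT w|lborel. Q (x + y) y * of_real (exp (- (norm y)\<^sup>2)) *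
        exp (- of_real (1/2 * (norm w)\<^sup>2) + \<i> * of_real (w \<bullet> (- cxJ y))))"
    proof (rule Bochner_Integration.integral_cong[OF refl])
      fix w
      have "exp (- complex_of_real (1/2 * (norm w)\<^sup>2) + \<i> * of_real (w \<bullet> (- cxJ y))) =
          of_real (exp (- (1/2 * (norm w)\<^sup>2))) * exp (\<i> * of_real (- sympl w y))"
        unfolding exp_add sympl_cxJ by (simp add: exp_of_real[symmetric])
      then show "?h (y, w) = Q (x + y) y * of_real (exp (- (norm y)\<^sup>2)) *
          exp (- of_real (1/2 * (norm w)\<^sup>2) + \<i> * of_real (w \<bullet> (- cxJ y)))"
        by (simp only: fst_conv snd_conv of_real_mult ac_simps mult_1)
    qed
    also have "\<dots> = Q (x + y) y * of_real (exp (- (norm y)\<^sup>2)) *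
        of_real (sqrt (pi / (1/2)) ^ DIM('n phase) * exp (- (norm (- cxJ y))\<^sup>2 / (4 * (1/2))))"
      by (subst integral_mult_right_zero, subst gaussian_integral(2)) auto
    also have "sqrt (pi / (1/2)) ^ DIM('n phase) = (2 * pi) ^ CARD('n)"
    proof -
      have "DIM('n phase) = 2 * CARD('n)" by simp
      then show ?thesis by (simp only: power_mult) (simp add: mult.commute)
    qed
    also have "(norm (- cxJ y))\<^sup>2 = (norm y)\<^sup>2"
      by (simp add: power2_norm_eq_inner inner_cxJ(1))
    also have "complex_of_real ((2 * pi) ^ CARD('n) * exp (- (norm y)\<^sup>2 / (4 * (1/2)))) = of_real ((2 * pi) ^ CARD('n)) * of_real (exp (- (norm y)\<^sup>2 / 2))"
      by simp
    also have "Q (x + y) y * of_real (exp (- (norm y)\<^sup>2)) * \<dots> =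
        of_real ((2 * pi) ^ CARD('n)) * (Q (x + y) y * of_real (exp (- (norm y)\<^sup>2) * exp (- (norm y)\<^sup>2 / 2)))"
      by (simp only: of_real_mult ac_simps)
    also have "exp (- (norm y)\<^sup>2) * exp (- (norm y)\<^sup>2 / 2) = exp (- (3/2 * (norm y)\<^sup>2))"
      by (simp add: exp_add[symmetric])
    finally show "(LINT w|lborel. ?h (y, w)) = of_real ((2 * pi) ^ CARD('n)) * (Q (x + y) y * of_real (exp (- (3/2 * (norm y)\<^sup>2))))" .
  qed
  also have "\<dots> = of_real ((2 * pi) ^ CARD('n)) * (LINT y|lborel. Q (x + y) y * of_real (exp (- (3/2 * (norm y)\<^sup>2))))"
    by (rule integral_mult_right_zero)
  \<comment> \<open>Translation by \<open>x\<close> removes the parameter from the first argument of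
    \<open>Q\<close>, leaving it in the second argument and the Gaussian, where the dependence is
    continuous.\<close>
  also have "(LINT y|lborel. Q (x + y) y * of_real (exp (- (3/2 * (norm y)\<^sup>2)))) =
      (LINT y|lborel. Q (x + y) ((x + y) - x) * of_real (exp (- (3/2 * (norm ((x + y) - x))\<^sup>2))))" by simp
  also have "\<dots> = (LINT y|lborel. Q y (y - x) * of_real (exp (- (3/2 * (norm (y - x))\<^sup>2))))"
  proof (rule lborel_shift(1))
    have [measurable]: "(\<lambda>y. Q y (y - x)) \<in> borel_measurable borel" by (intro Q_measurable continuous_intros)
    show "(\<lambda>y. Q y (y - x) * of_real (exp (- (3/2 * (norm (y - x))\<^sup>2)))) \<in> borel_measurable borel" by measurable
  qed
  finally have "of_real ((2 * pi) ^ CARD('n)) * (of_real (pi ^ (2 * CARD('n))) * G x) =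
      of_real ((2 * pi) ^ CARD('n)) * (LINT y|lborel. Q y (y - x) * of_real (exp (- (3/2 * (norm (y - x))\<^sup>2))))"
    unfolding lint_G by (simp only: ac_simps)
  then show ?thesis by simp
qed

text \<open>Dominated convergence on two levels in \<open>G_eq_integral_Q\<close>: inside
  \<open>Q\<close>, where \<open>y\<close> is fixed and \<open>Hw y\<close> is its own majorant, and
  then in \<open>y\<close>, where \<open>Q\<close> is bounded by \<open>C\<close> and the Gaussians
  with moving centres have a common majorant.\<close>

lemma G_continuous: "continuous_on UNIV G"
proof (rule continuous_on_sequentiallyI)
  fix X :: "nat \<Rightarrow> 'n phase" and x assume X: "X \<longlonglongrightarrow> x"
  let ?q = "\<lambda>x y. Q y (y - x) * of_real (exp (- (3/2 * (norm (y - x))\<^sup>2)))"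
  have "(\<lambda>k. X k - x) \<longlonglongrightarrow> 0" using X by (simp add: LIM_zero_iff)
  then have "Bseq (\<lambda>k. X k - x)" by (intro convergent_imp_Bseq convergentI)
  then obtain R where R: "\<And>k. norm (X k - x) \<le> R" by (auto simp: Bseq_def)
  have Qm: "(\<lambda>y. Q y (y - x)) \<in> borel_measurable borel" for x by (intro Q_measurable continuous_intros)
  note [measurable] = Qm
  \<comment> \<open>By the triangle inequality \<open>(norm (y - x))\<^sup>2\<close> is at most
    \<open>2 * (norm (y - X k))\<^sup>2 + 2 * R\<^sup>2\<close>. Moving the centre of the Gaussian
    to \<open>x\<close> thus halves 3/2 to 3/4 and costs the factor
    \<open>exp (3/2 * R\<^sup>2)\<close>.\<close>
  have "(\<lambda>k. LINT y|lborel. ?q (X k) y) \<longlonglongrightarrow> (LINT y|lborel. ?q x y)"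
  proof (rule integral_dominated_convergence[where w="\<lambda>y. (C * exp (3/2 * R\<^sup>2)) * exp (- (3/4 * (norm (- x + y))\<^sup>2))"])
    have "integrable lborel (\<lambda>y. exp (- (3/4 * (norm (- x + y))\<^sup>2)))"
      using lborel_shift(2)[of "\<lambda>y::'n phase. exp (- (3/4 * (norm y)\<^sup>2))" "- x"] gaussian_integrable[of "3/4", where 'a="'n phase"]
      by auto
    then show "integrable lborel (\<lambda>y. (C * exp (3/2 * R\<^sup>2)) * exp (- (3/4 * (norm (- x + y))\<^sup>2)))"
      by (rule integrable_mult_right)
    show "AE y in lborel. (\<lambda>k. ?q (X k) y) \<longlonglongrightarrow> ?q x y"
    proof (rule AE_I2)
      fix y
      have "(\<lambda>k. Q y (y - X k)) \<longlonglongrightarrow> Q y (y - x)"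
        unfolding Q_def
      proof (rule integral_dominated_convergence[where w="\<lambda>w. cmod (Hw y w)"])
        show "AE w in lborel. (\<lambda>k. Hw y w * exp (\<i> * of_real (sympl w (y - X k)))) \<longlonglongrightarrow> Hw y w * exp (\<i> * of_real (sympl w (y - x)))"
          unfolding sympl_def by (intro AE_I2 tendsto_intros X)
        show "integrable lborel (\<lambda>w. cmod (Hw y w))" by (rule integrable_norm[OF Hw_integrable])
      qed (auto simp: norm_mult)
      then show "(\<lambda>k. ?q (X k) y) \<longlonglongrightarrow> ?q x y" by (intro tendsto_intros X)
    qed
    show "AE y in lborel. norm (?q (X k) y) \<le> (C * exp (3/2 * R\<^sup>2)) * exp (- (3/4 * (norm (- x + y))\<^sup>2))" for k
    proof (rule AE_I2)
      fix y
      let ?a = "norm (y - X k)" and ?b = "norm (X k - x)"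
      have b2: "?b\<^sup>2 \<le> R\<^sup>2" using R[of k] by (intro power_mono) auto
      have "norm (- x + y) \<le> ?a + ?b" using norm_triangle_ineq[of "y - X k" "X k - x"] by simp
      then have "(norm (- x + y))\<^sup>2 \<le> (?a + ?b)\<^sup>2" by (intro power_mono) auto
      also have "\<dots> \<le> 2 * ?a\<^sup>2 + 2 * ?b\<^sup>2"
        using sum_squares_bound[of ?a ?b] by (simp add: power2_sum)
      finally have "- (3/2 * ?a\<^sup>2) \<le> 3/2 * R\<^sup>2 + - (3/4 * (norm (- x + y))\<^sup>2)" using b2 by linarith
      then have "exp (- (3/2 * ?a\<^sup>2)) \<le> exp (3/2 * R\<^sup>2) * exp (- (3/4 * (norm (- x + y))\<^sup>2))"
        unfolding exp_add[symmetric] exp_le_cancel_iff .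
      then have "cmod (Q y (y - X k)) * exp (- (3/2 * ?a\<^sup>2)) \<le> C * (exp (3/2 * R\<^sup>2) * exp (- (3/4 * (norm (- x + y))\<^sup>2)))"
        by (intro mult_mono cmod_Q C_nonneg) auto
      then show "norm (?q (X k) y) \<le> (C * exp (3/2 * R\<^sup>2)) * exp (- (3/4 * (norm (- x + y))\<^sup>2))"
        unfolding norm_mult norm_of_real abs_exp_cancel by (simp only: mult.assoc)
    qed
    show "?q x \<in> borel_measurable lborel" "?q (X k) \<in> borel_measurable lborel" for k by measurable
  qed
  then have "(\<lambda>k. (LINT y|lborel. ?q (X k) y) / of_real (pi ^ (2 * CARD('n)))) \<longlonglongrightarrow> (LINT y|lborel. ?q x y) / of_real (pi ^ (2 * CARD('n)))"
    by (intro tendsto_intros) auto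
  then show "(\<lambda>k. G (X k)) \<longlonglongrightarrow> G x"
    unfolding G_eq_integral_Q[symmetric] by simp
qed

end

subsection \<open>The resolution of the identity\<close>

text \<open>The parallelogram law for the moduli and bilinearity of \<open>sympl\<close> for the
  phases. The whole dependence on \<open>Y\<close> is the kernel of \<open>Hw_reproducing\<close>
  centred at the midpoint \<open>x\<close>, which is how the symbol of an anti-Wick form meets the
  mean value property.\<close>

lemma coherent_product:
  fixes x z Y :: "'n::finite phase"
  shows "L2_inner (coherent_state (x + z)) (coherent_state Y) * L2_inner (coherent_state Y) (coherent_state (x - z)) =
    L2_inner (coherent_state (x + z)) (coherent_state (x - z)) * of_real (exp ((norm z)\<^sup>2 / 2)) *
    (exp (\<i> * of_real (sympl z (Y - x))) * of_real (exp (- (1/2 * (norm (Y - x))\<^sup>2))))"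
proof -
  have r: "- (norm (x + z - Y))\<^sup>2 / 4 + - (norm (Y - (x - z)))\<^sup>2 / 4 =
      - (norm (x + z - (x - z)))\<^sup>2 / 4 + (norm z)\<^sup>2 / 2 + - (1/2 * (norm (Y - x))\<^sup>2)"
    unfolding power2_norm_eq_inner by (simp add: inner_simps inner_commute field_simps)
  have i: "sympl (x + z) Y + sympl Y (x - z) = sympl (x + z) (x - z) + 2 * sympl z (Y - x)"
    using sympl_anti[of Y x] sympl_anti[of Y z] sympl_anti[of x z] by (simp add: sympl_bilinear)
  let ?q = "\<lambda>s. \<i> / 2 * complex_of_real s"
  have "L2_inner (coherent_state (x + z)) (coherent_state Y) * L2_inner (coherent_state Y) (coherent_state (x - z)) =
     exp (of_real (- (norm (x + z - Y))\<^sup>2 / 4 + - (norm (Y - (x - z)))\<^sup>2 / 4) + ?q (sympl (x + z) Y + sympl Y (x - z)))"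
    unfolding coherent_state_inner exp_add[symmetric] by (simp add: algebra_simps)
  also have "\<dots> = exp (of_real (- (norm (x + z - (x - z)))\<^sup>2 / 4) + ?q (sympl (x + z) (x - z)) + of_real ((norm z)\<^sup>2 / 2)
     + (\<i> * of_real (sympl z (Y - x)) + of_real (- (1/2 * (norm (Y - x))\<^sup>2))))"
    unfolding r i by (rule arg_cong[where f=exp]) (simp add: algebra_simps)
  finally show ?thesis
    unfolding coherent_state_inner exp_add exp_of_real .
qed

lemma half_sum_diff:
  fixes a b :: "'a::real_vector"
  obtains x z where "a = x + z" "b = x - z"
proof
  show "a = (1/2) *\<^sub>R (a + b) + (1/2) *\<^sub>R (a - b)" "b = (1/2) *\<^sub>R (a + b) - (1/2) *\<^sub>R (a - b)"
    by (simp_all add: algebra_simps flip: scaleR_add_left)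
qed

text \<open>The case of the constant symbol 1. By \<open>coherent_product\<close> the integrand is a
  Gaussian with a linear phase, whose integral supplies the factor that cancels
  \<open>exp ((norm z)\<^sup>2 / 2)\<close>.\<close>

lemma coherent_resolution:
  fixes a b :: "'n::finite phase"
  shows "integrable lborel (\<lambda>Y. L2_inner (coherent_state a) (coherent_state Y) * L2_inner (coherent_state Y) (coherent_state b))" (is ?int)
    and "(LINT Y|lborel. L2_inner (coherent_state a) (coherent_state Y) * L2_inner (coherent_state Y) (coherent_state b)) =
      of_real ((2 * pi) ^ CARD('n)) * L2_inner (coherent_state a) (coherent_state b)" (is ?val)
proof -
  obtain x z where ab: "a = x + z" "b = x - z" by (rule half_sum_diff)
  let ?E = "L2_inner (coherent_state a) (coherent_state b) * of_real (exp ((norm z)\<^sup>2 / 2))"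
  let ?g = "\<lambda>v::'n phase. exp (- of_real (1/2 * (norm v)\<^sup>2) + \<i> * of_real (v \<bullet> (- cxJ z)))"
  have eq: "L2_inner (coherent_state a) (coherent_state Y) * L2_inner (coherent_state Y) (coherent_state b) = ?E * ?g (- x + Y)" for Y
  proof -
    have "sympl z (Y - x) = (- x + Y) \<bullet> (- cxJ z)"
      using inner_cxJ(2)[of "- x + Y" z] by (simp add: sympl_cxJ inner_commute)
    then have "exp (\<i> * of_real (sympl z (Y - x))) * of_real (exp (- (1/2 * (norm (Y - x))\<^sup>2))) = ?g (- x + Y)"
      unfolding exp_add by (simp add: exp_of_real[symmetric])
    then show ?thesis unfolding ab coherent_product by simp
  qed
  have m: "?g \<in> borel_measurable borel" by measurable
  have "integrable lborel ?g" by (rule gaussian_integral(1)) simp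
  then show ?int unfolding eq using lborel_shift(2)[OF m, of "- x"] by (intro integrable_mult_right) simp
  have "(LINT Y|lborel. ?E * ?g (- x + Y)) = ?E * (LINT v|lborel. ?g v)"
    unfolding integral_mult_right_zero lborel_shift(1)[OF m, of "- x"] ..
  also have "(LINT v|lborel. ?g v) = of_real (sqrt (pi / (1/2)) ^ DIM('n phase) * exp (- (norm (- cxJ z))\<^sup>2 / (4 * (1/2))))"
    by (rule gaussian_integral(2)) simp
  also have "sqrt (pi / (1/2)) ^ DIM('n phase) = (2 * pi) ^ CARD('n)"
  proof -
    have "DIM('n phase) = 2 * CARD('n)" by simp
    then show ?thesis by (simp only: power_mult) (simp add: mult.commute)
  qed
  also have "(norm (- cxJ z))\<^sup>2 = (norm z)\<^sup>2"
    by (simp add: power2_norm_eq_inner inner_cxJ(1))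
  also have "?E * of_real ((2 * pi) ^ CARD('n) * exp (- (norm z)\<^sup>2 / (4 * (1/2)))) =
      of_real ((2 * pi) ^ CARD('n)) * L2_inner (coherent_state a) (coherent_state b) * of_real (exp ((norm z)\<^sup>2 / 2) * exp (- (norm z)\<^sup>2 / 2))"
    by simp
  also have "exp ((norm z)\<^sup>2 / 2) * exp (- (norm z)\<^sup>2 / 2) = 1" by (simp flip: exp_add)
  finally show ?val unfolding eq by simp
qed

lemma coherent_transform_continuous:
  fixes f :: "real ^ 'n::finite \<Rightarrow> complex"
  assumes f: "f \<in> L2_space"
  shows "continuous_on UNIV (\<lambda>Z. L2_inner f (coherent_state Z))"
  unfolding continuous_on_def
proof
  fix Z :: "'n phase"
  have "((\<lambda>X. L2_norm f * L2_norm (\<lambda>u. coherent_state X u - coherent_state Z u)) \<longlongrightarrow> L2_norm f * 0) (at Z)"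
    by (intro tendsto_intros coherent_state_tendsto tendsto_ident_at)
  then have lim: "((\<lambda>X. L2_norm f * L2_norm (\<lambda>u. coherent_state X u - coherent_state Z u)) \<longlongrightarrow> 0) (at Z)"
    by simp
  have "cmod (L2_inner f (coherent_state X) - L2_inner f (coherent_state Z)) \<le>
      L2_norm f * L2_norm (\<lambda>u. coherent_state X u - coherent_state Z u)" for X
    unfolding L2_inner_diff(2)[OF coherent_state_L2 coherent_state_L2 f, symmetric]
    by (rule L2_inner_le[OF f L2_diff[OF coherent_state_L2 coherent_state_L2]])
  then show "((\<lambda>Z. L2_inner f (coherent_state Z)) \<longlongrightarrow> L2_inner f (coherent_state Z)) (at Z)"
    using Lim_null_comparison[OF _ lim, of "\<lambda>X. L2_inner f (coherent_state X) - L2_inner f (coherent_state Z)"]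
    by (simp add: LIM_zero_iff)
qed

lemma coherent_transform_measurable [measurable]:
  "f \<in> L2_space \<Longrightarrow> (\<lambda>Z. L2_inner f (coherent_state Z)) \<in> borel_measurable borel"
  by (rule borel_measurable_continuous_onI[OF coherent_transform_continuous])

lemma coherent_span_resolution:
  fixes f g :: "real ^ 'n::finite \<Rightarrow> complex"
  assumes "f \<in> coherent_span" "g \<in> coherent_span"
  shows "integrable lborel (\<lambda>Y. L2_inner f (coherent_state Y) * L2_inner (coherent_state Y) g) \<and>
    (LINT Y|lborel. L2_inner f (coherent_state Y) * L2_inner (coherent_state Y) g) =
      of_real ((2 * pi) ^ CARD('n)) * L2_inner f g"
  using assms
proof (induction f arbitrary: g)
  case (base Z)
  from base.prems show ?case
  proof induction
    case (base Z')
    then show ?case using coherent_resolution by blast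
  next
    case (add f g)
    then show ?case by (simp add: L2_inner_add coherent_span_L2 distrib_left)
  next
    case (cmult f c)
    then show ?case by (simp add: L2_inner_cmult mult.left_commute)
  qed
next
  case (add f f')
  then show ?case by (simp add: L2_inner_add coherent_span_L2 distrib_left distrib_right)
next
  case (cmult f c)
  then show ?case by (simp add: L2_inner_cmult mult.assoc mult.left_commute)
qed

lemma coherent_span_approx_seq:
  assumes f: "f \<in> L2_space"
  obtains s where "\<And>k. s k \<in> coherent_span" "(\<lambda>k. L2_norm (\<lambda>u. f u - s k u)) \<longlonglongrightarrow> 0"
proof -
  have "\<exists>g\<in>coherent_span. L2_norm (\<lambda>u. f u - g u) < inverse (real (Suc k))" for k
    using coherent_closure_approx[OF coherent_closure_eq_L2[OF f], of "inverse (real (Suc k))"] by auto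
  then obtain s where s: "\<And>k. s k \<in> coherent_span" "\<And>k. L2_norm (\<lambda>u. f u - s k u) < inverse (real (Suc k))"
    by metis
  have "(\<lambda>k. L2_norm (\<lambda>u. f u - s k u)) \<longlonglongrightarrow> 0"
  proof (rule tendsto_sandwich[OF _ _ tendsto_const LIMSEQ_inverse_real_of_nat])
    show "\<forall>\<^sub>F k in sequentially. L2_norm (\<lambda>u. f u - s k u) \<le> inverse (real (Suc k))"
      using s(2) by (intro always_eventually) (auto intro: less_imp_le)
  qed auto
  with s(1) show ?thesis by (rule that)
qed

text \<open>On the span the resolution of the identity gives equality. Approximation from the span
  and Fatou's lemma carry it to all \<open>f\<close> as an inequality, the form in which
  Cauchy-Schwarz uses it for anti-Wick forms.\<close>

lemma coherent_transform_L2: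
  fixes f :: "real ^ 'n::finite \<Rightarrow> complex"
  assumes f: "f \<in> L2_space"
  shows "integrable lborel (\<lambda>Y. (cmod (L2_inner f (coherent_state Y)))\<^sup>2)"
    and "(LINT Y|lborel. (cmod (L2_inner f (coherent_state Y)))\<^sup>2) \<le> (2 * pi) ^ CARD('n) * (L2_norm f)\<^sup>2"
proof -
  let ?c = "(2 * pi) ^ CARD('n)"
  have span: "(\<integral>\<^sup>+Y. ennreal ((cmod (L2_inner g (coherent_state Y)))\<^sup>2) \<partial>lborel) = ennreal (?c * (L2_norm g)\<^sup>2)"
    if g: "g \<in> coherent_span" for g :: "real ^ 'n \<Rightarrow> complex"
  proof -
    have eq: "L2_inner g (coherent_state Y) * L2_inner (coherent_state Y) g = of_real ((cmod (L2_inner g (coherent_state Y)))\<^sup>2)" for Y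
      unfolding L2_inner_cnj[of "coherent_state Y" g] complex_norm_square ..
    have "integrable lborel (\<lambda>Y. complex_of_real ((cmod (L2_inner g (coherent_state Y)))\<^sup>2))"
      and "(LINT Y|lborel. complex_of_real ((cmod (L2_inner g (coherent_state Y)))\<^sup>2)) = of_real (?c * (L2_norm g)\<^sup>2)"
      using coherent_span_resolution[OF g g] unfolding eq L2_inner_self by (simp_all only: of_real_mult)
    then have "integrable lborel (\<lambda>Y. (cmod (L2_inner g (coherent_state Y)))\<^sup>2)"
      and "(LINT Y|lborel. (cmod (L2_inner g (coherent_state Y)))\<^sup>2) = ?c * (L2_norm g)\<^sup>2"
      unfolding complex_of_real_integrable_eq integral_complex_of_real of_real_eq_iff by simp_all
    then show ?thesis by (subst nn_integral_eq_integral) auto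
  qed
  obtain s where s: "\<And>k. s k \<in> coherent_span" "(\<lambda>k. L2_norm (\<lambda>u. f u - s k u)) \<longlonglongrightarrow> 0"
    using coherent_span_approx_seq[OF f] by blast
  note s2 = coherent_span_L2[OF s(1)]
  have lim: "(\<lambda>k. L2_inner (s k) h) \<longlonglongrightarrow> L2_inner f h" if h: "h \<in> L2_space" for h
  proof -
    have "(\<lambda>k. L2_norm (\<lambda>u. f u - s k u) * L2_norm h) \<longlonglongrightarrow> 0 * L2_norm h"
      by (intro tendsto_intros s)
    then have l: "(\<lambda>k. L2_norm (\<lambda>u. f u - s k u) * L2_norm h) \<longlonglongrightarrow> 0" by simp
    have "(\<lambda>k. L2_inner f h - L2_inner (s k) h) \<longlonglongrightarrow> 0"
      by (rule Lim_null_comparison[OF always_eventually l])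
        (auto simp: L2_inner_diff(1)[OF f s2 h, symmetric] intro!: L2_inner_le L2_diff f s2 h)
    then have "(\<lambda>k. L2_inner f h - (L2_inner f h - L2_inner (s k) h)) \<longlonglongrightarrow> L2_inner f h - 0"
      by (intro tendsto_intros)
    then show ?thesis by simp
  qed
  have norm_lim: "(\<lambda>k. L2_norm f + L2_norm (\<lambda>u. f u - s k u)) \<longlonglongrightarrow> L2_norm f"
    using tendsto_add[OF tendsto_const s(2), of "L2_norm f"] by simp
  have nle: "L2_norm (s k) \<le> L2_norm f + L2_norm (\<lambda>u. f u - s k u)" for k
  proof -
    have "L2_norm (\<lambda>u. f u + (-1) * (f u - s k u)) \<le> L2_norm f + L2_norm (\<lambda>u. (-1) * (f u - s k u))"
      by (intro L2_norm_add L2_cmult L2_diff f s2)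
    then show ?thesis unfolding L2_norm_cmult by simp
  qed
  have "(\<integral>\<^sup>+Y. ennreal ((cmod (L2_inner f (coherent_state Y)))\<^sup>2) \<partial>lborel) =
     (\<integral>\<^sup>+Y. liminf (\<lambda>k. ennreal ((cmod (L2_inner (s k) (coherent_state Y)))\<^sup>2)) \<partial>lborel)"
  proof (rule nn_integral_cong)
    fix Y
    have "(\<lambda>k. ennreal ((cmod (L2_inner (s k) (coherent_state Y)))\<^sup>2)) \<longlonglongrightarrow> ennreal ((cmod (L2_inner f (coherent_state Y)))\<^sup>2)"
      by (intro tendsto_ennrealI tendsto_intros lim coherent_state_L2)
    from lim_imp_Liminf[OF _ this]
    show "ennreal ((cmod (L2_inner f (coherent_state Y)))\<^sup>2) = liminf (\<lambda>k. ennreal ((cmod (L2_inner (s k) (coherent_state Y)))\<^sup>2))"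
      by simp
  qed
  also have "\<dots> \<le> liminf (\<lambda>k. \<integral>\<^sup>+Y. ennreal ((cmod (L2_inner (s k) (coherent_state Y)))\<^sup>2) \<partial>lborel)"
    using s2 by (intro nn_integral_liminf) measurable
  also have "\<dots> \<le> liminf (\<lambda>k. ennreal (?c * (L2_norm f + L2_norm (\<lambda>u. f u - s k u))\<^sup>2))"
    unfolding span[OF s(1)]
    by (intro Liminf_mono always_eventually allI ennreal_leI mult_left_mono power_mono nle) auto
  also have "\<dots> = ennreal (?c * (L2_norm f)\<^sup>2)"
    by (rule lim_imp_Liminf) (auto intro!: tendsto_ennrealI tendsto_intros norm_lim)
  finally have le: "(\<integral>\<^sup>+Y. ennreal ((cmod (L2_inner f (coherent_state Y)))\<^sup>2) \<partial>lborel) \<le> ennreal (?c * (L2_norm f)\<^sup>2)" .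
  have m: "(\<lambda>Y. (cmod (L2_inner f (coherent_state Y)))\<^sup>2) \<in> borel_measurable lborel"
    using f by measurable
  show int: "integrable lborel (\<lambda>Y. (cmod (L2_inner f (coherent_state Y)))\<^sup>2)"
  proof (rule integrableI_bounded[OF m])
    show "(\<integral>\<^sup>+Y. ennreal (norm ((cmod (L2_inner f (coherent_state Y)))\<^sup>2)) \<partial>lborel) < \<infinity>"
      using le_less_trans[OF le] by simp
  qed
  show "(LINT Y|lborel. (cmod (L2_inner f (coherent_state Y)))\<^sup>2) \<le> ?c * (L2_norm f)\<^sup>2"
    using le nn_integral_eq_integral[OF int] by (simp add: ennreal_le_iff)
qed

text \<open>Totality is used in one slot at a time: first the right argument is released from the
  span, with the left one kept in it, and then the left.\<close>

lemma (in bounded_sesquilinear) eq_zero: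
  assumes coh: "\<And>X Z. B (coherent_state X) (coherent_state Z) = 0"
    and f: "f \<in> L2_space" and g: "g \<in> L2_space"
  shows "B f g = 0"
proof -
  have span: "B f g = 0" if "f \<in> coherent_span" "g \<in> coherent_span" for f g
    using that
  proof (induction f arbitrary: g)
    case (base Z)
    from base.prems show ?case
      by induction (auto simp: coh add_right cmult_right coherent_span_L2)
  qed (auto simp: add_left cmult_left coherent_span_L2)
  have right: "B f g = 0" if f: "f \<in> coherent_span" for f
  proof -
    obtain s where s: "\<And>k. s k \<in> coherent_span" "(\<lambda>k. L2_norm (\<lambda>u. g u - s k u)) \<longlonglongrightarrow> 0"
      using coherent_span_approx_seq[OF g] by blast
    have "(\<lambda>k. K * (L2_norm f * L2_norm (\<lambda>u. g u - s k u))) \<longlonglongrightarrow> K * (L2_norm f * 0)"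
      by (intro tendsto_intros s)
    moreover have "cmod (B f g) \<le> K * (L2_norm f * L2_norm (\<lambda>u. g u - s k u))" for k
      using bounded[OF coherent_span_L2[OF f] L2_diff[OF g coherent_span_L2[OF s(1)], of k]]
        diff_right[OF g coherent_span_L2[OF s(1)] coherent_span_L2[OF f], of k] span[OF f s(1), of k] by simp
    ultimately have "cmod (B f g) \<le> K * (L2_norm f * 0)"
      by (intro LIMSEQ_le_const) auto
    then show ?thesis by simp
  qed
  obtain s where s: "\<And>k. s k \<in> coherent_span" "(\<lambda>k. L2_norm (\<lambda>u. f u - s k u)) \<longlonglongrightarrow> 0"
    using coherent_span_approx_seq[OF f] by blast
  have "(\<lambda>k. K * (L2_norm (\<lambda>u. f u - s k u) * L2_norm g)) \<longlonglongrightarrow> K * (0 * L2_norm g)"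
    by (intro tendsto_intros s)
  moreover have "cmod (B f g) \<le> K * (L2_norm (\<lambda>u. f u - s k u) * L2_norm g)" for k
    using bounded[OF L2_diff[OF f coherent_span_L2[OF s(1)], of k] g]
      diff_left[OF f coherent_span_L2[OF s(1)] g, of k] right[OF s(1), of k] by simp
  ultimately have "cmod (B f g) \<le> K * (0 * L2_norm g)"
    by (intro LIMSEQ_le_const) auto
  then show ?thesis by simp
qed

section \<open>Anti-Wick operators as sesquilinear forms\<close>

definition anti_Wick_form ::
  "('n::finite phase \<Rightarrow> complex) \<Rightarrow> (real ^ 'n \<Rightarrow> complex) \<Rightarrow> (real ^ 'n \<Rightarrow> complex) \<Rightarrow> complex" where
  "anti_Wick_form G f g = of_real (1 / (2 * pi) ^ CARD('n)) *
     (LINT Z|lborel. G Z * L2_inner f (coherent_state Z) * L2_inner (coherent_state Z) g)"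

text \<open>Cauchy-Schwarz on phase space, with \<open>G\<close> attached to the first transform.
  Each of the two transforms contributes the square root of \<open>(2 * pi) ^ CARD('n)\<close>; the
  normalisation of the form cancels their product, so a bound for \<open>G\<close> is also one for
  the form.\<close>

lemma bounded_sesquilinear_anti_Wick_form:
  fixes G :: "'n::finite phase \<Rightarrow> complex"
  assumes G [measurable]: "G \<in> borel_measurable borel" and M: "\<And>Z. cmod (G Z) \<le> M"
  shows "bounded_sesquilinear (anti_Wick_form G) M"
proof -
  let ?c = "(2 * pi) ^ CARD('n)"
  have M0: "M \<ge> 0" using M[of 0] norm_ge_zero[of "G 0"] by linarith
  have *: "integrable lborel (\<lambda>Z. G Z * L2_inner f (coherent_state Z) * L2_inner (coherent_state Z) g) \<and>
      cmod (anti_Wick_form G f g) \<le> M * (L2_norm f * L2_norm g)"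
    if f: "f \<in> L2_space" and g: "g \<in> L2_space" for f g :: "real ^ 'n \<Rightarrow> complex"
  proof -
    let ?f = "\<lambda>Z. L2_inner f (coherent_state Z)" and ?g = "\<lambda>Z. L2_inner (coherent_state Z) g"
    have g_cnj: "?g Z = cnj (L2_inner g (coherent_state Z))" for Z by (rule L2_inner_cnj)
    have fm [measurable]: "?f \<in> borel_measurable borel" using f by measurable
    have gm [measurable]: "?g \<in> borel_measurable borel" unfolding g_cnj using g by measurable
    have Gle: "(cmod (G Z * ?f Z))\<^sup>2 \<le> M\<^sup>2 * (cmod (?f Z))\<^sup>2" for Z
      unfolding norm_mult power_mult_distrib by (intro mult_right_mono power_mono M) auto
    have i0: "integrable lborel (\<lambda>Z. M\<^sup>2 * (cmod (?f Z))\<^sup>2)"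
      by (intro integrable_mult_right coherent_transform_L2 f)
    have i1: "integrable lborel (\<lambda>Z. (cmod (G Z * ?f Z))\<^sup>2)"
      by (rule Bochner_Integration.integrable_bound[OF i0]) (use Gle in auto)
    have i2: "integrable lborel (\<lambda>Z. (cmod (?g Z))\<^sup>2)" and n2: "(LINT Z|lborel. (cmod (?g Z))\<^sup>2) \<le> ?c * (L2_norm g)\<^sup>2"
      using coherent_transform_L2[OF g] unfolding g_cnj by simp_all
    have n1: "(LINT Z|lborel. (cmod (G Z * ?f Z))\<^sup>2) \<le> M\<^sup>2 * (?c * (L2_norm f)\<^sup>2)"
    proof -
      have "(LINT Z|lborel. (cmod (G Z * ?f Z))\<^sup>2) \<le> (LINT Z|lborel. M\<^sup>2 * (cmod (?f Z))\<^sup>2)"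
        by (intro integral_mono i1 i0 Gle)
      also have "\<dots> = M\<^sup>2 * (LINT Z|lborel. (cmod (?f Z))\<^sup>2)" by (rule integral_mult_right_zero)
      also have "\<dots> \<le> M\<^sup>2 * (?c * (L2_norm f)\<^sup>2)"
        by (intro mult_left_mono coherent_transform_L2 f) simp
      finally show ?thesis .
    qed
    have m1: "(\<lambda>Z. G Z * ?f Z) \<in> borel_measurable lborel" "?g \<in> borel_measurable lborel" by measurable
    note CS = L2_integral_Cauchy_Schwarz[OF m1 i1 i2]
    have "cmod (LINT Z|lborel. G Z * ?f Z * ?g Z) \<le> sqrt (M\<^sup>2 * (?c * (L2_norm f)\<^sup>2)) * sqrt (?c * (L2_norm g)\<^sup>2)"
      by (rule order_trans[OF CS(2)], intro mult_mono real_sqrt_le_mono n1 n2) auto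
    also have "\<dots> = ?c * (M * (L2_norm f * L2_norm g))"
    proof -
      have "sqrt (M\<^sup>2 * (c * a\<^sup>2)) * sqrt (c * b\<^sup>2) = c * (M * (a * b))"
        if "c \<ge> 0" "a \<ge> 0" "b \<ge> 0" for a b c :: real
        using that M0 by (simp add: real_sqrt_mult)
      then show ?thesis by simp
    qed
    finally have "cmod (LINT Z|lborel. G Z * ?f Z * ?g Z) \<le> ?c * (M * (L2_norm f * L2_norm g))" .
    then have "cmod (anti_Wick_form G f g) \<le> M * (L2_norm f * L2_norm g)"
      unfolding anti_Wick_form_def norm_mult[of "of_real _"] norm_of_real by (simp add: field_simps)
    with CS(1) show ?thesis by blast
  qed
  show ?thesis
  proof
    show "anti_Wick_form G (\<lambda>u. f u + g u) h = anti_Wick_form G f h + anti_Wick_form G g h"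
      if "f \<in> L2_space" "g \<in> L2_space" "h \<in> L2_space" for f g h
    proof -
      have "(LINT Z|lborel. G Z * L2_inner (\<lambda>u. f u + g u) (coherent_state Z) * L2_inner (coherent_state Z) h) =
          (LINT Z|lborel. G Z * L2_inner f (coherent_state Z) * L2_inner (coherent_state Z) h +
            G Z * L2_inner g (coherent_state Z) * L2_inner (coherent_state Z) h)"
        using that by (simp add: L2_inner_add distrib_left distrib_right)
      also have "\<dots> = (LINT Z|lborel. G Z * L2_inner f (coherent_state Z) * L2_inner (coherent_state Z) h) +
          (LINT Z|lborel. G Z * L2_inner g (coherent_state Z) * L2_inner (coherent_state Z) h)"
        using *[OF that(1,3)] *[OF that(2,3)] by (intro Bochner_Integration.integral_add) blast+
      finally show ?thesis by (simp only: anti_Wick_form_def distrib_left)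
    qed
    show "anti_Wick_form G h (\<lambda>u. f u + g u) = anti_Wick_form G h f + anti_Wick_form G h g"
      if "f \<in> L2_space" "g \<in> L2_space" "h \<in> L2_space" for f g h
    proof -
      have "(LINT Z|lborel. G Z * L2_inner h (coherent_state Z) * L2_inner (coherent_state Z) (\<lambda>u. f u + g u)) =
          (LINT Z|lborel. G Z * L2_inner h (coherent_state Z) * L2_inner (coherent_state Z) f +
            G Z * L2_inner h (coherent_state Z) * L2_inner (coherent_state Z) g)"
        using that by (simp add: L2_inner_add distrib_left)
      also have "\<dots> = (LINT Z|lborel. G Z * L2_inner h (coherent_state Z) * L2_inner (coherent_state Z) f) +
          (LINT Z|lborel. G Z * L2_inner h (coherent_state Z) * L2_inner (coherent_state Z) g)"
        using *[OF that(3,1)] *[OF that(3,2)] by (intro Bochner_Integration.integral_add) blast+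
      finally show ?thesis by (simp only: anti_Wick_form_def distrib_left)
    qed
    show "anti_Wick_form G (\<lambda>u. c * f u) h = c * anti_Wick_form G f h" for c f h
    proof -
      have "G Z * L2_inner (\<lambda>u. c * f u) (coherent_state Z) * L2_inner (coherent_state Z) h =
          c * (G Z * L2_inner f (coherent_state Z) * L2_inner (coherent_state Z) h)" for Z
        unfolding L2_inner_cmult by (simp only: ac_simps)
      then show ?thesis
        unfolding anti_Wick_form_def by (simp only: integral_mult_right_zero mult.left_commute)
    qed
    show "anti_Wick_form G h (\<lambda>u. c * f u) = cnj c * anti_Wick_form G h f" for c f h
    proof -
      have "G Z * L2_inner h (coherent_state Z) * L2_inner (coherent_state Z) (\<lambda>u. c * f u) =
          cnj c * (G Z * L2_inner h (coherent_state Z) * L2_inner (coherent_state Z) f)" for Z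
        unfolding L2_inner_cmult by (simp only: ac_simps)
      then show ?thesis
        unfolding anti_Wick_form_def by (simp only: integral_mult_right_zero mult.left_commute)
    qed
  qed (use * M0 in auto)
qed

lemma bounded_sesquilinear_eq:
  assumes "bounded_sesquilinear B K" "bounded_sesquilinear B' K'"
    and coh: "\<And>X Z. B (coherent_state X) (coherent_state Z) = B' (coherent_state X) (coherent_state Z)"
    and f: "f \<in> L2_space" and g: "g \<in> L2_space"
  shows "B f g = B' f g"
proof -
  interpret B: bounded_sesquilinear B K by fact
  interpret B': bounded_sesquilinear B' K' by fact
  interpret D: bounded_sesquilinear "\<lambda>f g. B f g - B' f g" "K + K'"
  proof
    show "cmod (B f g - B' f g) \<le> (K + K') * (L2_norm f * L2_norm g)"
      if "f \<in> L2_space" "g \<in> L2_space" for f g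
      using norm_triangle_ineq4[of "B f g" "B' f g"] B.bounded[OF that] B'.bounded[OF that]
      by (simp only: distrib_right)
  qed (auto simp: B.add_left B.add_right B.cmult_left B.cmult_right B'.add_left B'.add_right
      B'.cmult_left B'.cmult_right B.K_nonneg B'.K_nonneg algebra_simps)
  show ?thesis using D.eq_zero[OF _ f g] coh by simp
qed

text \<open>For two coherent states \<open>coherent_product\<close> turns the anti-Wick form into
  the integral evaluated by \<open>Hw_reproducing\<close>. Totality extends the agreement to all of
  L2.\<close>

lemma (in bounded_symbol) eq_anti_Wick_form:
  assumes f: "f \<in> L2_space" and g: "g \<in> L2_space"
  shows "B f g = anti_Wick_form G f g"
proof -
  have Gm [measurable]: "G \<in> borel_measurable borel" by (rule borel_measurable_continuous_onI[OF G_continuous])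
  have W: "bounded_sesquilinear (anti_Wick_form G) (C / (2 * pi) ^ CARD('n))"
    by (rule bounded_sesquilinear_anti_Wick_form[OF Gm cmod_G])
  have "B (coherent_state a) (coherent_state b) = anti_Wick_form G (coherent_state a) (coherent_state b)" for a b
  proof -
    obtain x z where ab: "a = x + z" "b = x - z" by (rule half_sum_diff)
    let ?ab = "L2_inner (coherent_state a) (coherent_state b)"
    let ?E = "?ab * of_real (exp ((norm z)\<^sup>2 / 2))"
    let ?g = "\<lambda>Y. G Y * exp (\<i> * of_real (sympl z (Y - x))) * of_real (exp (- (1/2 * (norm (Y - x))\<^sup>2)))"
    have eq: "G Y * L2_inner (coherent_state a) (coherent_state Y) * L2_inner (coherent_state Y) (coherent_state b) = ?E * ?g Y" for Y
      unfolding ab mult.assoc[of "G Y"] coherent_product by (simp only: ac_simps)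
    have m: "?g \<in> borel_measurable borel" by measurable
    have "(LINT Y|lborel. ?E * ?g Y) = ?E * (LINT Y|lborel. ?g (x + Y))"
      unfolding integral_mult_right_zero lborel_shift(1)[OF m, of x] ..
    also have "(LINT Y|lborel. ?g (x + Y)) = of_real ((2 * pi) ^ CARD('n)) * Hw x z"
      using Hw_reproducing[of x z] by simp
    finally have "anti_Wick_form G (coherent_state a) (coherent_state b) =
        of_real (1 / (2 * pi) ^ CARD('n)) * (?E * (of_real ((2 * pi) ^ CARD('n)) * Hw x z))"
      unfolding anti_Wick_form_def eq by (simp only:)
    also have "\<dots> = ?E * Hw x z" by simp
    \<comment> \<open>The Gaussian inside \<open>Hw\<close> cancels the one produced by
      \<open>coherent_product\<close>, and \<open>?ab\<close> cancels the denominator of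
      \<open>H\<close>.\<close>
    also have "\<dots> = ?ab * H a b * of_real (exp ((norm z)\<^sup>2 / 2) * exp (- (norm z)\<^sup>2 / 2))"
      unfolding Hw_def ab of_real_mult by (simp only: ac_simps)
    also have "exp ((norm z)\<^sup>2 / 2) * exp (- (norm z)\<^sup>2 / 2) = 1" by (simp flip: exp_add)
    also have "?ab * H a b * of_real 1 = B (coherent_state a) (coherent_state b)"
      by (simp add: H_def coherent_state_inner)
    finally show ?thesis by simp
  qed
  from bounded_sesquilinear_eq[OF _ W this f g] show ?thesis
    using bounded_sesquilinear_axioms by blast
qed

text \<open>Additivity and homogeneity of \<open>A\<close> hold only almost everywhere; passing to
  inner products turns them into exact identities.\<close>

lemma bounded_sesquilinear_operator:
  fixes A :: "(real ^ 'n::finite \<Rightarrow> complex) \<Rightarrow> (real ^ 'n \<Rightarrow> complex)"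
  assumes A: "bounded_L2_operator A"
  obtains K where "bounded_sesquilinear (\<lambda>f g. L2_inner (A f) g) K"
proof -
  have AL: "A f \<in> L2_space" if "f \<in> L2_space" for f using A that by (auto simp: bounded_L2_operator_def)
  have "\<exists>C. \<forall>f\<in>L2_space. L2_norm (A f) \<le> C * L2_norm f"
    using A by (simp add: bounded_L2_operator_def)
  then obtain C where C: "\<And>f. f \<in> L2_space \<Longrightarrow> L2_norm (A f) \<le> C * L2_norm f"
    by blast
  have "bounded_sesquilinear (\<lambda>f g. L2_inner (A f) g) \<bar>C\<bar>"
  proof
    fix f g h :: "real ^ 'n \<Rightarrow> complex" and c :: complex
    assume f: "f \<in> L2_space" and h: "h \<in> L2_space"
    show "L2_inner (A (\<lambda>u. c * f u)) h = c * L2_inner (A f) h"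
    proof -
      have "L2_inner (A (\<lambda>u. c * f u)) h = L2_inner (\<lambda>u. c * A f u) h"
        using A f by (intro L2_inner_cong_AE AL L2_cmult h) (auto simp: bounded_L2_operator_def)
      then show ?thesis by (simp only: L2_inner_cmult)
    qed
    show "L2_inner (A h) (\<lambda>u. c * f u) = cnj c * L2_inner (A h) f" by (rule L2_inner_cmult)
    show "cmod (L2_inner (A f) h) \<le> \<bar>C\<bar> * (L2_norm f * L2_norm h)"
    proof -
      have "cmod (L2_inner (A f) h) \<le> L2_norm (A f) * L2_norm h" by (intro L2_inner_le AL f h)
      also have "\<dots> \<le> (\<bar>C\<bar> * L2_norm f) * L2_norm h"
      proof (rule mult_right_mono)
        have "C * L2_norm f \<le> \<bar>C\<bar> * L2_norm f" by (intro mult_right_mono) auto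
        with C[OF f] show "L2_norm (A f) \<le> \<bar>C\<bar> * L2_norm f" by linarith
      qed simp
      finally show ?thesis by (simp only: mult.assoc)
    qed
    assume g: "g \<in> L2_space"
    show "L2_inner (A (\<lambda>u. f u + g u)) h = L2_inner (A f) h + L2_inner (A g) h"
    proof -
      have "L2_inner (A (\<lambda>u. f u + g u)) h = L2_inner (\<lambda>u. A f u + A g u) h"
        using A f g by (intro L2_inner_cong_AE AL L2_add h) (auto simp: bounded_L2_operator_def)
      then show ?thesis by (simp only: L2_inner_add(1)[OF AL[OF f] AL[OF g] h])
    qed
    show "L2_inner (A h) (\<lambda>u. f u + g u) = L2_inner (A h) f + L2_inner (A h) g"
      by (intro L2_inner_add AL f g h)
  qed simp
  then show ?thesis by (rule that)
qed

theorem theorem1p3: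
  fixes A :: "(real ^ 'n \<Rightarrow> complex) \<Rightarrow> (real ^ 'n \<Rightarrow> complex)"
  assumes "bounded_L2_operator A"
    and "(SUP X :: (real ^ 'n) \<times> (real ^ 'n).
            ennreal (1 / (2 * pi) ^ CARD('n)) *
            (\<integral>\<^sup>+ Z. ennreal
               (cmod (L2_inner (A (coherent_state (X + Z))) (coherent_state (X - Z)) /
                      L2_inner (coherent_state (X + Z)) (coherent_state (X - Z))) *
                exp (- (norm Z)\<^sup>2 / 2)) \<partial>lborel)) < \<infinity>"
  shows "\<exists>G :: (real ^ 'n) \<times> (real ^ 'n) \<Rightarrow> complex.
           bounded (range G) \<and> continuous_on UNIV G \<and> is_anti_Wick G A \<and>
           (\<forall>X. G X =
              of_real (1 / (2 * pi) ^ CARD('n)) *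
              (LINT Z|lborel.
                 L2_inner (A (coherent_state (X + Z))) (coherent_state (X - Z)) /
                 L2_inner (coherent_state (X + Z)) (coherent_state (X - Z)) *
                 of_real (exp (- (norm Z)\<^sup>2 / 2))))"
proof -
  obtain K where K: "bounded_sesquilinear (\<lambda>f g. L2_inner (A f) g) K"
    using bounded_sesquilinear_operator[OF assms(1)] .
  interpret bounded_sesquilinear "\<lambda>f g. L2_inner (A f) g" K by (rule K)
  let ?c = "(2 * pi) ^ CARD('n)"
  define S where "S = (SUP X. ennreal (1 / ?c) * (\<integral>\<^sup>+Z. ennreal (cmod (Hw X Z)) \<partial>lborel))"
  have "S < \<infinity>"
    using assms(2) by (simp only: S_def Hw_def H_def norm_mult norm_of_real abs_exp_cancel)
  then obtain r where r: "S = ennreal r" "r \<ge> 0" by (cases S) auto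
  have "(\<integral>\<^sup>+Z. ennreal (cmod (Hw X Z)) \<partial>lborel) \<le> ennreal (?c * r)" for X
  proof -
    let ?I = "\<integral>\<^sup>+Z. ennreal (cmod (Hw X Z)) \<partial>lborel"
    have "?I = ennreal ?c * (ennreal (1 / ?c) * ?I)"
      unfolding mult.assoc[symmetric] by (simp flip: ennreal_mult)
    also have "ennreal (1 / ?c) * ?I \<le> ennreal r"
      unfolding r(1)[symmetric] S_def by (rule SUP_upper) simp
    then have "ennreal ?c * (ennreal (1 / ?c) * ?I) \<le> ennreal ?c * ennreal r" by (rule mult_left_mono) simp
    finally show ?thesis using r(2) by (simp add: ennreal_mult)
  qed
  \<comment> \<open>The supremum \<open>r\<close> includes the normalising factor and
    \<open>Hw_bound\<close> does not, hence the constant \<open>?c * r\<close>.\<close>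
  then interpret bounded_symbol "\<lambda>f g. L2_inner (A f) g" K "?c * r"
    by unfold_locales (use r(2) in auto)
  show ?thesis
  proof (intro exI[of _ G] conjI allI)
    show "bounded (range G)" unfolding bounded_iff using cmod_G by blast
    show "continuous_on UNIV G" by (rule G_continuous)
    show "is_anti_Wick G A"
      unfolding is_anti_Wick_def using assms(1) eq_anti_Wick_form by (simp add: anti_Wick_form_def)
  qed (simp only: G_def Hw_def H_def)
qed

end
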